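(* Let $M$ be a compact orientable $(2n+1)$-dimensional smooth manifold with a contact structure $\xi$; fix a contact form $\alpha$ on $M$ and the corresponding volume form $\Omega=\alpha\wedge (d\alpha)^n$. The functional on $\mathrm{CVect}^*(M)$ defined by $$\mathcal{I}: X_H\mapsto \int_M H^{-(n+1)}\,\Omega$$ is invariant. This functional is independent of the choice of the contact form.
   Context: A contact structure $\xi$ on a $(2n+1)$-dimensional smooth manifold $M$ ($n\ge 1$) is a codimension 1 distribution which is completely non-integrable; a contact form is a real 1-form $\alpha$ on $M$ with $\xi=\ker\alpha$ and $\alpha\wedge(d\alpha)^n\neq 0$ everywhere; it is defined up to multiplication by a nonvanishing function. Vector fields and functions are smooth with complex coefficients. Integration over $M$ is with respect to a fixed orientation of $M$. $\mathrm{CVect}(M)$ is the Lie algebra of contact vector fields, i.e. of vector fields $X$ with $L_X\alpha=f_X\alpha$ for some function $f_X$. Given $\alpha$, the map $X\mapsto H=\alpha(X)$ is a bijection from $\mathrm{CVect}(M)$ onto $C^\infty(M)$ (complex-valued smooth functions); $H$ is called the contact Hamiltonian of $X$ with respect to $\alpha$, and the contact vector field with contact Hamiltonian $H$ is denoted $X_H$. $\mathrm{CVect}^*(M)$ is the set of contact vector fields with nowhere vanishing contact Hamiltonian (this does not depend on the choice of $\alpha$). Invariant means invariant with respect to the (adjoint) action of the Lie algebra $\mathrm{CVect}(M)$: for every $V\in\mathrm{CVect}(M)$ and $X\in\mathrm{CVect}^*(M)$, $\frac{d}{dt}\big|_{t=0}\mathcal{I}(X+t[V,X])=0$. *)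

theory Defs
  imports "HOL-Analysis.Analysis"
begin

section \<open>Smooth functions on open sets\<close>

primrec differentiable_class ::
    "nat \<Rightarrow> ('a::real_normed_vector) set \<Rightarrow> ('a \<Rightarrow> 'b::real_normed_vector) \<Rightarrow> bool" where
  "differentiable_class 0 S f \<longleftrightarrow> continuous_on S f"
| "differentiable_class (Suc k) S f \<longleftrightarrow>
     (\<forall>x\<in>S. f differentiable (at x)) \<and>
     (\<forall>v. differentiable_class k S (\<lambda>x. frechet_derivative f (at x) v))"

text \<open>Meant for open \<open>S\<close>.\<close>

definition smooth_on ::
    "('a::real_normed_vector) set \<Rightarrow> ('a \<Rightarrow> 'b::real_normed_vector) \<Rightarrow> bool" where
  "smooth_on S f \<longleftrightarrow> (\<forall>k. differentiable_class k S f)"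

definition pderiv_at ::
    "'d \<Rightarrow> (real^'d::finite \<Rightarrow> 'b::real_normed_vector) \<Rightarrow> real^'d \<Rightarrow> 'b" where
  "pderiv_at j f x = frechet_derivative f (at x) (axis j 1)"


section \<open>Smooth manifolds\<close>

text \<open>A chart is a pair of its domain and its coordinate map; the values of the coordinate map
  outside the domain carry no meaning.\<close>

type_synonym ('m, 'd) chart = "'m set \<times> ('m \<Rightarrow> real^'d)"

abbreviation chart_dom :: "('m, 'd::finite) chart \<Rightarrow> 'm set" where
  "chart_dom c \<equiv> fst c"

abbreviation chart_map :: "('m, 'd::finite) chart \<Rightarrow> 'm \<Rightarrow> real^'d" where
  "chart_map c \<equiv> snd c"

abbreviation chart_inv :: "('m, 'd::finite) chart \<Rightarrow> real^'d \<Rightarrow> 'm" where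
  "chart_inv c \<equiv> inv_into (fst c) (snd c)"

abbreviation chart_image :: "('m, 'd::finite) chart \<Rightarrow> (real^'d) set" where
  "chart_image c \<equiv> snd c ` fst c"

definition is_chart :: "'m topology \<Rightarrow> ('m, 'd::finite) chart \<Rightarrow> bool" where
  "is_chart T c \<longleftrightarrow> openin T (chart_dom c) \<and> open (chart_image c) \<and>
     homeomorphic_map (subtopology T (chart_dom c)) (top_of_set (chart_image c)) (chart_map c)"

definition transition ::
    "('m, 'd::finite) chart \<Rightarrow> ('m, 'd) chart \<Rightarrow> real^'d \<Rightarrow> real^'d" where
  "transition c c' = chart_map c' \<circ> chart_inv c"

definition smooth_compatible :: "('m, 'd::finite) chart \<Rightarrow> ('m, 'd) chart \<Rightarrow> bool" where
  "smooth_compatible c c' \<longleftrightarrow>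
     smooth_on (chart_map c ` (chart_dom c \<inter> chart_dom c')) (transition c c') \<and>
     smooth_on (chart_map c' ` (chart_dom c \<inter> chart_dom c')) (transition c' c)"

text \<open>The dimension of the manifold is \<open>CARD('d)\<close>; the smooth structure is a maximal atlas.\<close>

definition smooth_manifold :: "'m topology \<Rightarrow> ('m, 'd::finite) chart set \<Rightarrow> bool" where
  "smooth_manifold T A \<longleftrightarrow>
     Hausdorff_space T \<and> second_countable T \<and>
     (\<forall>c\<in>A. is_chart T c) \<and> (\<Union>c\<in>A. chart_dom c) = topspace T \<and>
     (\<forall>c\<in>A. \<forall>c'\<in>A. smooth_compatible c c') \<and>
     (\<forall>c. is_chart T c \<and> (\<forall>c'\<in>A. smooth_compatible c c') \<longrightarrow> c \<in> A)"

definition smooth_function ::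
    "('m, 'd::finite) chart set \<Rightarrow> ('m \<Rightarrow> 'b::real_normed_vector) \<Rightarrow> bool" where
  "smooth_function A f \<longleftrightarrow> (\<forall>c\<in>A. smooth_on (chart_image c) (f \<circ> chart_inv c))"

definition jacobian ::
    "('m, 'd::finite) chart \<Rightarrow> ('m, 'd) chart \<Rightarrow> 'm \<Rightarrow> real^'d^'d" where
  "jacobian c c' p = matrix (frechet_derivative (transition c c') (at (chart_map c p)))"

text \<open>An orientation is given by an atlas of positively oriented charts.\<close>

definition orientation ::
    "'m topology \<Rightarrow> ('m, 'd::finite) chart set \<Rightarrow> ('m, 'd) chart set \<Rightarrow> bool" where
  "orientation T A P \<longleftrightarrow> P \<subseteq> A \<and> (\<Union>c\<in>P. chart_dom c) = topspace T \<and>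
     (\<forall>c\<in>P. \<forall>c'\<in>P. \<forall>p \<in> chart_dom c \<inter> chart_dom c'. det (jacobian c c' p) > 0)"


section \<open>Tangent vectors and vector fields\<close>

text \<open>A tangent vector at \<open>p\<close> is the family of its component vectors with respect to the charts
  around \<open>p\<close>, related by the Jacobian matrices of the transition maps (and set to \<open>0\<close> at all other
  charts, so that equality of tangent vectors is equality of families). For \<open>'k = real\<close> this is
  \<open>T\<^sub>pM\<close>, for \<open>'k = complex\<close> its complexification.\<close>

type_synonym ('m, 'd, 'k) tangent = "('m, 'd) chart \<Rightarrow> 'k^'d"

definition tangent_space ::
    "('m, 'd::finite) chart set \<Rightarrow> 'm \<Rightarrow> ('m, 'd, 'k::real_normed_field) tangent set" where
  "tangent_space A p = {v.
     (\<forall>c\<in>A. \<forall>c'\<in>A. p \<in> chart_dom c \<longrightarrow> p \<in> chart_dom c' \<longrightarrow>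
        v c' = (\<chi> i j. of_real (jacobian c c' p $ i $ j)) *v v c) \<and>
     (\<forall>c. c \<notin> A \<or> p \<notin> chart_dom c \<longrightarrow> v c = 0)}"

text \<open>The tangent vector at \<open>p\<close> whose component vector in the chart \<open>c\<close> is \<open>u\<close>.\<close>

definition tangent_of ::
    "('m, 'd::finite) chart set \<Rightarrow> ('m, 'd) chart \<Rightarrow> 'm \<Rightarrow> real^'d \<Rightarrow> ('m, 'd, real) tangent" where
  "tangent_of A c p u =
     (\<lambda>c'. if c' \<in> A \<and> p \<in> chart_dom c' then jacobian c c' p *v u else 0)"

type_synonym ('m, 'd) vfield = "'m \<Rightarrow> ('m, 'd, complex) tangent"

definition vfield_local ::
    "('m, 'd::finite) vfield \<Rightarrow> ('m, 'd) chart \<Rightarrow> real^'d \<Rightarrow> complex^'d" where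
  "vfield_local X c x = X (chart_inv c x) c"

definition vector_field ::
    "'m topology \<Rightarrow> ('m, 'd::finite) chart set \<Rightarrow> ('m, 'd) vfield \<Rightarrow> bool" where
  "vector_field T A X \<longleftrightarrow> (\<forall>p \<in> topspace T. X p \<in> tangent_space A p) \<and>
     (\<forall>c\<in>A. smooth_on (chart_image c) (vfield_local X c))"

text \<open>In coordinates, \<open>[V, X]\<^sub>i = \<Sum>\<^sub>j V\<^sub>j \<partial>\<^sub>jX\<^sub>i - X\<^sub>j \<partial>\<^sub>jV\<^sub>i\<close>.\<close>

definition lie_bracket ::
    "('m, 'd::finite) chart set \<Rightarrow> ('m, 'd) vfield \<Rightarrow> ('m, 'd) vfield \<Rightarrow> ('m, 'd) vfield" where
  "lie_bracket A V X = (\<lambda>p c. if c \<in> A \<and> p \<in> chart_dom c then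
     (\<chi> i. \<Sum>j\<in>UNIV. V p c $ j * pderiv_at j (vfield_local X c) (chart_map c p) $ i
                   - X p c $ j * pderiv_at j (vfield_local V c) (chart_map c p) $ i) else 0)"

definition vfield_add_scaled ::
    "('m, 'd::finite) vfield \<Rightarrow> real \<Rightarrow> ('m, 'd) vfield \<Rightarrow> ('m, 'd) vfield" where
  "vfield_add_scaled X t Y = (\<lambda>p c. X p c + t *\<^sub>R Y p c)"


section \<open>Differential forms\<close>

text \<open>A \<open>k\<close>-form on a vector space is a function of a sequence of vectors that depends only on its
  first \<open>k\<close> members. The wedge product is normalised such that
  \<open>dx\<^sub>1 \<and> \<dots> \<and> dx\<^sub>m\<close> takes the value \<open>1\<close> on the standard basis.\<close>

definition wedge :: "nat \<Rightarrow> nat \<Rightarrow> ((nat \<Rightarrow> 'v) \<Rightarrow> real) \<Rightarrow> ((nat \<Rightarrow> 'v) \<Rightarrow> real) \<Rightarrow> (nat \<Rightarrow> 'v) \<Rightarrow> real"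
  where
  "wedge k l \<omega> \<eta> v =
     (\<Sum>\<sigma> | \<sigma> permutes {..<k + l}.
        of_int (sign \<sigma>) * \<omega> (\<lambda>i. v (\<sigma> i)) * \<eta> (\<lambda>i. v (\<sigma> (k + i)))) / (fact k * fact l)"

primrec wedge_power :: "nat \<Rightarrow> ((nat \<Rightarrow> 'v) \<Rightarrow> real) \<Rightarrow> nat \<Rightarrow> (nat \<Rightarrow> 'v) \<Rightarrow> real" where
  "wedge_power k \<omega> 0 = (\<lambda>v. 1)"
| "wedge_power k \<omega> (Suc n) = wedge k (k * n) \<omega> (wedge_power k \<omega> n)"

text \<open>A 1-form on an open subset of \<open>\<real>\<^sup>d\<close> is given by its vector of components;
  \<open>ext_deriv a x\<close> is the 2-form \<open>(da)\<^sub>x (v\<^sub>0, v\<^sub>1) = (D\<^sub>v\<^sub>0 a) v\<^sub>1 - (D\<^sub>v\<^sub>1 a) v\<^sub>0\<close>.\<close>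

definition form1 :: "(real^'d::finite \<Rightarrow> real^'d) \<Rightarrow> real^'d \<Rightarrow> (nat \<Rightarrow> real^'d) \<Rightarrow> real" where
  "form1 a x v = a x \<bullet> v 0"

definition ext_deriv :: "(real^'d::finite \<Rightarrow> real^'d) \<Rightarrow> real^'d \<Rightarrow> (nat \<Rightarrow> real^'d) \<Rightarrow> real" where
  "ext_deriv a x v =
     frechet_derivative a (at x) (v 0) \<bullet> v 1 - frechet_derivative a (at x) (v 1) \<bullet> v 0"

definition std_frame :: "nat \<Rightarrow> real^'d::{finite,wellorder}" where
  "std_frame i = axis (sorted_list_of_set UNIV ! i) 1"

text \<open>For \<open>CARD('d) = 2 * n + 1\<close>, the function \<open>g\<close> with \<open>a \<and> (da)\<^sup>n = g dx\<^sub>1 \<and> \<dots> \<and> dx\<^sub>2\<^sub>n\<^sub>+\<^sub>1\<close>.\<close>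

definition contact_density ::
    "nat \<Rightarrow> (real^'d::{finite,wellorder} \<Rightarrow> real^'d::_) \<Rightarrow> real^'d::_ \<Rightarrow> real" where
  "contact_density n a x =
     wedge 1 (2 * n) (form1 a x) (wedge_power 2 (ext_deriv a x) n) std_frame"

text \<open>A real 1-form on the manifold assigns to every point \<open>p\<close> a linear functional on \<open>T\<^sub>pM\<close>.\<close>

type_synonym ('m, 'd) oneform = "'m \<Rightarrow> ('m, 'd, real) tangent \<Rightarrow> real"

definition oneform_local ::
    "('m, 'd::finite) chart set \<Rightarrow> ('m, 'd) oneform \<Rightarrow> ('m, 'd) chart \<Rightarrow> real^'d \<Rightarrow> real^'d" where
  "oneform_local A \<alpha> c x =
     (\<chi> j. \<alpha> (chart_inv c x) (tangent_of A c (chart_inv c x) (axis j 1)))"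

definition one_form ::
    "'m topology \<Rightarrow> ('m, 'd::finite) chart set \<Rightarrow> ('m, 'd) oneform \<Rightarrow> bool" where
  "one_form T A \<alpha> \<longleftrightarrow>
     (\<forall>p \<in> topspace T. \<forall>u \<in> tangent_space A p. \<forall>v \<in> tangent_space A p. \<forall>r s.
        \<alpha> p (\<lambda>c. r *\<^sub>R u c + s *\<^sub>R v c) = r * \<alpha> p u + s * \<alpha> p v) \<and>
     (\<forall>c\<in>A. smooth_on (chart_image c) (oneform_local A \<alpha> c))"

text \<open>The complex-linear extension of \<open>\<alpha>\<close> applied to a complex vector field.\<close>

definition oneform_apply ::
    "('m, 'd::finite) oneform \<Rightarrow> ('m, 'd) vfield \<Rightarrow> 'm \<Rightarrow> complex" where
  "oneform_apply \<alpha> X p =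
     Complex (\<alpha> p (\<lambda>c. \<chi> i. Re (X p c $ i))) (\<alpha> p (\<lambda>c. \<chi> i. Im (X p c $ i)))"

text \<open>In coordinates, \<open>(L\<^sub>X\<alpha>)\<^sub>j = \<Sum>\<^sub>i X\<^sub>i \<partial>\<^sub>i\<alpha>\<^sub>j + \<alpha>\<^sub>i \<partial>\<^sub>jX\<^sub>i\<close>.\<close>

definition lie_deriv_local ::
    "(real^'d::finite \<Rightarrow> complex^'d) \<Rightarrow> (real^'d \<Rightarrow> real^'d) \<Rightarrow> real^'d \<Rightarrow> complex^'d" where
  "lie_deriv_local X a x =
     (\<chi> j. \<Sum>i\<in>UNIV. X x $ i * of_real (pderiv_at i a x $ j)
                   + of_real (a x $ i) * pderiv_at j X x $ i)"


section \<open>Integration of top-degree forms\<close>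

definition partition_of_unity ::
    "'m topology \<Rightarrow> ('m, 'd::finite) chart set \<Rightarrow> ('m, 'd) chart set \<Rightarrow>
     nat \<Rightarrow> (nat \<Rightarrow> ('m, 'd) chart) \<Rightarrow> (nat \<Rightarrow> 'm \<Rightarrow> real) \<Rightarrow> bool" where
  "partition_of_unity T A P N \<kappa> \<rho> \<longleftrightarrow>
     (\<forall>i<N. \<kappa> i \<in> P \<and> smooth_function A (\<rho> i) \<and> (\<forall>p \<in> topspace T. \<rho> i p \<ge> 0) \<and>
        T closure_of {p \<in> topspace T. \<rho> i p \<noteq> 0} \<subseteq> chart_dom (\<kappa> i)) \<and>
     (\<forall>p \<in> topspace T. (\<Sum>i<N. \<rho> i p) = 1)"

text \<open>The integral over a compact manifold, with respect to the orientation \<open>P\<close>, of the complex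
  top-degree form which in each chart \<open>c\<close> is \<open>w c dx\<^sub>1 \<and> \<dots> \<and> dx\<^sub>d\<close>: the common value of the sums
  obtained from the finite partitions of unity subordinate to positively oriented charts.\<close>

definition form_integral ::
    "'m topology \<Rightarrow> ('m, 'd::finite) chart set \<Rightarrow> ('m, 'd) chart set \<Rightarrow>
     (('m, 'd) chart \<Rightarrow> real^'d \<Rightarrow> complex) \<Rightarrow> complex" where
  "form_integral T A P w = (THE I. \<exists>N \<kappa> \<rho>. partition_of_unity T A P N \<kappa> \<rho> \<and>
     I = (\<Sum>i<N. LINT x:chart_image (\<kappa> i)|lborel. \<rho> i (chart_inv (\<kappa> i) x) *\<^sub>R w (\<kappa> i) x))"


section \<open>Contact manifolds\<close>

text \<open>A contact structure is a hyperplane distribution which near every point is the kernel of a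
  1-form \<open>a\<close> with \<open>a \<and> (da)\<^sup>n \<noteq> 0\<close> (complete non-integrability); the latter implies \<open>a \<noteq> 0\<close>, hence
  codimension 1. The atlas being maximal, chart domains can be taken arbitrarily small.\<close>

definition contact_structure ::
    "'m topology \<Rightarrow> ('m, 'd::{finite,wellorder}) chart set \<Rightarrow> nat \<Rightarrow>
     ('m \<Rightarrow> ('m, 'd, real) tangent set) \<Rightarrow> bool" where
  "contact_structure T A n \<xi> \<longleftrightarrow>
     (\<forall>p \<in> topspace T. \<exists>c\<in>A. p \<in> chart_dom c \<and>
        (\<exists>a. smooth_on (chart_image c) a \<and>
             (\<forall>x \<in> chart_image c. contact_density n a x \<noteq> 0) \<and>
             (\<forall>q \<in> chart_dom c. \<xi> q = {v \<in> tangent_space A q. a (chart_map c q) \<bullet> v c = 0})))"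

definition contact_form ::
    "'m topology \<Rightarrow> ('m, 'd::{finite,wellorder}) chart set \<Rightarrow> nat \<Rightarrow>
     ('m \<Rightarrow> ('m, 'd, real) tangent set) \<Rightarrow> ('m, 'd) oneform \<Rightarrow> bool" where
  "contact_form T A n \<xi> \<alpha> \<longleftrightarrow> one_form T A \<alpha> \<and>
     (\<forall>p \<in> topspace T. \<xi> p = {v \<in> tangent_space A p. \<alpha> p v = 0}) \<and>
     (\<forall>c\<in>A. \<forall>x \<in> chart_image c. contact_density n (oneform_local A \<alpha> c) x \<noteq> 0)"

definition CVect ::
    "'m topology \<Rightarrow> ('m, 'd::finite) chart set \<Rightarrow> ('m, 'd) oneform \<Rightarrow> ('m, 'd) vfield set" where
  "CVect T A \<alpha> = {X. vector_field T A X \<and>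
     (\<exists>f :: 'm \<Rightarrow> complex. smooth_function A f \<and>
        (\<forall>c\<in>A. \<forall>x \<in> chart_image c.
           lie_deriv_local (vfield_local X c) (oneform_local A \<alpha> c) x =
           (\<chi> j. f (chart_inv c x) * of_real (oneform_local A \<alpha> c x $ j))))}"

text \<open>The contact Hamiltonian of \<open>X\<close> is \<open>oneform_apply \<alpha> X\<close>.\<close>

definition CVect_star ::
    "'m topology \<Rightarrow> ('m, 'd::finite) chart set \<Rightarrow> ('m, 'd) oneform \<Rightarrow> ('m, 'd) vfield set" where
  "CVect_star T A \<alpha> = {X \<in> CVect T A \<alpha>. \<forall>p \<in> topspace T. oneform_apply \<alpha> X p \<noteq> 0}"

text \<open>The functional \<open>X\<^sub>H \<mapsto> \<integral> H\<^bsup>-(n+1)\<^esup> \<alpha> \<and> (d\<alpha>)\<^sup>n\<close>.\<close>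

definition contact_functional ::
    "'m topology \<Rightarrow> ('m, 'd::{finite,wellorder}) chart set \<Rightarrow> ('m, 'd) chart set \<Rightarrow> nat \<Rightarrow>
     ('m, 'd) oneform \<Rightarrow> ('m, 'd) vfield \<Rightarrow> complex" where
  "contact_functional T A P n \<alpha> X = form_integral T A P
     (\<lambda>c x. oneform_apply \<alpha> X (chart_inv c x) powi (- int (n + 1)) *
            of_real (contact_density n (oneform_local A \<alpha> c) x))"

definition CVect_invariant ::
    "'m topology \<Rightarrow> ('m, 'd::finite) chart set \<Rightarrow> ('m, 'd) oneform \<Rightarrow>
     (('m, 'd) vfield \<Rightarrow> complex) \<Rightarrow> bool" where
  "CVect_invariant T A \<alpha> I \<longleftrightarrow> (\<forall>V \<in> CVect T A \<alpha>. \<forall>X \<in> CVect_star T A \<alpha>.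
     ((\<lambda>t. I (vfield_add_scaled X t (lie_bracket A V X))) has_vector_derivative 0) (at 0))"

end

theory Submission
  imports Defs
begin

text \<open>If \<open>L\<^sub>V\<alpha> = f \<alpha>\<close>, the volume form satisfies \<open>L\<^sub>V\<Omega> = (n + 1) f \<Omega>\<close>, while the bracket \<open>[V, X]\<close> has the
  Hamiltonian \<open>V(H) - f H\<close>. The derivative of \<open>\<integral> H\<^bsup>-(n+1)\<^esup> \<Omega>\<close> in the direction \<open>[V, X]\<close> is therefore
  \<open>\<integral> L\<^sub>V(H\<^bsup>-(n+1)\<^esup> \<Omega>)\<close>, the integral of an exact form, up to sign. Under a change \<open>\<beta> = h \<alpha>\<close> of the
  contact form the integrand is unchanged.

  In coordinates the identity for \<open>L\<^sub>V\<Omega>\<close> is obtained by regarding \<open>a \<and> B\<^sup>n\<close> as a polynomial in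
  independent variables \<open>a\<close> and \<open>B\<close>, and differentiating its behaviour under linear changes of
  coordinates, under scaling, and under \<open>B \<mapsto> B + b \<and> a\<close>. Existence of partitions of unity is never
  needed: without one, \<open>form_integral\<close> is a description of an empty predicate, the same for
  all integrands.\<close>

section \<open>Calculus of smooth functions\<close>

text \<open>Why exactly these three symmetries: the derivative along \<open>V\<close> of the pair
  \<open>(a, B)\<close>, with \<open>B\<close> the matrix of \<open>da\<close>, is the sum of
  \<open>f (a, B)\<close>, of \<open>df \<and> a\<close> placed in the second component, and of the
  negative of \<open>(mtr M *v a, mtr M ** B + B ** M)\<close>, where \<open>M\<close> is the matrix
  of first partial derivatives of \<open>V\<close>. Each summand is tangent to a curve along which
  \<open>a \<and> B^n\<close> is known. They contribute the degree \<open>n + 1\<close>, zero, and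
  minus the trace of \<open>M\<close>; the trace then cancels against the divergence of
  \<open>V\<close>. The finite laws are used as well: the determinant law for changes of chart, the
  other two for \<open>\<beta> = h \<alpha>\<close>.

  The derivative is not taken under the integral sign. With \<open>K\<close> the Hamiltonian of
  \<open>[V, X]\<close>, compactness bounds \<open>K / H\<close>, so
  \<open>(1 + t K / H)^-(n+1)\<close> has a second order expansion that is uniform on the manifold.
  Its linear term integrates to zero, and the remainder is quadratic in \<open>t\<close>.

  Brackets and \<open>da\<close> exist only through charts, so their independence of the chart must
  be proved; the obstacle there is the second derivatives of transition maps, which cancel by
  symmetry.\<close>

lemma frechet_derivative_eqI:
  "(f has_derivative f') (at x) \<Longrightarrow> frechet_derivative f (at x) = f'"
  by (rule frechet_derivative_at[symmetric])

text \<open>A derivative at a point of the open set \<open>S\<close> sees only values in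
  \<open>S\<close>. The closure lemmas below use this to exchange \<open>frechet_derivative\<close>
  of a composite function for its computed value.\<close>

lemma differentiable_class_cong:
  assumes "open S" "\<And>x. x \<in> S \<Longrightarrow> f x = g x" "differentiable_class k S f"
  shows "differentiable_class k S g"
  using assms(2,3)
proof (induction k arbitrary: f g)
  case 0
  then show ?case by (metis continuous_on_cong differentiable_class.simps(1))
next
  case (Suc k)
  have der: "(g has_derivative frechet_derivative f (at x)) (at x)" if "x \<in> S" for x
    using Suc.prems that \<open>open S\<close>
    by (metis frechet_derivative_works has_derivative_transform_within_open differentiable_class.simps(2))
  have "differentiable_class k S (\<lambda>x. frechet_derivative g (at x) v)" for v
  proof (rule Suc.IH)
    show "differentiable_class k S (\<lambda>x. frechet_derivative f (at x) v)"
      using Suc.prems by simp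
  qed (simp add: frechet_derivative_eqI[OF der])
  then show ?case using der by (auto simp: differentiable_def)
qed

lemma differentiable_class_Suc_imp: "differentiable_class (Suc k) S f \<Longrightarrow> differentiable_class k S f"
proof (induction k arbitrary: f)
  case 0
  then show ?case
    by (auto intro!: continuous_at_imp_continuous_on differentiable_imp_continuous_within)
next
  case (Suc k)
  then show ?case by (metis differentiable_class.simps(2))
qed

lemma differentiable_class_const: "differentiable_class k S (\<lambda>_. c)"
  by (induction k arbitrary: c) auto

lemma differentiable_class_linear:
  assumes "open S" "bounded_linear h" "differentiable_class k S f"
  shows "differentiable_class k S (\<lambda>x. h (f x))"
  using assms(3)
proof (induction k arbitrary: f)
  case 0
  then show ?case using assms(2) by (simp add: bounded_linear.continuous_on)
next
  case (Suc k)
  have der: "((\<lambda>x. h (f x)) has_derivative (\<lambda>v. h (frechet_derivative f (at x) v))) (at x)" if "x \<in> S" for x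
    using Suc.prems that assms(2) bounded_linear.has_derivative frechet_derivative_works by fastforce
  have "differentiable_class k S (\<lambda>x. frechet_derivative (\<lambda>x. h (f x)) (at x) v)" for v
    by (rule differentiable_class_cong[OF \<open>open S\<close> _ Suc.IH[of "\<lambda>x. frechet_derivative f (at x) v"]])
      (use Suc.prems in \<open>auto simp: frechet_derivative_eqI[OF der]\<close>)
  then show ?case using der by (auto simp: differentiable_def)
qed

lemma differentiable_class_add:
  assumes "open S" "differentiable_class k S f" "differentiable_class k S g"
  shows "differentiable_class k S (\<lambda>x. f x + g x)"
  using assms(2,3)
proof (induction k arbitrary: f g)
  case 0
  then show ?case by (simp add: continuous_on_add)
next
  case (Suc k)
  have der: "((\<lambda>x. f x + g x) has_derivative
      (\<lambda>v. frechet_derivative f (at x) v + frechet_derivative g (at x) v)) (at x)" if "x \<in> S" for x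
    using Suc.prems that by (auto intro!: has_derivative_add simp flip: frechet_derivative_works)
  have "differentiable_class k S (\<lambda>x. frechet_derivative (\<lambda>x. f x + g x) (at x) v)" for v
    by (rule differentiable_class_cong[OF \<open>open S\<close> _ Suc.IH[of "\<lambda>x. frechet_derivative f (at x) v"
            "\<lambda>x. frechet_derivative g (at x) v"]])
      (use Suc.prems in \<open>auto simp: frechet_derivative_eqI[OF der]\<close>)
  then show ?case using der by (auto simp: differentiable_def)
qed

text \<open>One proof for products, scalar multiples and inner products. The product rule keeps one
  factor undifferentiated, so the induction also needs that class \<open>Suc k\<close> is contained
  in class \<open>k\<close>.\<close>

lemma differentiable_class_bilinear:
  assumes "open S" "bounded_bilinear h" "differentiable_class k S f" "differentiable_class k S g"
  shows "differentiable_class k S (\<lambda>x. h (f x) (g x))"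
  using assms(3,4)
proof (induction k arbitrary: f g)
  case 0
  then show ?case using assms(2) by (simp add: bounded_bilinear.continuous_on)
next
  case (Suc k)
  have der: "((\<lambda>x. h (f x) (g x)) has_derivative
      (\<lambda>v. h (f x) (frechet_derivative g (at x) v) + h (frechet_derivative f (at x) v) (g x))) (at x)"
    if "x \<in> S" for x
    using Suc.prems that
    by (intro bounded_bilinear.FDERIV[OF assms(2)]) (auto simp flip: frechet_derivative_works)
  have "differentiable_class k S (\<lambda>x. frechet_derivative (\<lambda>x. h (f x) (g x)) (at x) v)" for v
    by (rule differentiable_class_cong[OF \<open>open S\<close> _ differentiable_class_add[OF \<open>open S\<close>
         Suc.IH[of f "\<lambda>x. frechet_derivative g (at x) v"]
         Suc.IH[of "\<lambda>x. frechet_derivative f (at x) v" g]]])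
      (use Suc.prems differentiable_class_Suc_imp[OF Suc.prems(1)] differentiable_class_Suc_imp[OF Suc.prems(2)]
        in \<open>auto simp: frechet_derivative_eqI[OF der]\<close>)
  then show ?case using der by (auto simp: differentiable_def)
qed

text \<open>The derivative of the inverse is a product of the inverse itself with the derivative of
  \<open>f\<close>; the induction hypothesis for the same \<open>f\<close> is fed back into that
  product.\<close>

lemma differentiable_class_inverse:
  fixes f :: "'a::real_normed_vector \<Rightarrow> 'b::real_normed_field"
  assumes "open S" "\<And>x. x \<in> S \<Longrightarrow> f x \<noteq> 0" "differentiable_class k S f"
  shows "differentiable_class k S (\<lambda>x. inverse (f x))"
  using assms(3)
proof (induction k)
  case 0
  then show ?case using assms(2) by (simp add: continuous_on_inverse)
next
  case (Suc k)
  have der: "((\<lambda>x. inverse (f x)) has_derivative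
      (\<lambda>v. - (inverse (f x) * frechet_derivative f (at x) v * inverse (f x)))) (at x)"
    if "x \<in> S" for x
    using Suc.prems that assms(2)
    by (intro Deriv.has_derivative_inverse) (auto simp flip: frechet_derivative_works)
  have IH: "differentiable_class k S (\<lambda>x. inverse (f x))"
    using Suc differentiable_class_Suc_imp by blast
  have "differentiable_class k S (\<lambda>x. frechet_derivative (\<lambda>x. inverse (f x)) (at x) v)" for v
    by (rule differentiable_class_cong[OF \<open>open S\<close> _
          differentiable_class_linear[OF \<open>open S\<close> bounded_linear_minus[OF bounded_linear_ident]
            differentiable_class_bilinear[OF \<open>open S\<close> bounded_bilinear_mult
              differentiable_class_bilinear[OF \<open>open S\<close> bounded_bilinear_mult IH,
                of "\<lambda>x. frechet_derivative f (at x) v"] IH]]])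
      (use Suc.prems in \<open>auto simp: frechet_derivative_eqI[OF der]\<close>)
  then show ?case using der by (auto simp: differentiable_def)
qed

lemma smooth_on_cong: "open S \<Longrightarrow> (\<And>x. x \<in> S \<Longrightarrow> f x = g x) \<Longrightarrow> smooth_on S f \<Longrightarrow> smooth_on S g"
  unfolding smooth_on_def using differentiable_class_cong by blast

lemma smooth_on_const: "smooth_on S (\<lambda>_. c)"
  by (simp add: smooth_on_def differentiable_class_const)

lemma smooth_on_linear: "open S \<Longrightarrow> bounded_linear h \<Longrightarrow> smooth_on S f \<Longrightarrow> smooth_on S (\<lambda>x. h (f x))"
  by (simp add: smooth_on_def differentiable_class_linear)

lemma smooth_on_add: "open S \<Longrightarrow> smooth_on S f \<Longrightarrow> smooth_on S g \<Longrightarrow> smooth_on S (\<lambda>x. f x + g x)"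
  by (simp add: smooth_on_def differentiable_class_add)

lemma smooth_on_diff: "open S \<Longrightarrow> smooth_on S f \<Longrightarrow> smooth_on S g \<Longrightarrow> smooth_on S (\<lambda>x. f x - g x)"
  using smooth_on_add[OF _ _ smooth_on_linear[OF _ bounded_linear_minus[OF bounded_linear_ident]], of S f g]
  by simp

lemma smooth_on_sum:
  assumes "open S" "\<And>i. i \<in> I \<Longrightarrow> smooth_on S (f i)"
  shows "smooth_on S (\<lambda>x. \<Sum>i\<in>I. f i x)"
  using assms(2)
proof (induction I rule: infinite_finite_induct)
  case (insert x F)
  then show ?case by (auto intro: smooth_on_add assms(1))
qed (auto intro: smooth_on_const)

lemma smooth_on_bilinear:
  "open S \<Longrightarrow> bounded_bilinear h \<Longrightarrow> smooth_on S f \<Longrightarrow> smooth_on S g \<Longrightarrow> smooth_on S (\<lambda>x. h (f x) (g x))"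
  by (simp add: smooth_on_def differentiable_class_bilinear)

lemmas smooth_on_mult = smooth_on_bilinear[OF _ bounded_bilinear_mult]

lemma smooth_on_inverse:
  fixes f :: "'a::real_normed_vector \<Rightarrow> 'b::real_normed_field"
  shows "open S \<Longrightarrow> (\<And>x. x \<in> S \<Longrightarrow> f x \<noteq> 0) \<Longrightarrow> smooth_on S f \<Longrightarrow> smooth_on S (\<lambda>x. inverse (f x))"
  by (simp add: smooth_on_def differentiable_class_inverse)

lemma smooth_on_power:
  fixes f :: "'a::real_normed_vector \<Rightarrow> 'b::real_normed_algebra_1"
  assumes "open S" "smooth_on S f"
  shows "smooth_on S (\<lambda>x. f x ^ m)"
  by (induction m) (auto intro: smooth_on_const smooth_on_mult assms)

lemma smooth_on_frechet_derivative: "smooth_on S f \<Longrightarrow> smooth_on S (\<lambda>x. frechet_derivative f (at x) v)"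
  unfolding smooth_on_def by (metis differentiable_class.simps(2))

lemma smooth_on_pderiv_at: "smooth_on S f \<Longrightarrow> smooth_on S (pderiv_at j f)"
  unfolding pderiv_at_def by (rule smooth_on_frechet_derivative)

lemma smooth_on_imp_differentiable: "smooth_on S f \<Longrightarrow> x \<in> S \<Longrightarrow> f differentiable (at x)"
  unfolding smooth_on_def by (metis differentiable_class.simps(2))

lemma smooth_on_imp_continuous_on: "smooth_on S f \<Longrightarrow> continuous_on S f"
  unfolding smooth_on_def by (metis differentiable_class.simps(1))

lemma smooth_on_imp_has_derivative:
  "smooth_on S f \<Longrightarrow> x \<in> S \<Longrightarrow> (f has_derivative frechet_derivative f (at x)) (at x)"
  using frechet_derivative_works smooth_on_imp_differentiable by blast

lemma smooth_on_nth: "open S \<Longrightarrow> smooth_on S f \<Longrightarrow> smooth_on S (\<lambda>x. f x $ i)"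
  by (rule smooth_on_linear[OF _ bounded_linear_vec_nth])

lemma smooth_on_of_real:
  "open S \<Longrightarrow> smooth_on S f \<Longrightarrow> smooth_on S (\<lambda>x. of_real (f x) :: 'b::{real_normed_algebra_1})"
  by (rule smooth_on_linear[OF _ bounded_linear_of_real])

text \<open>Both second derivatives are limits of the same symmetric second difference.\<close>

lemma second_difference_mean_value:
  fixes f :: "'a::real_normed_vector \<Rightarrow> real"
  assumes "smooth_on S f" and sub: "\<And>r q. 0 \<le> r \<Longrightarrow> r \<le> s \<Longrightarrow> 0 \<le> q \<Longrightarrow> q \<le> s \<Longrightarrow> x + r *\<^sub>R u + q *\<^sub>R v \<in> S" and "s > 0"
  shows "\<exists>r q. 0 \<le> r \<and> r \<le> s \<and> 0 \<le> q \<and> q \<le> s \<and>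
     f (x + s *\<^sub>R u + s *\<^sub>R v) - f (x + s *\<^sub>R u) - f (x + s *\<^sub>R v) + f x =
     s * s * frechet_derivative (\<lambda>x. frechet_derivative f (at x) u) (at (x + r *\<^sub>R u + q *\<^sub>R v)) v"
proof -
  have line: "((\<lambda>t. h (y + t *\<^sub>R w)) has_real_derivative frechet_derivative h (at (y + t *\<^sub>R w)) w) (at t)"
    if "smooth_on S h" "y + t *\<^sub>R w \<in> S" for h :: "'a \<Rightarrow> real" and y w t
  proof -
    have *: "(h has_derivative frechet_derivative h (at (y + t *\<^sub>R w))) (at (y + t *\<^sub>R w))"
      using that smooth_on_imp_has_derivative by blast
    have "((\<lambda>t. h (y + t *\<^sub>R w)) has_derivative (\<lambda>d. frechet_derivative h (at (y + t *\<^sub>R w)) (d *\<^sub>R w))) (at t)"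
      by (rule has_derivative_compose[of "\<lambda>t. y + t *\<^sub>R w" _ _ _ h, OF _ *]) (auto intro!: derivative_eq_intros)
    then show ?thesis
      using linear_scale[OF linear_frechet_derivative[OF smooth_on_imp_differentiable[OF that]]]
      by (auto simp: has_field_derivative_def mult.commute[of _ "frechet_derivative _ _ _"] fun_eq_iff
          elim!: has_derivative_eq_rhs)
  qed
  \<comment> \<open>First mean value theorem: in the direction \<open>u\<close>, for the difference
    between \<open>f\<close> shifted by \<open>s *\<^sub>R v\<close> and \<open>f\<close>.\<close>
  have d1: "((\<lambda>t. f (x + s *\<^sub>R v + t *\<^sub>R u) - f (x + t *\<^sub>R u)) has_real_derivative
       frechet_derivative f (at (x + s *\<^sub>R v + t *\<^sub>R u)) u - frechet_derivative f (at (x + t *\<^sub>R u)) u) (at t)"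
    if "0 \<le> t" "t \<le> s" for t
  proof -
    have "x + s *\<^sub>R v + t *\<^sub>R u \<in> S" using sub[of t s] that \<open>s > 0\<close> by (simp add: algebra_simps)
    moreover have "x + t *\<^sub>R u \<in> S" using sub[of t 0] that \<open>s > 0\<close> by simp
    ultimately show ?thesis by (intro DERIV_diff line assms(1))
  qed
  obtain r where r: "0 < r" "r < s" and req: "(f (x + s *\<^sub>R v + s *\<^sub>R u) - f (x + s *\<^sub>R u)) - (f (x + s *\<^sub>R v + 0 *\<^sub>R u) - f (x + 0 *\<^sub>R u))
      = (s - 0) * (frechet_derivative f (at (x + s *\<^sub>R v + r *\<^sub>R u)) u - frechet_derivative f (at (x + r *\<^sub>R u)) u)"
    using MVT2[OF \<open>s > 0\<close> d1] by blast
  \<comment> \<open>Second mean value theorem: in the direction \<open>v\<close>, at the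
    intermediate parameter \<open>r\<close> just found.\<close>
  have d2: "((\<lambda>t. frechet_derivative f (at (x + r *\<^sub>R u + t *\<^sub>R v)) u) has_real_derivative
       frechet_derivative (\<lambda>x. frechet_derivative f (at x) u) (at (x + r *\<^sub>R u + t *\<^sub>R v)) v) (at t)"
    if "0 \<le> t" "t \<le> s" for t
    by (rule line[OF smooth_on_frechet_derivative[OF assms(1)]]) (use sub that r in auto)
  obtain q where q: "0 < q" "q < s" and qeq: "frechet_derivative f (at (x + r *\<^sub>R u + s *\<^sub>R v)) u - frechet_derivative f (at (x + r *\<^sub>R u + 0 *\<^sub>R v)) u
     = (s - 0) * frechet_derivative (\<lambda>x. frechet_derivative f (at x) u) (at (x + r *\<^sub>R u + q *\<^sub>R v)) v"
    using MVT2[OF \<open>s > 0\<close> d2] by blast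
  show ?thesis
  proof (intro exI conjI)
    show "f (x + s *\<^sub>R u + s *\<^sub>R v) - f (x + s *\<^sub>R u) - f (x + s *\<^sub>R v) + f x =
     s * s * frechet_derivative (\<lambda>x. frechet_derivative f (at x) u) (at (x + r *\<^sub>R u + q *\<^sub>R v)) v"
      using req qeq by (simp add: add.commute add.left_commute)
  qed (use r q in auto)
qed

lemma symmetric_second_derivative:
  fixes f :: "'a::real_normed_vector \<Rightarrow> real"
  assumes "open S" "smooth_on S f" "x \<in> S"
  shows "frechet_derivative (\<lambda>x. frechet_derivative f (at x) u) (at x) v =
         frechet_derivative (\<lambda>x. frechet_derivative f (at x) v) (at x) u" (is "?P x = ?Q x")
proof (rule ccontr)
  assume "?P x \<noteq> ?Q x"
  \<comment> \<open>Half the gap: two values closer than \<open>e\<close> to \<open>?P x\<close> and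
    \<open>?Q x\<close> respectively cannot coincide.\<close>
  define e where "e = \<bar>?P x - ?Q x\<bar> / 2"
  have "e > 0" using \<open>?P x \<noteq> ?Q x\<close> by (simp add: e_def)
  have cont: "continuous_on S ?P" "continuous_on S ?Q"
    by (intro smooth_on_imp_continuous_on smooth_on_frechet_derivative assms)+
  obtain d1 where d1: "d1 > 0" "\<And>y. y \<in> S \<Longrightarrow> dist y x < d1 \<Longrightarrow> dist (?P y) (?P x) < e"
    using continuous_on_iff[THEN iffD1, rule_format, OF cont(1) \<open>x \<in> S\<close> \<open>e > 0\<close>] by blast
  obtain d2 where d2: "d2 > 0" "\<And>y. y \<in> S \<Longrightarrow> dist y x < d2 \<Longrightarrow> dist (?Q y) (?Q x) < e"
    using continuous_on_iff[THEN iffD1, rule_format, OF cont(2) \<open>x \<in> S\<close> \<open>e > 0\<close>] by blast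
  obtain d3 where d3: "d3 > 0" "ball x d3 \<subseteq> S" using assms open_contains_ball by blast
  define d where "d = Min {d1, d2, d3}"
  have d: "d > 0" "d \<le> d1" "d \<le> d2" "d \<le> d3" using d1 d2 d3 by (auto simp: d_def)
  \<comment> \<open>This size keeps the whole parallelogram with sides \<open>s *\<^sub>R u\<close>
    and \<open>s *\<^sub>R v\<close> within distance \<open>d\<close> of \<open>x\<close>. The added
    1 keeps the divisor positive when both vectors vanish.\<close>
  define s where "s = d / (2 * (norm u + norm v + 1))"
  have "norm u + norm v + 1 > 0" by (simp add: add_nonneg_pos)
  then have "s > 0" using d by (simp add: s_def)
  have near: "dist (x + r *\<^sub>R u + q *\<^sub>R v) x < d" if "0 \<le> r" "r \<le> s" "0 \<le> q" "q \<le> s" for r q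
  proof -
    have "dist (x + r *\<^sub>R u + q *\<^sub>R v) x = norm (r *\<^sub>R u + q *\<^sub>R v)"
      by (simp add: dist_norm add.assoc)
    also have "\<dots> \<le> r * norm u + q * norm v"
      using norm_triangle_ineq[of "r *\<^sub>R u" "q *\<^sub>R v"] that by simp
    also have "\<dots> \<le> s * norm u + s * norm v" using that by (intro add_mono mult_right_mono) auto
    also have "\<dots> < s * (2 * (norm u + norm v + 1))" (is "_ < ?c")
    proof -
      have "norm u + norm v < 2 * (norm u + norm v + 1)"
        by (simp add: algebra_simps add_nonneg_pos)
      then have "s * (norm u + norm v) < ?c" using \<open>s > 0\<close> by (rule mult_strict_left_mono)
      then show ?thesis by (simp only: distrib_left)
    qed
    also have "\<dots> = d" using \<open>norm u + norm v + 1 > 0\<close> by (simp add: s_def)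
    finally show ?thesis .
  qed
  have inS: "y \<in> S" if "dist y x < d" for y
    using that d d3 by (auto simp: dist_commute subset_iff)
  obtain r q where rq: "0 \<le> r" "r \<le> s" "0 \<le> q" "q \<le> s"
    "f (x + s *\<^sub>R u + s *\<^sub>R v) - f (x + s *\<^sub>R u) - f (x + s *\<^sub>R v) + f x = s * s * ?P (x + r *\<^sub>R u + q *\<^sub>R v)"
    using second_difference_mean_value[OF assms(2) inS[OF near] \<open>s > 0\<close>] by blast
  have near': "dist (x + r *\<^sub>R v + q *\<^sub>R u) x < d" if "0 \<le> r" "r \<le> s" "0 \<le> q" "q \<le> s" for r q
    using near[OF that(3,4,1,2)] by (simp add: add.commute add.left_commute)
  obtain r' q' where rq': "0 \<le> r'" "r' \<le> s" "0 \<le> q'" "q' \<le> s"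
    "f (x + s *\<^sub>R v + s *\<^sub>R u) - f (x + s *\<^sub>R v) - f (x + s *\<^sub>R u) + f x = s * s * ?Q (x + r' *\<^sub>R v + q' *\<^sub>R u)"
    using second_difference_mean_value[OF assms(2) inS[OF near'] \<open>s > 0\<close>] by blast
  have "s * s * ?P (x + r *\<^sub>R u + q *\<^sub>R v) = s * s * ?Q (x + r' *\<^sub>R v + q' *\<^sub>R u)"
    unfolding rq(5)[symmetric] rq'(5)[symmetric]
    by (simp add: add.commute[of "s *\<^sub>R u" "s *\<^sub>R v"] add.assoc)
  then have "?P (x + r *\<^sub>R u + q *\<^sub>R v) = ?Q (x + r' *\<^sub>R v + q' *\<^sub>R u)" using \<open>s > 0\<close> by simp
  moreover have "dist (?P (x + r *\<^sub>R u + q *\<^sub>R v)) (?P x) < e"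
    using near[OF rq(1-4)] inS d by (intro d1) auto
  moreover have "dist (?Q (x + r' *\<^sub>R v + q' *\<^sub>R u)) (?Q x) < e"
    using near'[OF rq'(1-4)] inS d by (intro d2) auto
  ultimately show False by (simp add: e_def dist_real_def abs_if split: if_splits)
qed

subsection \<open>Partial derivatives\<close>

lemma pderiv_at_cong:
  assumes "open S" "x \<in> S" "\<And>y. y \<in> S \<Longrightarrow> f y = g y" "f differentiable (at x)"
  shows "pderiv_at j f x = pderiv_at j g x"
proof -
  have "(g has_derivative frechet_derivative f (at x)) (at x)"
    using assms by (metis frechet_derivative_works has_derivative_transform_within_open)
  then show ?thesis by (simp add: pderiv_at_def frechet_derivative_eqI)
qed

lemma frechet_derivative_eq_sum_pderiv_at:
  assumes "f differentiable (at x)"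
  shows "frechet_derivative f (at x) v = (\<Sum>k\<in>UNIV. v $ k *\<^sub>R pderiv_at k f x)"
proof -
  have lin: "linear (frechet_derivative f (at x))" by (rule linear_frechet_derivative[OF assms])
  have "v = (\<Sum>k\<in>UNIV. v $ k *\<^sub>R axis k 1)"
    by (simp add: vec_eq_iff axis_def if_distrib cong: if_cong)
  then have "frechet_derivative f (at x) v = frechet_derivative f (at x) (\<Sum>k\<in>UNIV. v $ k *\<^sub>R axis k 1)"
    by simp
  then show ?thesis by (simp add: linear_sum[OF lin] linear_scale[OF lin] pderiv_at_def)
qed

lemma pderiv_at_linear:
  assumes "bounded_linear h" "f differentiable (at x)"
  shows "pderiv_at j (\<lambda>x. h (f x)) x = h (pderiv_at j f x)"
proof -
  have "((\<lambda>x. h (f x)) has_derivative (\<lambda>v. h (frechet_derivative f (at x) v))) (at x)"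
    using assms bounded_linear.has_derivative frechet_derivative_works by fastforce
  then show ?thesis by (simp add: pderiv_at_def frechet_derivative_eqI)
qed

lemma pderiv_at_nth: "f differentiable (at x) \<Longrightarrow> pderiv_at j (\<lambda>x. f x $ i) x = pderiv_at j f x $ i"
  by (rule pderiv_at_linear[OF bounded_linear_vec_nth])

lemma differentiable_nth: "f differentiable (at x) \<Longrightarrow> (\<lambda>x. f x $ i) differentiable (at x)"
  unfolding differentiable_def by (blast dest: bounded_linear.has_derivative[OF bounded_linear_vec_nth])

lemma pderiv_at_bilinear:
  assumes "bounded_bilinear h" "f differentiable (at x)" "g differentiable (at x)"
  shows "pderiv_at j (\<lambda>x. h (f x) (g x)) x = h (f x) (pderiv_at j g x) + h (pderiv_at j f x) (g x)"
proof -
  have "((\<lambda>x. h (f x) (g x)) has_derivative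
      (\<lambda>v. h (f x) (frechet_derivative g (at x) v) + h (frechet_derivative f (at x) v) (g x))) (at x)"
    using assms
    by (intro bounded_bilinear.FDERIV[OF assms(1)]) (auto simp flip: frechet_derivative_works)
  then show ?thesis by (simp add: pderiv_at_def frechet_derivative_eqI)
qed

lemmas pderiv_at_mult = pderiv_at_bilinear[OF bounded_bilinear_mult]

lemma pderiv_at_add:
  assumes "f differentiable (at x)" "g differentiable (at x)"
  shows "pderiv_at j (\<lambda>x. f x + g x) x = pderiv_at j f x + pderiv_at j g x"
proof -
  have "((\<lambda>x. f x + g x) has_derivative
      (\<lambda>v. frechet_derivative f (at x) v + frechet_derivative g (at x) v)) (at x)"
    using assms by (auto intro!: has_derivative_add simp flip: frechet_derivative_works)
  then show ?thesis by (simp add: pderiv_at_def frechet_derivative_eqI)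
qed

lemma pderiv_at_diff:
  assumes "f differentiable (at x)" "g differentiable (at x)"
  shows "pderiv_at j (\<lambda>x. f x - g x) x = pderiv_at j f x - pderiv_at j g x"
proof -
  have "((\<lambda>x. f x - g x) has_derivative
      (\<lambda>v. frechet_derivative f (at x) v - frechet_derivative g (at x) v)) (at x)"
    using assms by (auto intro!: has_derivative_diff simp flip: frechet_derivative_works)
  then show ?thesis by (simp add: pderiv_at_def frechet_derivative_eqI)
qed

lemma pderiv_at_sum:
  assumes "\<And>i. i \<in> I \<Longrightarrow> f i differentiable (at x)"
  shows "pderiv_at j (\<lambda>x. \<Sum>i\<in>I. f i x) x = (\<Sum>i\<in>I. pderiv_at j (f i) x)"
proof -
  have "((\<lambda>x. \<Sum>i\<in>I. f i x) has_derivative (\<lambda>v. \<Sum>i\<in>I. frechet_derivative (f i) (at x) v)) (at x)"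
    using assms by (auto intro!: has_derivative_sum simp flip: frechet_derivative_works)
  then show ?thesis by (simp add: pderiv_at_def frechet_derivative_eqI)
qed

lemma pderiv_at_const: "pderiv_at j (\<lambda>_. c) x = 0"
  by (simp add: pderiv_at_def)

lemma pderiv_at_chain:
  fixes \<tau> :: "real^'d::finite \<Rightarrow> real^'e::finite"
  assumes "\<tau> differentiable (at x)" "f differentiable (at (\<tau> x))"
  shows "pderiv_at j (\<lambda>x. f (\<tau> x)) x = (\<Sum>k\<in>UNIV. (pderiv_at j \<tau> x $ k) *\<^sub>R pderiv_at k f (\<tau> x))"
proof -
  have "((\<lambda>x. f (\<tau> x)) has_derivative (\<lambda>v. frechet_derivative f (at (\<tau> x)) (frechet_derivative \<tau> (at x) v))) (at x)"
    using assms by (simp only: frechet_derivative_works has_derivative_compose)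
  then have "pderiv_at j (\<lambda>x. f (\<tau> x)) x = frechet_derivative f (at (\<tau> x)) (pderiv_at j \<tau> x)"
    by (simp add: pderiv_at_def frechet_derivative_eqI)
  then show ?thesis by (simp add: frechet_derivative_eq_sum_pderiv_at[OF assms(2)])
qed

lemma differentiable_chain:
  "\<tau> differentiable (at x) \<Longrightarrow> f differentiable (at (\<tau> x)) \<Longrightarrow> (\<lambda>x. f (\<tau> x)) differentiable (at x)"
  by (drule (1) differentiable_chain_at) (simp only: o_def)

lemma pderiv_at_commute:
  fixes f :: "real^'d::finite \<Rightarrow> real"
  assumes "open S" "smooth_on S f" "x \<in> S"
  shows "pderiv_at i (pderiv_at j f) x = pderiv_at j (pderiv_at i f) x"
  unfolding pderiv_at_def by (rule symmetric_second_derivative[OF assms])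

lemma pderiv_at_nth_commute:
  fixes f :: "real^'d::finite \<Rightarrow> real^'e::finite"
  assumes S: "open S" "smooth_on S f" and x: "x \<in> S"
  shows "pderiv_at i (\<lambda>y. pderiv_at j f y $ k) x = pderiv_at j (\<lambda>y. pderiv_at i f y $ k) x"
proof -
  have e: "pderiv_at j (\<lambda>y. f y $ k) y = pderiv_at j f y $ k" if "y \<in> S" for y j
    using smooth_on_imp_differentiable[OF S(2) that] by (rule pderiv_at_nth)
  have "pderiv_at i (\<lambda>y. pderiv_at j f y $ k) x = pderiv_at i (pderiv_at j (\<lambda>y. f y $ k)) x" for i j
    by (rule pderiv_at_cong[OF S(1) x])
      (auto simp: e intro: smooth_on_imp_differentiable[OF smooth_on_nth[OF S(1) smooth_on_pderiv_at[OF S(2)]] x])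
  then show ?thesis using pderiv_at_commute[OF S(1) smooth_on_nth[OF S] x] by metis
qed

section \<open>Alternating forms and the contact density\<close>

text \<open>Forms are functions of infinite sequences of vectors, so multilinearity and degree must
  be imposed separately: this predicate treats the slots below \<open>k\<close>, while
  \<open>depends_on_first\<close> makes all later slots irrelevant.\<close>

definition slot_linear :: "nat \<Rightarrow> ((nat \<Rightarrow> 'v::real_vector) \<Rightarrow> real) \<Rightarrow> bool" where
  "slot_linear k \<omega> \<longleftrightarrow> (\<forall>v. \<forall>i<k. linear (\<lambda>u. \<omega> (v(i := u))))"

definition depends_on_first :: "nat \<Rightarrow> ((nat \<Rightarrow> 'v) \<Rightarrow> real) \<Rightarrow> bool" where
  "depends_on_first k \<omega> \<longleftrightarrow> (\<forall>v v'. (\<forall>i<k. v i = v' i) \<longrightarrow> \<omega> v = \<omega> v')"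

lemma linear_mult_const:
  fixes L :: "'v::real_vector \<Rightarrow> real"
  assumes "linear L"
  shows "linear (\<lambda>u. c * L u * d)"
  using linear_add[OF assms] linear_scale[OF assms] by (intro linearI) (auto simp: algebra_simps)

lemma permutes_lessThan_less: "\<sigma> permutes {..<m} \<Longrightarrow> i < m \<Longrightarrow> \<sigma> i < m" for m :: nat
  using permutes_in_image[of \<sigma> "{..<m}"] by auto

lemma depends_on_first_wedge:
  assumes "depends_on_first k \<omega>" "depends_on_first l \<eta>"
  shows "depends_on_first (k + l) (wedge k l \<omega> \<eta>)"
  unfolding depends_on_first_def
proof (intro allI impI)
  fix v v' :: "nat \<Rightarrow> 'a"
  assume v: "\<forall>i<k + l. v i = v' i"
  have "\<omega> (\<lambda>i. v (\<sigma> i)) = \<omega> (\<lambda>i. v' (\<sigma> i))" "\<eta> (\<lambda>i. v (\<sigma> (k + i))) = \<eta> (\<lambda>i. v' (\<sigma> (k + i)))"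
    if "\<sigma> permutes {..<k + l}" for \<sigma>
    using assms v permutes_lessThan_less[OF that] unfolding depends_on_first_def by simp_all
  then show "wedge k l \<omega> \<eta> v = wedge k l \<omega> \<eta> v'"
    unfolding wedge_def by (auto intro!: arg_cong[of _ _ "\<lambda>s. s / _"] sum.cong)
qed

text \<open>In each summand the varied vector matters at the single position \<open>j\<close> with
  \<open>\<sigma> j = i\<close>. It enters one of the two factors linearly and leaves the other one
  constant.\<close>

lemma slot_linear_wedge:
  assumes "slot_linear k \<omega>" "depends_on_first k \<omega>" "slot_linear l \<eta>"
  shows "slot_linear (k + l) (wedge k l \<omega> \<eta>)"
  unfolding slot_linear_def
proof (intro allI impI)
  fix v :: "nat \<Rightarrow> 'a" and i assume i: "i < k + l"
  have "linear (\<lambda>u. of_int (sign \<sigma>) * \<omega> (\<lambda>j. (v(i := u)) (\<sigma> j)) * \<eta> (\<lambda>j. (v(i := u)) (\<sigma> (k + j))))"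
    if \<sigma>: "\<sigma> permutes {..<k + l}" for \<sigma>
  proof -
    obtain j where j: "j < k + l" "\<sigma> j = i"
      using i permutes_image[OF \<sigma>] by (metis imageE lessThan_iff)
    have eq: "\<sigma> j' = i \<longleftrightarrow> j' = j" for j' using j permutes_inj[OF \<sigma>] by (auto simp: inj_def)
    show ?thesis
    proof (cases "j < k")
      case True
      have 1: "(\<lambda>j'. (v(i := u)) (\<sigma> j')) = (\<lambda>j'. v (\<sigma> j'))(j := u)" for u
        by (auto simp: fun_eq_iff eq j)
      have 2: "(\<lambda>j'. (v(i := u)) (\<sigma> (k + j'))) = (\<lambda>j'. v (\<sigma> (k + j')))" for u
        using True by (auto simp: fun_eq_iff eq)
      show ?thesis unfolding 1 2
        using assms(1) True by (intro linear_mult_const) (simp add: slot_linear_def)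
    next
      case False
      \<comment> \<open>The sequence passed to \<open>\<omega>\<close> does contain
        \<open>u\<close>, but at position \<open>j \<ge> k\<close>, beyond its degree.\<close>
      have 1: "\<omega> (\<lambda>j'. (v(i := u)) (\<sigma> j')) = \<omega> (\<lambda>j'. v (\<sigma> j'))" for u
        using assms(2) False unfolding depends_on_first_def
        by (elim allE impE) (auto simp: eq)
      have 2: "(\<lambda>j'. (v(i := u)) (\<sigma> (k + j'))) = (\<lambda>j'. v (\<sigma> (k + j')))(j - k := u)" for u
        using False by (auto simp: fun_eq_iff eq)
      have "j - k < l" using j False by simp
      then have "linear (\<lambda>u. \<eta> ((\<lambda>j'. v (\<sigma> (k + j')))(j - k := u)))"
        using assms(3) by (simp add: slot_linear_def)
      then show ?thesis unfolding 1 2 using linear_mult_const[of _ _ 1] by simp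
    qed
  qed
  then have "linear (\<lambda>u. \<Sum>\<sigma> | \<sigma> permutes {..<k + l}.
      of_int (sign \<sigma>) * \<omega> (\<lambda>j. (v(i := u)) (\<sigma> j)) * \<eta> (\<lambda>j. (v(i := u)) (\<sigma> (k + j))))"
    by (intro linear_compose_sum) auto
  from linear_mult_const[OF this, of 1 "inverse (fact k * fact l)"]
  show "linear (\<lambda>u. wedge k l \<omega> \<eta> (v(i := u)))"
    by (simp add: wedge_def divide_inverse)
qed

text \<open>Summation over all permutations antisymmetrizes: left composition with
  \<open>\<tau>\<close> reindexes the sum, and a sign is its own inverse. This supplies the
  alternation that \<open>alternating_det\<close> asks for.\<close>

lemma wedge_permute:
  assumes "\<tau> permutes {..<k + l}"
  shows "wedge k l \<omega> \<eta> (\<lambda>i. v (\<tau> i)) = of_int (sign \<tau>) * wedge k l \<omega> \<eta> v"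
proof -
  let ?g = "\<lambda>\<sigma>. of_int (sign \<sigma>) * \<omega> (\<lambda>i. v (\<sigma> i)) * \<eta> (\<lambda>i. v (\<sigma> (k + i)))"
  have "permutation \<tau>" using assms permutation_permutes by blast
  have "(\<Sum>\<sigma> | \<sigma> permutes {..<k + l}.
        of_int (sign \<sigma>) * \<omega> (\<lambda>i. v (\<tau> (\<sigma> i))) * \<eta> (\<lambda>i. v (\<tau> (\<sigma> (k + i)))))
     = (\<Sum>\<sigma> | \<sigma> permutes {..<k + l}. of_int (sign \<tau>) * ?g (\<tau> \<circ> \<sigma>))"
  proof (rule sum.cong[OF refl])
    fix \<sigma> assume "\<sigma> \<in> {\<sigma>. \<sigma> permutes {..<k + l}}"
    then have "permutation \<sigma>" using permutation_permutes by blast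
    have "(of_int (sign \<sigma>) :: real) = of_int (sign \<tau>) * of_int (sign (\<tau> \<circ> \<sigma>))"
      unfolding sign_compose[OF \<open>permutation \<tau>\<close> \<open>permutation \<sigma>\<close>]
      by (simp flip: of_int_mult mult.assoc)
    then show "of_int (sign \<sigma>) * \<omega> (\<lambda>i. v (\<tau> (\<sigma> i))) * \<eta> (\<lambda>i. v (\<tau> (\<sigma> (k + i)))) =
        of_int (sign \<tau>) * ?g (\<tau> \<circ> \<sigma>)" by simp
  qed
  also have "\<dots> = (\<Sum>\<sigma> | \<sigma> permutes {..<k + l}. of_int (sign \<tau>) * ?g \<sigma>)"
    by (rule sum.reindex_bij_witness[where i = "\<lambda>\<sigma>. inv \<tau> \<circ> \<sigma>" and j = "\<lambda>\<sigma>. \<tau> \<circ> \<sigma>"])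
      (use assms in \<open>auto simp: permutes_compose permutes_inv o_assoc permutes_inv_o\<close>)
  finally show ?thesis unfolding wedge_def by (simp add: sum_distrib_left)
qed

text \<open>The uniqueness of the determinant among alternating multilinear functions. The arguments
  are relabelled by the index type \<open>'d\<close> along \<open>e\<close>, and the identity is
  checked on elementary matrices and shown to be stable under products.\<close>

lemma alternating_det:
  fixes f :: "(nat \<Rightarrow> real^'d::finite) \<Rightarrow> real" and A :: "real^'d^'d"
  assumes lin: "slot_linear m f" and dep: "depends_on_first m f"
    and alt: "\<And>\<tau> v. \<tau> permutes {..<m} \<Longrightarrow> f (\<lambda>i. v (\<tau> i)) = of_int (sign \<tau>) * f v"
    and e: "bij_betw e {..<m} (UNIV :: 'd set)"
  shows "f (\<lambda>i. A *v axis (e i) 1) = det A * f (\<lambda>i. axis (e i) 1)"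
proof -
  define \<Psi> where "\<Psi> c = f (\<lambda>i. c (e i))" for c :: "'d \<Rightarrow> real^'d"
  have slot: "linear (\<lambda>u. \<Psi> (c(j := u)))" for c j
  proof -
    obtain i where i: "i < m" "e i = j" using e unfolding bij_betw_def by (metis UNIV_I imageE lessThan_iff)
    have "\<Psi> (c(j := u)) = f ((\<lambda>i. c (e i))(i := u))" for u
      unfolding \<Psi>_def using dep i bij_betw_imp_inj_on[OF e] unfolding depends_on_first_def
      by (elim allE impE) (auto simp: inj_on_def)
    then show ?thesis using lin i by (simp add: slot_linear_def)
  qed
  have swap: "\<Psi> (\<lambda>j. c (Transposition.transpose p q j)) = - \<Psi> c" if "p \<noteq> q" for c p q
  proof -
    obtain p' q' where pq: "p' < m" "e p' = p" "q' < m" "e q' = q" using e unfolding bij_betw_def by (metis UNIV_I imageE lessThan_iff)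
    have "p' \<noteq> q'" using pq that by auto
    have "\<Psi> (\<lambda>j. c (Transposition.transpose p q j)) = f (\<lambda>i. c (e (Transposition.transpose p' q' i)))"
      unfolding \<Psi>_def using dep pq bij_betw_imp_inj_on[OF e] unfolding depends_on_first_def
      by (elim allE impE) (auto simp: inj_on_def Transposition.transpose_def)
    also have "\<dots> = of_int (sign (Transposition.transpose p' q')) * \<Psi> c"
      unfolding \<Psi>_def by (rule alt[of _ "\<lambda>i. c (e i)"]) (use pq in \<open>auto intro: permutes_swap_id\<close>)
    finally show ?thesis using \<open>p' \<noteq> q'\<close> by (simp add: sign_swap_id)
  qed
  have scale: "\<Psi> (\<lambda>j. if j \<in> S then d j *\<^sub>R c j else c j) = (\<Prod>j\<in>S. d j) * \<Psi> c" if "finite S" for S d c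
    using that
  proof (induction S)
    case (insert k S)
    have eq: "(\<lambda>j. if j \<in> insert k S then d j *\<^sub>R c j else c j)
        = (\<lambda>j. if j \<in> S then d j *\<^sub>R c j else c j)(k := d k *\<^sub>R c k)"
      by auto
    have eq': "(\<lambda>j. if j \<in> S then d j *\<^sub>R c j else c j)(k := c k) = (\<lambda>j. if j \<in> S then d j *\<^sub>R c j else c j)"
      using insert by auto
    show ?case unfolding eq using linear_scale[OF slot, of _ k "d k" "c k"] insert eq' by simp
  qed simp
  \<comment> \<open>The claim ranges over all families \<open>c\<close>: for a product
    \<open>A ** B\<close>, the hypothesis for \<open>A\<close> is applied to the family already
    combined by \<open>B\<close>.\<close>
  have comb: "\<Psi> (\<lambda>j. \<Sum>k\<in>UNIV. A $ j $ k *\<^sub>R c k) = det A * \<Psi> c" for A :: "real^'d^'d" and c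
  proof (induction A arbitrary: c rule: induct_matrix_elementary_alt)
    case mult: (1 A B)
    have "(\<Sum>k\<in>UNIV. (A ** B) $ j $ k *\<^sub>R c k) = (\<Sum>l\<in>UNIV. A $ j $ l *\<^sub>R (\<Sum>k\<in>UNIV. B $ l $ k *\<^sub>R c k))" for j
      by (simp add: matrix_matrix_mult_def scaleR_sum_left scaleR_sum_right) (rule sum.swap)
    then show ?case using mult by (simp add: det_mul)
  next
    case zero_row: (2 A i)
    define c' where "c' = (\<lambda>j. \<Sum>k\<in>UNIV. A $ j $ k *\<^sub>R c k)"
    have "c' i = 0" using zero_row by (simp add: c'_def row_def vec_eq_iff)
    then have "c' = c'(i := 0)" by auto
    then have "\<Psi> c' = 0" using linear_0[OF slot, of c' i] by simp
    then show ?case using det_zero_row(2)[of i A] zero_row by (simp add: c'_def)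
  next
    case diagonal: (3 A)
    have "(\<Sum>k\<in>UNIV. A $ j $ k *\<^sub>R c k) = A $ j $ j *\<^sub>R c j" for j
    proof -
      have "(\<Sum>k\<in>UNIV. A $ j $ k *\<^sub>R c k) = (\<Sum>k\<in>UNIV. if k = j then A $ j $ j *\<^sub>R c j else 0)"
        using diagonal by (intro sum.cong) auto
      then show ?thesis by simp
    qed
    then show ?case using scale[of UNIV "\<lambda>j. A $ j $ j" c] diagonal by (simp add: det_diagonal)
  next
    case swap1: (4 p q)
    have s: "(\<chi> i j. mat 1 $ i $ Transposition.transpose p q j) = (\<chi> i. (mat 1 :: real^'d^'d) $ Transposition.transpose p q i)"
      by (auto simp: vec_eq_iff mat_def Transposition.transpose_def)
    have "det (\<chi> i. (mat 1 :: real^'d^'d) $ Transposition.transpose p q i) = - 1"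
      using det_permute_rows[of "Transposition.transpose p q" "mat 1 :: real^'d^'d"] swap1
      by (simp add: permutes_swap_id sign_swap_id)
    moreover have "(\<Sum>k\<in>UNIV. (\<chi> i. (mat 1 :: real^'d^'d) $ Transposition.transpose p q i) $ j $ k *\<^sub>R c k)
        = c (Transposition.transpose p q j)" for j
      by (simp add: mat_def if_distrib[of "\<lambda>x. x *\<^sub>R _"] cong: if_cong)
    ultimately show ?case unfolding s using swap[OF swap1] by simp
  next
    case idplus: (5 p q)
    have d: "(\<chi> i j. of_bool (i = p \<and> j = q \<or> i = j)) =
        (\<chi> k. if k = p then row p (mat 1 :: real^'d^'d) + 1 *s row q (mat 1) else row k (mat 1))"
      using idplus by (auto simp: vec_eq_iff mat_def row_def)
    have "det (\<chi> i j. of_bool (i = p \<and> j = q \<or> i = j) :: real^'d^'d) = 1"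
      unfolding d using det_row_operation[OF idplus, of "mat 1 :: real^'d^'d" 1] by simp
    moreover have "(\<lambda>j. \<Sum>k\<in>UNIV. (\<chi> i j. of_bool (i = p \<and> j = q \<or> i = j) :: real^'d^'d) $ j $ k *\<^sub>R c k)
        = c(p := c p + c q)"
    proof
      fix j
      have "(\<Sum>k\<in>UNIV. (\<chi> i j. of_bool (i = p \<and> j = q \<or> i = j) :: real^'d^'d) $ j $ k *\<^sub>R c k)
         = (\<Sum>k\<in>UNIV. (if k = j then c j else 0) + (if k = q then (if j = p then c q else 0) else 0))"
        using idplus by (intro sum.cong) auto
      then show "(\<Sum>k\<in>UNIV. (\<chi> i j. of_bool (i = p \<and> j = q \<or> i = j) :: real^'d^'d) $ j $ k *\<^sub>R c k) =
          (c(p := c p + c q)) j"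
        by (simp add: sum.distrib)
    qed
    \<comment> \<open>Exchanging two equal members changes nothing and yet flips the sign.\<close>
    moreover have "\<Psi> (c(p := c q)) = 0"
    proof -
      have "(\<lambda>j. (c(p := c q)) (Transposition.transpose p q j)) = c(p := c q)"
        by (auto simp: Transposition.transpose_def)
      then show ?thesis using swap[OF idplus, of "c(p := c q)"] by simp
    qed
    ultimately show ?case using linear_add[OF slot, of c p "c p" "c q"] by simp
  qed
  have "(\<lambda>j. \<Sum>k\<in>UNIV. A $ j $ k *\<^sub>R axis k 1) = (\<lambda>j. row j A)" for A :: "real^'d^'d"
    by (auto simp: vec_eq_iff axis_def row_def if_distrib cong: if_cong)
  then have "\<Psi> (\<lambda>j. row j A) = det A * \<Psi> (\<lambda>j. axis j 1)" for A :: "real^'d^'d"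
    using comb[of A "\<lambda>j. axis j 1"] by simp
  \<comment> \<open>Combining the standard basis gives the rows of the matrix, whereas
    \<open>A *v axis j 1\<close> is a column; the determinant is the same for the transpose.\<close>
  from this[of "Finite_Cartesian_Product.transpose A"] show ?thesis
    by (simp add: \<Psi>_def matrix_vector_mul_component matrix_vector_mult_basis)
qed

text \<open>The matrix \<open>B\<close> encodes the 2-form \<open>(u, w) \<mapsto> u \<bullet> (B *v w)\<close>; \<open>contact_top n a B\<close> is then
  \<open>a \<and> B\<^sup>n\<close>, where \<open>B\<close> is treated as a variable independent of \<open>a\<close>.\<close>

definition contact_top :: "nat \<Rightarrow> real^'d::finite \<Rightarrow> real^'d^'d \<Rightarrow> (nat \<Rightarrow> real^'d) \<Rightarrow> real" where
  "contact_top n a B = wedge 1 (2 * n) (\<lambda>v. a \<bullet> v 0) (wedge_power 2 (\<lambda>v. v 0 \<bullet> (B *v v 1)) n)"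

text \<open>The matrix of the 2-form \<open>b \<and> a\<close>, in the convention of
  \<open>contact_top\<close>.\<close>

definition skew :: "real^'d \<Rightarrow> real^'d \<Rightarrow> real^'d^'d" where
  "skew b a = (\<chi> i j. b $ i * a $ j - a $ i * b $ j)"

lemma inner_skew: "u \<bullet> (skew b a *v w) = (b \<bullet> u) * (a \<bullet> w) - (a \<bullet> u) * (b \<bullet> w)"
proof -
  have "skew b a *v w = (a \<bullet> w) *\<^sub>R b - (b \<bullet> w) *\<^sub>R a"
    by (simp add: skew_def vec_eq_iff inner_vec_def matrix_vector_mult_def sum_distrib_left
        sum_subtractf algebra_simps)
  then show ?thesis by (simp add: inner_diff_right inner_commute mult.commute)
qed

lemma alternating_form2:
  "slot_linear 2 (\<lambda>v. v 0 \<bullet> (B *v v (1::nat)))" "depends_on_first 2 (\<lambda>v. v 0 \<bullet> (B *v v (1::nat)))"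
  for B :: "real^'d::finite^'d"
proof -
  show "depends_on_first 2 (\<lambda>v. v 0 \<bullet> (B *v v (1::nat)))" by (simp add: depends_on_first_def)
  show "slot_linear 2 (\<lambda>v. v 0 \<bullet> (B *v v (1::nat)))"
    unfolding slot_linear_def
  proof (intro allI impI)
    fix v :: "nat \<Rightarrow> real^'d" and i :: nat assume "i < 2"
    then consider "i = 0" | "i = 1" by linarith
    then show "linear (\<lambda>u. (v(i := u)) 0 \<bullet> (B *v (v(i := u)) 1))"
      by cases (auto intro!: linearI simp: inner_add_left inner_add_right matrix_vector_right_distrib
          matrix_vector_mult_scaleR)
  qed
qed

lemma alternating_wedge_power:
  assumes "slot_linear k \<omega>" "depends_on_first k \<omega>"
  shows "slot_linear (k * n) (wedge_power k \<omega> n) \<and> depends_on_first (k * n) (wedge_power k \<omega> n)"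
proof (induction n)
  case 0
  show ?case by (simp add: slot_linear_def depends_on_first_def)
next
  case (Suc n)
  show ?case
    using slot_linear_wedge[OF assms, of "k * n" "wedge_power k \<omega> n"]
      depends_on_first_wedge[OF assms(2), of "k * n" "wedge_power k \<omega> n"] Suc by simp
qed

lemma std_frame_bij:
  "bij_betw (\<lambda>i. sorted_list_of_set (UNIV :: 'd set) ! i) {..<CARD('d)} (UNIV :: 'd::{finite,wellorder} set)"
  using bij_betw_nth[of "sorted_list_of_set (UNIV :: 'd set)"] by simp

lemma wedge_pullback:
  "wedge k l (\<lambda>v. \<omega> (\<lambda>i. L (v i))) (\<lambda>v. \<eta> (\<lambda>i. L (v i))) v = wedge k l \<omega> \<eta> (\<lambda>i. L (v i))"
  by (simp add: wedge_def)

lemma wedge_power_pullback: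
  "wedge_power k (\<lambda>v. \<omega> (\<lambda>i. L (v i))) n = (\<lambda>v. wedge_power k \<omega> n (\<lambda>i. L (v i)))"
proof (induction n)
  case (Suc n)
  show ?case by (rule ext) (simp only: wedge_power.simps Suc wedge_pullback)
qed simp

abbreviation mtr :: "real^'n^'m \<Rightarrow> real^'m^'n" where
  "mtr \<equiv> Finite_Cartesian_Product.transpose"

lemma inner_mult_right: "x \<bullet> (A *v y) = (mtr A *v x) \<bullet> y" for x :: "real^'m::finite" and y :: "real^'n::finite"
  by (metis dot_lmul_matrix vector_transpose_matrix transpose_transpose)

text \<open>\<open>mtr L *v a\<close> and \<open>mtr L ** B ** L\<close> are the pullbacks along
  \<open>L\<close> of the two forms, and the wedge product commutes with pullback.\<close>

lemma contact_top_pullback: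
  fixes L :: "real^'d::finite^'d"
  shows "contact_top n (mtr L *v a) (mtr L ** B ** L) v = contact_top n a B (\<lambda>i. L *v v i)"
proof -
  have 1: "(mtr L *v a) \<bullet> x = a \<bullet> (L *v x)" for x by (simp add: inner_mult_right)
  have 2: "x \<bullet> ((mtr L ** B ** L) *v y) = (L *v x) \<bullet> (B *v (L *v y))" for x y
    by (simp add: inner_mult_right[of x] inner_mult_right[of "L *v x"] matrix_vector_mul_assoc
        matrix_transpose_mul matrix_mul_assoc)
  show ?thesis
    unfolding contact_top_def 1 2
    wedge_power_pullback[of 2 "\<lambda>v. v 0 \<bullet> (B *v v 1)" "(*v) L"]
    by (rule wedge_pullback)
qed

lemma contact_top_std_frame:
  fixes L :: "real^'d::{finite,wellorder}^'d::_"
  assumes "CARD('d) = 2 * n + 1"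
  shows "contact_top n a B (\<lambda>i. L *v std_frame i) = det L * contact_top n a B std_frame"
  unfolding std_frame_def
proof (rule alternating_det)
  have P: "slot_linear (2 * n) (wedge_power 2 (\<lambda>v. v 0 \<bullet> (B *v v 1)) n)"
    "depends_on_first (2 * n) (wedge_power 2 (\<lambda>v. v 0 \<bullet> (B *v v 1)) n)"
    using alternating_wedge_power[OF alternating_form2] by auto
  have a: "slot_linear 1 (\<lambda>v. a \<bullet> v 0)" "depends_on_first 1 (\<lambda>v. a \<bullet> v 0)"
    by (auto simp: slot_linear_def depends_on_first_def inner_add_right intro!: linearI)
  show "slot_linear (1 + 2 * n) (contact_top n a B)" "depends_on_first (1 + 2 * n) (contact_top n a B)"
    unfolding contact_top_def by (intro slot_linear_wedge depends_on_first_wedge P a)+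
  show "contact_top n a B (\<lambda>i. v (\<tau> i)) = of_int (sign \<tau>) * contact_top n a B v"
    if "\<tau> permutes {..<1 + 2 * n}" for \<tau> v
    unfolding contact_top_def by (rule wedge_permute[OF that])
  show "bij_betw (\<lambda>i. sorted_list_of_set (UNIV :: 'd set) ! i) {..<1 + 2 * n} (UNIV :: 'd set)"
    using std_frame_bij[where 'd = 'd] assms by simp
qed

text \<open>A form of degree equal to the dimension \<open>2 * n + 1\<close> is multiplied by
  \<open>det L\<close> under pullback. Applied to Jacobians this is the transition law of the
  contact density; to first order at the identity it produces the divergence term.\<close>

lemma contact_top_det:
  fixes L :: "real^'d::{finite,wellorder}^'d::_"
  assumes "CARD('d) = 2 * n + 1"
  shows "contact_top n (mtr L *v a) (mtr L ** B ** L) std_frame = det L * contact_top n a B std_frame"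
  by (simp only: contact_top_pullback contact_top_std_frame[OF assms])

section \<open>Scaling, and dependence on the restriction of \<open>B\<close> to the kernel of
  \<open>a\<close>\<close>

lemma wedge_scale: "wedge k l (\<lambda>v. r * \<omega> v) (\<lambda>v. s * \<eta> v) = (\<lambda>v. r * s * wedge k l \<omega> \<eta> v)"
  by (simp add: wedge_def fun_eq_iff sum_distrib_left mult.assoc mult.left_commute)

lemma wedge_power_scale: "wedge_power k (\<lambda>v. r * \<omega> v) n = (\<lambda>v. r ^ n * wedge_power k \<omega> n v)"
  by (induction n) (simp_all add: wedge_scale)

text \<open>One factor comes from \<open>a\<close> and \<open>n\<close> factors come from
  \<open>B\<close>. This degree is the origin of the exponent \<open>n + 1\<close> in the
  functional.\<close>

lemma contact_top_scale: "contact_top n (r *\<^sub>R a) (r *\<^sub>R B) v = r ^ Suc n * contact_top n a B v"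
  by (simp add: contact_top_def scaleR_matrix_vector_assoc[symmetric] wedge_power_scale wedge_scale)

lemma wedge_power_cong_kernel:
  assumes "\<And>u w. a \<bullet> u = 0 \<Longrightarrow> a \<bullet> w = 0 \<Longrightarrow> u \<bullet> (B *v w) = u \<bullet> (B' *v w)"
    and "\<And>i. i < 2 * n \<Longrightarrow> a \<bullet> v i = 0"
  shows "wedge_power 2 (\<lambda>v. v 0 \<bullet> (B *v v 1)) n v = wedge_power 2 (\<lambda>v. v 0 \<bullet> (B' *v v 1)) n v"
  using assms(2)
proof (induction n arbitrary: v)
  case (Suc n)
  have ker: "a \<bullet> v (\<sigma> i) = 0" if "\<sigma> permutes {..<2 + 2 * n}" "i < 2 + 2 * n" for \<sigma> i
    using Suc.prems permutes_lessThan_less[OF that] by simp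
  show ?case
    unfolding wedge_power.simps wedge_def
  proof (intro arg_cong[of _ _ "\<lambda>s. s / _"] sum.cong refl)
    fix \<sigma> assume "\<sigma> \<in> {\<sigma>. \<sigma> permutes {..<2 + 2 * n}}"
    then have \<sigma>: "\<sigma> permutes {..<2 + 2 * n}" by simp
    have "v (\<sigma> 0) \<bullet> (B *v v (\<sigma> 1)) = v (\<sigma> 0) \<bullet> (B' *v v (\<sigma> 1))"
      by (intro assms(1) ker[OF \<sigma>]) auto
    moreover have "wedge_power 2 (\<lambda>v. v 0 \<bullet> (B *v v 1)) n (\<lambda>i. v (\<sigma> (2 + i)))
        = wedge_power 2 (\<lambda>v. v 0 \<bullet> (B' *v v 1)) n (\<lambda>i. v (\<sigma> (2 + i)))"
      by (intro Suc.IH ker[OF \<sigma>]) auto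
    ultimately show "of_int (sign \<sigma>) * (v (\<sigma> 0) \<bullet> (B *v v (\<sigma> 1))) * wedge_power 2 (\<lambda>v. v 0 \<bullet> (B *v v 1)) n (\<lambda>i. v (\<sigma> (2 + i)))
       = of_int (sign \<sigma>) * (v (\<sigma> 0) \<bullet> (B' *v v (\<sigma> 1))) * wedge_power 2 (\<lambda>v. v 0 \<bullet> (B' *v v 1)) n (\<lambda>i. v (\<sigma> (2 + i)))"
      by simp
  qed
qed simp

text \<open>In a frame all but one of whose members lie in the kernel of \<open>a\<close>, every nonzero term of
  \<open>a \<and> B\<^sup>n\<close> evaluates \<open>B\<close> on the kernel only.\<close>

lemma contact_top_cong_kernel:
  fixes a :: "real^'d::{finite,wellorder}"
  assumes "CARD('d) = 2 * n + 1" "a \<noteq> 0"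
    and B: "\<And>u w. a \<bullet> u = 0 \<Longrightarrow> a \<bullet> w = 0 \<Longrightarrow> u \<bullet> (B *v w) = u \<bullet> (B' *v w)"
  shows "contact_top n a B std_frame = contact_top n a B' std_frame"
proof -
  define e where "e i = sorted_list_of_set (UNIV :: 'd set) ! i" for i
  have e: "bij_betw e {..<2 * n + 1} UNIV" using std_frame_bij[where 'd = 'd] assms(1) by (simp add: e_def[abs_def])
  have "norm (a /\<^sub>R norm a) = 1" using \<open>a \<noteq> 0\<close> by simp
  \<comment> \<open>A rotated frame whose first member is \<open>a\<close> normalized and whose
    other members are orthogonal to \<open>a\<close>. Changing to it multiplies both sides by
    \<open>det L\<close>, which is cancelled at the end.\<close>
  then obtain L :: "real^'d::_^'d::_" where L: "orthogonal_matrix L" "L *v axis (e 0) 1 = a /\<^sub>R norm a"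
    by (rule orthogonal_matrix_exists_basis)
  have aL: "a \<bullet> (L *v axis j 1) = (if j = e 0 then norm a else 0)" for j
  proof -
    have "a = norm a *\<^sub>R (L *v axis (e 0) 1)" using L(2) \<open>a \<noteq> 0\<close> by simp
    then have "a \<bullet> (L *v axis j 1) = norm a * (((mtr L ** L) *v axis (e 0) 1) \<bullet> axis j 1)"
      by (metis inner_mult_right inner_scaleR_left matrix_vector_mul_assoc)
    also have "\<dots> = norm a * (axis (e 0) 1 \<bullet> (axis j 1 :: real^'d::_))"
      using L(1) by (simp add: orthogonal_matrix)
    finally show ?thesis by (simp add: inner_axis_axis)
  qed
  define v where "v i = L *v std_frame i" for i
  have v: "a \<bullet> v i = 0" if "i < 2 * n + 1" "i \<noteq> 0" for i
    using that bij_betw_imp_inj_on[OF e] aL[of "e i"] by (auto simp: v_def std_frame_def e_def inj_on_def)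
  have "contact_top n a B v = contact_top n a B' v"
    unfolding contact_top_def wedge_def
  proof (intro arg_cong[of _ _ "\<lambda>s. s / _"] sum.cong refl)
    fix \<sigma> assume "\<sigma> \<in> {\<sigma>. \<sigma> permutes {..<1 + 2 * n}}"
    then have \<sigma>: "\<sigma> permutes {..<1 + 2 * n}" by simp
    show "of_int (sign \<sigma>) * (a \<bullet> v (\<sigma> 0)) * wedge_power 2 (\<lambda>v. v 0 \<bullet> (B *v v 1)) n (\<lambda>i. v (\<sigma> (1 + i)))
       = of_int (sign \<sigma>) * (a \<bullet> v (\<sigma> 0)) * wedge_power 2 (\<lambda>v. v 0 \<bullet> (B' *v v 1)) n (\<lambda>i. v (\<sigma> (1 + i)))"
    \<comment> \<open>If \<open>\<sigma> 0 = 0\<close>, the only frame vector outside the kernel is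
      consumed by \<open>a\<close>, and \<open>B\<close> sees the kernel alone; otherwise the factor
      \<open>a \<bullet> v (\<sigma> 0)\<close> is zero.\<close>
    proof (cases "\<sigma> 0 = 0")
      case True
      have "a \<bullet> v (\<sigma> (1 + i)) = 0" if "i < 2 * n" for i
        using permutes_lessThan_less[OF \<sigma>, of "1 + i"] injD[OF permutes_inj[OF \<sigma>], of "1 + i" 0] True that
        by (intro v) auto
      then show ?thesis using wedge_power_cong_kernel[OF B] by simp
    next
      case False
      then show ?thesis using v[of "\<sigma> 0"] permutes_lessThan_less[OF \<sigma>, of 0] by simp
    qed
  qed
  then have "det L * contact_top n a B std_frame = det L * contact_top n a B' std_frame"
    unfolding v_def contact_top_std_frame[OF assms(1)] .
  moreover have "det L \<noteq> 0" using det_orthogonal_matrix[OF L(1)] by auto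
  ultimately show ?thesis by simp
qed

text \<open>\<open>b \<and> a\<close> vanishes on pairs from the kernel of \<open>a\<close>. The
  lemma removes the term \<open>df \<and> a\<close> of the Lie derivative of \<open>da\<close>, and
  the term \<open>dh \<and> \<alpha>\<close> of \<open>d(h \<alpha>)\<close>.\<close>

lemma contact_top_add_skew:
  fixes a :: "real^'d::{finite,wellorder}"
  assumes "CARD('d) = 2 * n + 1"
  shows "contact_top n a (B + skew b a) std_frame = contact_top n a B std_frame"
proof (cases "a = 0")
  case True
  then have "skew b a = 0" by (simp add: skew_def vec_eq_iff)
  then show ?thesis by simp
next
  case False
  show ?thesis
    by (rule contact_top_cong_kernel[OF assms False])
      (simp add: matrix_vector_mult_add_rdistrib inner_add_right inner_skew)
qed

subsection \<open>The differential of the contact density\<close>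

lemma smooth_on_wedge:
  assumes "open S" "\<And>v. smooth_on S (\<lambda>x. \<omega> x v)" "\<And>v. smooth_on S (\<lambda>x. \<eta> x v)"
  shows "smooth_on S (\<lambda>x. wedge k l (\<omega> x) (\<eta> x) v)"
  unfolding wedge_def divide_inverse
  by (intro smooth_on_mult smooth_on_sum smooth_on_const assms)

lemma smooth_on_wedge_power:
  assumes "open S" "\<And>v. smooth_on S (\<lambda>x. \<omega> x v)"
  shows "smooth_on S (\<lambda>x. wedge_power k (\<omega> x) n v)"
  by (induction n arbitrary: v) (auto intro: smooth_on_const smooth_on_wedge assms)

lemma smooth_on_contact_top:
  assumes "open S" "smooth_on S a" "smooth_on S B"
  shows "smooth_on S (\<lambda>x. contact_top n (a x) (B x) v)"
  unfolding contact_top_def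
proof (intro smooth_on_wedge smooth_on_wedge_power assms(1))
  show "smooth_on S (\<lambda>x. a x \<bullet> v 0)" for v
    by (rule smooth_on_linear[OF assms(1) bounded_linear_inner_left assms(2)])
  show "smooth_on S (\<lambda>x. v 0 \<bullet> (B x *v v 1))" for v
  proof -
    have "linear (\<lambda>B. v 0 \<bullet> (B *v v 1))"
      by (intro linearI) (simp_all add: matrix_vector_mult_add_rdistrib inner_add_right
          scaleR_matrix_vector_assoc[symmetric])
    then show ?thesis
      using smooth_on_linear[OF assms(1) _ assms(3)] linear_conv_bounded_linear by blast
  qed
qed

text \<open>A permutation other than the identity moves at least two points, so its product vanishes
  to second order at \<open>t = 0\<close>. The identity contributes the trace.\<close>

lemma det_derivative_at_one:
  fixes E :: "real^'d::finite^'d"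
  shows "((\<lambda>t. det (mat 1 + t *\<^sub>R E)) has_real_derivative trace E) (at 0)"
proof -
  let ?D = "\<lambda>p. of_int (sign p) * (\<Sum>i\<in>UNIV. E $ i $ p i * (\<Prod>j\<in>UNIV - {i}. mat 1 $ j $ p j + 0 * E $ j $ p j))"
  have "((\<lambda>t. \<Sum>p | p permutes (UNIV :: 'd set). of_int (sign p) * (\<Prod>i\<in>UNIV. mat 1 $ i $ p i + t * E $ i $ p i))
     has_real_derivative (\<Sum>p | p permutes (UNIV :: 'd set). ?D p)) (at 0)"
    by (intro DERIV_sum DERIV_cmult has_field_derivative_prod) (auto intro!: derivative_eq_intros)
  moreover have "?D p = (if p = id then trace E else 0)" if p: "p permutes (UNIV :: 'd set)" for p
  proof (cases "p = id")
    case True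
    then show ?thesis by (simp add: trace_def mat_def)
  next
    case False
    have "\<exists>j\<in>UNIV - {i}. mat 1 $ j $ p j + 0 * E $ j $ p j = 0" for i
    proof -
      obtain k where "p k \<noteq> k" using False by (auto simp: fun_eq_iff)
      moreover have "p (p k) \<noteq> p k" using permutes_inj[OF p] \<open>p k \<noteq> k\<close> by (auto simp: inj_def)
      ultimately obtain j where "j \<noteq> i" "p j \<noteq> j" by (cases "k = i") auto
      then show ?thesis by (intro bexI[of _ j]) (auto simp: mat_def)
    qed
    then have "(\<Prod>j\<in>UNIV - {i}. mat 1 $ j $ p j + 0 * E $ j $ p j) = 0" for i
      by (intro prod_zero) auto
    then have "?D p = 0" by (simp only: mult_zero_right sum.neutral_const)
    then show ?thesis using False by simp
  qed
  then have "(\<Sum>p | p permutes (UNIV :: 'd set). ?D p) = trace E"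
    by (simp add: finite_permutations permutes_id)
  ultimately show ?thesis by (simp add: det_def)
qed

text \<open>Reads off a differential in one direction from a curve along which \<open>G\<close> is
  known explicitly, without expanding \<open>G\<close> itself.\<close>

lemma has_derivative_along_curve:
  assumes D: "(G has_derivative D) (at q)" and \<gamma>: "(\<gamma> has_vector_derivative d) (at 0)" "\<gamma> 0 = q"
    and e: "((\<lambda>t. G (\<gamma> t)) has_real_derivative e) (at 0)"
  shows "D d = e"
proof -
  have "((\<lambda>t. G (\<gamma> t)) has_derivative (\<lambda>t. D (t *\<^sub>R d))) (at 0)"
    using has_derivative_compose[of \<gamma> "\<lambda>t. t *\<^sub>R d" 0 UNIV G D] assms
    by (simp add: has_vector_derivative_def)
  then have "(\<lambda>t. D (t *\<^sub>R d)) = (*) e"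
    using e by (auto simp: has_field_derivative_def dest: has_derivative_unique)
  from fun_cong[OF this, of 1] show ?thesis by simp
qed

text \<open>The curves are the scaling by \<open>1 + t\<close>, the line in the direction
  \<open>skew b a\<close>, and the pullback along \<open>mat 1 + t *\<^sub>R M\<close>. Along them
  the initial value is multiplied by \<open>(1 + t) ^ Suc n\<close>, by 1, and by
  \<open>det (mat 1 + t *\<^sub>R M)\<close>.\<close>

lemma contact_top_differential:
  fixes a :: "real^'d::{finite,wellorder}" and B :: "real^'d::_^'d::_"
  assumes card: "CARD('d) = 2 * n + 1"
    and D: "((\<lambda>p. contact_top n (fst p) (snd p) std_frame) has_derivative D) (at (a, B))"
  shows "D (a, B) = real (n + 1) * contact_top n a B std_frame"
    and "D (0, skew b a) = 0"
    and "D (mtr M *v a, mtr M ** B + B ** M) = trace M * contact_top n a B std_frame"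
proof -
  note along = has_derivative_along_curve[OF D]
  let ?G = "contact_top n a B std_frame"
  show "D (a, B) = real (n + 1) * ?G"
  proof (rule along[of "\<lambda>t. (a, B) + t *\<^sub>R (a, B)"])
    show "((\<lambda>t. (a, B) + t *\<^sub>R (a, B)) has_vector_derivative (a, B)) (at 0)"
      by (auto intro!: derivative_eq_intros simp: has_vector_derivative_def)
    have "contact_top n (fst ((a, B) + t *\<^sub>R (a, B))) (snd ((a, B) + t *\<^sub>R (a, B))) std_frame = (1 + t) ^ Suc n * ?G" for t
      using contact_top_scale[of n "1 + t" a B std_frame] by (simp add: scaleR_add_left)
    then show "((\<lambda>t. contact_top n (fst ((a, B) + t *\<^sub>R (a, B))) (snd ((a, B) + t *\<^sub>R (a, B))) std_frame)
       has_real_derivative real (n + 1) * ?G) (at 0)"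
      by (auto intro!: derivative_eq_intros simp: algebra_simps)
  qed simp
  show "D (0, skew b a) = 0"
  proof (rule along[of "\<lambda>t. (a, B) + t *\<^sub>R (0, skew b a)"])
    show "((\<lambda>t. (a, B) + t *\<^sub>R (0, skew b a)) has_vector_derivative (0, skew b a)) (at 0)"
      by (auto intro!: derivative_eq_intros simp: has_vector_derivative_def)
    have "t *\<^sub>R skew b a = skew (t *\<^sub>R b) a" for t
      by (simp add: skew_def vec_eq_iff algebra_simps)
    then show "((\<lambda>t. contact_top n (fst ((a, B) + t *\<^sub>R (0, skew b a))) (snd ((a, B) + t *\<^sub>R (0, skew b a))) std_frame)
       has_real_derivative 0) (at 0)"
      by (simp add: contact_top_add_skew[OF card])
  qed simp
  show "D (mtr M *v a, mtr M ** B + B ** M) = trace M * ?G"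
  \<comment> \<open>The term in \<open>t * t\<close> makes the curve the exact pullback along
    \<open>mat 1 + t *\<^sub>R M\<close>, so that \<open>contact_top_det\<close> applies for every
    \<open>t\<close>; it does not affect the velocity at 0.\<close>
  proof (rule along[of "\<lambda>t. (a, B) + t *\<^sub>R (mtr M *v a, mtr M ** B + B ** M) + (t * t) *\<^sub>R (0, mtr M ** B ** M)"])
    show "((\<lambda>t. (a, B) + t *\<^sub>R (mtr M *v a, mtr M ** B + B ** M) + (t * t) *\<^sub>R (0, mtr M ** B ** M))
       has_vector_derivative (mtr M *v a, mtr M ** B + B ** M)) (at 0)"
      by (auto intro!: derivative_eq_intros simp: has_vector_derivative_def)
    have tr: "mtr (mat 1 + t *\<^sub>R M) = mat 1 + t *\<^sub>R mtr M" for t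
      by (simp add: Finite_Cartesian_Product.transpose_def vec_eq_iff mat_def)
    have mr: "(t *\<^sub>R X) ** Y = t *\<^sub>R (X ** Y)" "X ** (t *\<^sub>R Y) = t *\<^sub>R (X ** Y)" for t and X Y :: "real^'d::_^'d::_"
      by (simp_all add: matrix_matrix_mult_def vec_eq_iff sum_distrib_left mult_ac)
    have ad: "(X + Y) ** Z = X ** Z + Y ** Z" for X Y Z :: "real^'d::_^'d::_"
      by (simp add: matrix_matrix_mult_def vec_eq_iff sum.distrib algebra_simps)
    have "contact_top n (a + t *\<^sub>R (mtr M *v a)) (B + t *\<^sub>R (mtr M ** B + B ** M) + (t * t) *\<^sub>R (mtr M ** B ** M)) std_frame
        = det (mat 1 + t *\<^sub>R M) * ?G" for t
    proof -
      have 1: "a + t *\<^sub>R (mtr M *v a) = mtr (mat 1 + t *\<^sub>R M) *v a"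
        by (simp only: tr matrix_vector_mult_add_rdistrib scaleR_matrix_vector_assoc matrix_vector_mul_lid)
      have 2: "B + t *\<^sub>R (mtr M ** B + B ** M) + (t * t) *\<^sub>R (mtr M ** B ** M)
          = mtr (mat 1 + t *\<^sub>R M) ** B ** (mat 1 + t *\<^sub>R M)"
        by (simp add: tr matrix_add_ldistrib ad mr scaleR_add_right add_ac)
      show ?thesis unfolding 1 2 by (rule contact_top_det[OF card])
    qed
    then show "((\<lambda>t. contact_top n (fst ((a, B) + t *\<^sub>R (mtr M *v a, mtr M ** B + B ** M) + (t * t) *\<^sub>R (0, mtr M ** B ** M)))
         (snd ((a, B) + t *\<^sub>R (mtr M *v a, mtr M ** B + B ** M) + (t * t) *\<^sub>R (0, mtr M ** B ** M))) std_frame)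
       has_real_derivative trace M * ?G) (at 0)"
      using DERIV_cmult_right[OF det_derivative_at_one[of M], of ?G] by simp
  qed simp
qed

text \<open>The matrix of \<open>da\<close>, in the convention of
  \<open>contact_top\<close>.\<close>

definition curl :: "(real^'d::finite \<Rightarrow> real^'d) \<Rightarrow> real^'d \<Rightarrow> real^'d^'d" where
  "curl a x = (\<chi> i j. pderiv_at i a x $ j - pderiv_at j a x $ i)"

lemma ext_deriv_curl:
  assumes "a differentiable (at x)"
  shows "ext_deriv a x v = v 0 \<bullet> (curl a x *v v 1)"
proof -
  let ?S = "\<lambda>u w. \<Sum>i\<in>UNIV. \<Sum>j\<in>UNIV. u $ i * pderiv_at i a x $ j * w $ j"
  have 1: "frechet_derivative a (at x) u \<bullet> w = ?S u w" for u w
    unfolding frechet_derivative_eq_sum_pderiv_at[OF assms]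
    by (simp add: inner_sum_left) (simp add: inner_vec_def sum_distrib_left mult.assoc)
  have "v 0 \<bullet> (curl a x *v v 1) = ?S (v 0) (v 1) - (\<Sum>i\<in>UNIV. \<Sum>j\<in>UNIV. v 1 $ j * pderiv_at j a x $ i * v 0 $ i)"
    by (simp add: inner_vec_def matrix_vector_mult_def curl_def sum_distrib_left sum_subtractf algebra_simps)
  also have "(\<Sum>i\<in>UNIV. \<Sum>j\<in>UNIV. v 1 $ j * pderiv_at j a x $ i * v 0 $ i) = ?S (v 1) (v 0)"
    by (rule sum.swap)
  finally show ?thesis by (simp add: ext_deriv_def 1)
qed

text \<open>The passage to independent variables: the density is the polynomial
  \<open>contact_top\<close> evaluated along the curve of values \<open>(a, da)\<close>, so the
  chain rule gives its derivatives.\<close>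

lemma contact_density_eq:
  assumes "a differentiable (at x)"
  shows "contact_density n a x = contact_top n (a x) (curl a x) std_frame"
proof -
  have "form1 a x = (\<lambda>v. a x \<bullet> v 0)" "ext_deriv a x = (\<lambda>v. v 0 \<bullet> (curl a x *v v 1))"
    by (auto simp: form1_def ext_deriv_curl[OF assms])
  then show ?thesis by (simp add: contact_density_def contact_top_def)
qed

lemma smooth_on_vec:
  fixes f :: "'n::finite \<Rightarrow> 'a::real_normed_vector \<Rightarrow> 'b::euclidean_space"
  assumes "open S" "\<And>i. smooth_on S (f i)"
  shows "smooth_on S (\<lambda>x. \<chi> i. f i x)"
proof -
  have eq: "(\<chi> i. f i x) = (\<Sum>i\<in>UNIV. axis i (f i x))" for x
    by (simp add: vec_eq_iff axis_def)
  have "linear (axis i :: 'b \<Rightarrow> 'b^'n)" for i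
    by (intro linearI) (simp_all add: vec_eq_iff axis_def)
  then have bl: "bounded_linear (axis i :: 'b \<Rightarrow> 'b^'n)" for i
    by (simp add: linear_conv_bounded_linear)
  show ?thesis unfolding eq
    by (rule smooth_on_sum[OF assms(1) smooth_on_linear[OF assms(1) bl assms(2)]])
qed

lemma smooth_on_vec2:
  fixes f :: "'n::finite \<Rightarrow> 'm::finite \<Rightarrow> 'a::real_normed_vector \<Rightarrow> 'b::euclidean_space"
  assumes "open S" "\<And>i j. smooth_on S (f i j)"
  shows "smooth_on S (\<lambda>x. \<chi> i j. f i j x)"
  by (rule smooth_on_vec[OF assms(1) smooth_on_vec[OF assms]])

lemma smooth_on_curl: "open S \<Longrightarrow> smooth_on S a \<Longrightarrow> smooth_on S (curl a)"
  unfolding curl_def[abs_def]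
  by (intro smooth_on_vec2 smooth_on_diff smooth_on_nth smooth_on_pderiv_at)

lemma smooth_on_contact_density:
  assumes "open S" "smooth_on S a"
  shows "smooth_on S (contact_density n a)"
  by (rule smooth_on_cong[OF assms(1) _ smooth_on_contact_top[OF assms smooth_on_curl[OF assms]]])
    (simp add: contact_density_eq smooth_on_imp_differentiable[OF assms(2)])

text \<open>The Lie derivative along \<open>X\<close> commutes with \<open>d\<close>: if \<open>L\<^sub>Xa = f a\<close> then
  \<open>L\<^sub>X(da) = f da + df \<and> a\<close>, and hence \<open>L\<^sub>X(a \<and> (da)\<^sup>n) = (n + 1) f a \<and> (da)\<^sup>n\<close>.\<close>

lemma lie_curl:
  fixes a X :: "real^'d::finite \<Rightarrow> real^'d" and f :: "real^'d \<Rightarrow> real"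
  assumes S: "open S" "smooth_on S a" "smooth_on S X" "smooth_on S f"
    and eq: "\<And>x j. x \<in> S \<Longrightarrow> (\<Sum>k\<in>UNIV. X x $ k * pderiv_at k a x $ j + a x $ k * pderiv_at j X x $ k) = f x * a x $ j"
    and x: "x \<in> S"
  defines "M \<equiv> (\<chi> k j. pderiv_at j X x $ k)"
  shows "(\<Sum>k\<in>UNIV. X x $ k *\<^sub>R pderiv_at k (curl a) x) =
     f x *\<^sub>R curl a x + skew (\<chi> i. pderiv_at i f x) (a x) - (mtr M ** curl a x + curl a x ** M)"
proof -
  note sm = S(2-4) smooth_on_nth[OF S(1)] smooth_on_pderiv_at
  have d: "g differentiable (at x)" if "smooth_on S g" for g :: "real^'d \<Rightarrow> 'z::real_normed_vector"
    using smooth_on_imp_differentiable[OF that x] .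
  have sm2: "smooth_on S (\<lambda>x. pderiv_at k g x $ j)" if "smooth_on S g" for k j and g :: "real^'d \<Rightarrow> real^'d"
    by (intro sm that)
  note comm = pderiv_at_nth_commute[OF S(1) _ x]
  let ?E = "\<lambda>i j. \<Sum>k\<in>UNIV. pderiv_at i X x $ k * pderiv_at k a x $ j + X x $ k * pderiv_at i (\<lambda>x. pderiv_at k a x $ j) x
       + (pderiv_at i a x $ k * pderiv_at j X x $ k + a x $ k * pderiv_at i (\<lambda>x. pderiv_at j X x $ k) x)"
  have E: "?E i j = pderiv_at i f x * a x $ j + f x * pderiv_at i a x $ j" for i j
  proof -
    have "pderiv_at i (\<lambda>x. \<Sum>k\<in>UNIV. X x $ k * pderiv_at k a x $ j + a x $ k * pderiv_at j X x $ k) x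
        = pderiv_at i (\<lambda>x. f x * a x $ j) x"
      by (rule pderiv_at_cong[OF S(1) x eq])
        (auto intro!: d smooth_on_sum smooth_on_add smooth_on_mult sm2 sm S)
    also have "\<dots> = pderiv_at i f x * a x $ j + f x * pderiv_at i a x $ j"
      by (simp add: pderiv_at_mult pderiv_at_nth d S sm)
    finally show ?thesis
      by (simp add: pderiv_at_sum pderiv_at_add pderiv_at_mult pderiv_at_nth d S sm sm2
          smooth_on_add smooth_on_mult algebra_simps)
  qed
  show ?thesis
  proof (subst vec_eq_iff, intro allI, subst vec_eq_iff, intro allI)
    fix i j
    have "pderiv_at k (curl a) x $ i $ j = pderiv_at k (\<lambda>x. pderiv_at i a x $ j) x - pderiv_at k (\<lambda>x. pderiv_at j a x $ i) x" for k
    proof -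
      have sc: "smooth_on S (curl a)" by (rule smooth_on_curl[OF S(1,2)])
      have "pderiv_at k (curl a) x $ i $ j = pderiv_at k (\<lambda>x. curl a x $ i $ j) x"
        by (simp add: pderiv_at_nth d sc sm)
      also have "\<dots> = pderiv_at k (\<lambda>x. pderiv_at i a x $ j - pderiv_at j a x $ i) x"
        by (simp add: curl_def)
      finally show ?thesis by (simp add: pderiv_at_diff d sm2 S)
    qed
    then have L: "(\<Sum>k\<in>UNIV. X x $ k *\<^sub>R pderiv_at k (curl a) x) $ i $ j
      = (\<Sum>k\<in>UNIV. X x $ k * (pderiv_at i (\<lambda>x. pderiv_at k a x $ j) x - pderiv_at j (\<lambda>x. pderiv_at k a x $ i) x))"
      by (simp add: comm[OF S(2), of _ i j] comm[OF S(2), of _ j i])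
    have R: "(mtr M ** curl a x + curl a x ** M) $ i $ j
       = (\<Sum>k\<in>UNIV. pderiv_at i X x $ k * (pderiv_at k a x $ j - pderiv_at j a x $ k)
           + (pderiv_at i a x $ k - pderiv_at k a x $ i) * pderiv_at j X x $ k)"
      by (simp add: M_def curl_def matrix_matrix_mult_def Finite_Cartesian_Product.transpose_def sum.distrib)
    \<comment> \<open>The hypothesis, differentiated and antisymmetrized in \<open>i\<close> and
      \<open>j\<close>. The terms with second derivatives of \<open>X\<close> cancel by symmetry;
      what remains is the derivative of \<open>da\<close> along \<open>X\<close> together with the
      two matrix products.\<close>
    have "?E i j - ?E j i = (\<Sum>k\<in>UNIV. X x $ k * (pderiv_at i (\<lambda>x. pderiv_at k a x $ j) x - pderiv_at j (\<lambda>x. pderiv_at k a x $ i) x))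
      + (\<Sum>k\<in>UNIV. pderiv_at i X x $ k * (pderiv_at k a x $ j - pderiv_at j a x $ k)
           + (pderiv_at i a x $ k - pderiv_at k a x $ i) * pderiv_at j X x $ k)"
      unfolding comm[OF S(3), of j i]
      by (simp add: algebra_simps flip: sum.distrib sum_subtractf)
    then show "(\<Sum>k\<in>UNIV. X x $ k *\<^sub>R pderiv_at k (curl a) x) $ i $ j =
      (f x *\<^sub>R curl a x + skew (\<chi> i. pderiv_at i f x) (a x) - (mtr M ** curl a x + curl a x ** M)) $ i $ j"
      unfolding E L[symmetric] R[symmetric]
      by (simp add: skew_def curl_def algebra_simps)
  qed
qed

text \<open>The left side is the divergence of the density times \<open>X\<close>, that is, the
  coefficient of the Lie derivative of \<open>a \<and> (da)^n\<close>. By the chain rule its first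
  sum is the differential of \<open>contact_top\<close> at the derivative of
  \<open>(a, curl a)\<close> along \<open>X\<close>.\<close>

lemma div_contact_density:
  fixes a X :: "real^'d::{finite,wellorder} \<Rightarrow> real^'d::_" and f :: "real^'d::_ \<Rightarrow> real"
  assumes card: "CARD('d) = 2 * n + 1"
    and S: "open S" "smooth_on S a" "smooth_on S X" "smooth_on S f"
    and eq: "\<And>x j. x \<in> S \<Longrightarrow> (\<Sum>k\<in>UNIV. X x $ k * pderiv_at k a x $ j + a x $ k * pderiv_at j X x $ k) = f x * a x $ j"
    and x: "x \<in> S"
  shows "(\<Sum>k\<in>UNIV. X x $ k * pderiv_at k (contact_density n a) x) + (\<Sum>k\<in>UNIV. pderiv_at k X x $ k) * contact_density n a x
     = real (n + 1) * f x * contact_density n a x"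
proof -
  let ?G = "\<lambda>p::(real^'d::_) \<times> (real^'d::_^'d::_). contact_top n (fst p) (snd p) std_frame"
  define D where "D = frechet_derivative ?G (at (a x, curl a x))"
  define M where "M = (\<chi> k j. pderiv_at j X x $ k)"
  have "smooth_on UNIV (\<lambda>p::(real^'d::_) \<times> (real^'d::_^'d::_). p)"
    unfolding smooth_on_def
  proof
    fix k show "differentiable_class k UNIV (\<lambda>p::(real^'d::_) \<times> (real^'d::_^'d::_). p)"
      by (cases k) (auto simp: differentiable_class_const frechet_derivative_ident)
  qed
  then have "smooth_on UNIV ?G"
    by (intro smooth_on_contact_top smooth_on_linear[OF _ bounded_linear_fst] smooth_on_linear[OF _ bounded_linear_snd]) auto
  then have D: "(?G has_derivative D) (at (a x, curl a x))"
    unfolding D_def using smooth_on_imp_has_derivative by blast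
  have lin: "linear D" using D has_derivative_linear by blast
  have a': "(a has_derivative frechet_derivative a (at x)) (at x)"
    and c': "(curl a has_derivative frechet_derivative (curl a) (at x)) (at x)"
    using smooth_on_imp_has_derivative[OF _ x] S smooth_on_curl by blast+
  have "((\<lambda>y. ?G (a y, curl a y)) has_derivative (\<lambda>v. D (frechet_derivative a (at x) v, frechet_derivative (curl a) (at x) v))) (at x)"
    by (rule has_derivative_compose[OF has_derivative_Pair[OF a' c'] D])
  note der = this
  have "?G (a y, curl a y) = contact_density n a y" if "y \<in> S" for y
    using that by (simp add: contact_density_eq smooth_on_imp_differentiable[OF S(2)])
  then have "(contact_density n a has_derivative (\<lambda>v. D (frechet_derivative a (at x) v, frechet_derivative (curl a) (at x) v))) (at x)"
    by (rule has_derivative_transform_within_open[OF der S(1) x])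
  then have pd: "pderiv_at k (contact_density n a) x = D (pderiv_at k a x, pderiv_at k (curl a) x)" for k
    by (simp add: pderiv_at_def frechet_derivative_eqI)
  have "(\<Sum>k\<in>UNIV. X x $ k * pderiv_at k (contact_density n a) x)
      = D (\<Sum>k\<in>UNIV. X x $ k *\<^sub>R (pderiv_at k a x, pderiv_at k (curl a) x))"
    by (simp only: pd linear_sum[OF lin] linear_scale[OF lin] real_scaleR_def)
  also have "(\<Sum>k\<in>UNIV. X x $ k *\<^sub>R (pderiv_at k a x, pderiv_at k (curl a) x))
      = (\<Sum>k\<in>UNIV. X x $ k *\<^sub>R pderiv_at k a x, \<Sum>k\<in>UNIV. X x $ k *\<^sub>R pderiv_at k (curl a) x)"
    by (simp add: prod_eq_iff fst_sum snd_sum)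
  also have "(\<Sum>k\<in>UNIV. X x $ k *\<^sub>R pderiv_at k a x) = f x *\<^sub>R a x - mtr M *v a x"
    using eq[OF x] by (simp add: vec_eq_iff M_def matrix_vector_mult_def Finite_Cartesian_Product.transpose_def
        sum.distrib algebra_simps del: transpose_matrix_vector)
  also have "(\<Sum>k\<in>UNIV. X x $ k *\<^sub>R pderiv_at k (curl a) x) = 
     f x *\<^sub>R curl a x + skew (\<chi> i. pderiv_at i f x) (a x) - (mtr M ** curl a x + curl a x ** M)"
    unfolding M_def by (rule lie_curl[OF S eq x])
  \<comment> \<open>A splitting into the three directions evaluated by
    \<open>contact_top_differential\<close>. The trace coming from the last one cancels against the
    divergence of \<open>X\<close>.\<close>
  also have "(f x *\<^sub>R a x - mtr M *v a x, f x *\<^sub>R curl a x + skew (\<chi> i. pderiv_at i f x) (a x) - (mtr M ** curl a x + curl a x ** M))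
     = f x *\<^sub>R (a x, curl a x) + (0, skew (\<chi> i. pderiv_at i f x) (a x)) - (mtr M *v a x, mtr M ** curl a x + curl a x ** M)"
    by simp
  also have "D \<dots> = f x * (real (n + 1) * contact_density n a x) - trace M * contact_density n a x"
    unfolding linear_diff[OF lin] linear_add[OF lin] linear_scale[OF lin] contact_top_differential[OF card D]
      contact_density_eq[OF smooth_on_imp_differentiable[OF S(2) x]] by simp
  finally show ?thesis by (simp add: trace_def M_def algebra_simps)
qed

text \<open>The complex case splits into real and imaginary parts, as \<open>L\<^sub>X\<close> is complex linear in \<open>X\<close>.\<close>

lemma complex_div_contact_density:
  fixes a :: "real^'d::{finite,wellorder} \<Rightarrow> real^'d::_" and X :: "real^'d::_ \<Rightarrow> complex^'d::_"
  assumes card: "CARD('d) = 2 * n + 1"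
    and S: "open S" "smooth_on S a" "smooth_on S X" "smooth_on S f"
    and eq: "\<And>x. x \<in> S \<Longrightarrow> lie_deriv_local X a x = (\<chi> j. f x * of_real (a x $ j))"
    and x: "x \<in> S"
  shows "(\<Sum>k\<in>UNIV. X x $ k * of_real (pderiv_at k (contact_density n a) x)) + (\<Sum>k\<in>UNIV. pderiv_at k X x $ k) * of_real (contact_density n a x)
     = of_nat (n + 1) * f x * of_real (contact_density n a x)"
proof -
  \<comment> \<open>\<open>h\<close> will be \<open>Re\<close> and \<open>Im\<close>. Because
    \<open>a\<close> is real, applying \<open>h\<close> to the complex equation leaves the real
    equation for the field \<open>h (X x $ k)\<close> with the factor
    \<open>h (f x)\<close>.\<close>
  have part: "(\<Sum>k\<in>UNIV. h (X x $ k) * pderiv_at k (contact_density n a) x) + (\<Sum>k\<in>UNIV. h (pderiv_at k X x $ k)) * contact_density n a x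
     = real (n + 1) * h (f x) * contact_density n a x"
    if h: "bounded_linear h" "\<And>z r. h (z * of_real r) = h z * r" for h :: "complex \<Rightarrow> real"
  proof -
    let ?X = "\<lambda>x. \<chi> k. h (X x $ k)"
    have bl: "linear h" using h bounded_linear.linear by blast
    have sX: "smooth_on S ?X" by (intro smooth_on_vec S smooth_on_linear[OF _ h(1)] smooth_on_nth)
    have pX: "pderiv_at j ?X y $ k = h (pderiv_at j X y $ k)" if "y \<in> S" for y j k
    proof -
      have "pderiv_at j ?X y $ k = pderiv_at j (\<lambda>x. ?X x $ k) y"
        using pderiv_at_nth[OF smooth_on_imp_differentiable[OF sX that]] by metis
      also have "\<dots> = h (pderiv_at j (\<lambda>x. X x $ k) y)"
        using pderiv_at_linear[OF h(1) smooth_on_imp_differentiable[OF smooth_on_nth[OF S(1,3)] that]] by simp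
      finally show ?thesis by (simp add: pderiv_at_nth[OF smooth_on_imp_differentiable[OF S(3) that]])
    qed
    have "(\<Sum>k\<in>UNIV. ?X y $ k * pderiv_at k a y $ j + a y $ k * pderiv_at j ?X y $ k) = h (f y) * a y $ j"
      if "y \<in> S" for y j
    proof -
      have "h (lie_deriv_local X a y $ j) = h (f y) * a y $ j" by (simp add: eq[OF that] h)
      then show ?thesis
        by (simp add: lie_deriv_local_def linear_sum[OF bl] linear_add[OF bl] h pX[OF that]
            mult.commute[of "of_real _"] mult.commute[of "h _"])
    qed
    from div_contact_density[OF card S(1,2) sX smooth_on_linear[OF S(1) h(1) S(4)] this x]
    show ?thesis by (simp add: pX x)
  qed
  show ?thesis
  proof (rule complex_eqI)
    have "Re (z * of_real r) = Re z * r" "Im (z * of_real r) = Im z * r" for z r by simp_all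
    note part[OF bounded_linear_Re this(1)] part[OF bounded_linear_Im this(2)]
    note this[symmetric]
    then show "Re ((\<Sum>k\<in>UNIV. X x $ k * of_real (pderiv_at k (contact_density n a) x)) + (\<Sum>k\<in>UNIV. pderiv_at k X x $ k) * of_real (contact_density n a x))
        = Re (of_nat (n + 1) * f x * of_real (contact_density n a x))"
       "Im ((\<Sum>k\<in>UNIV. X x $ k * of_real (pderiv_at k (contact_density n a) x)) + (\<Sum>k\<in>UNIV. pderiv_at k X x $ k) * of_real (contact_density n a x))
        = Im (of_nat (n + 1) * f x * of_real (contact_density n a x))"
      by (simp_all del: of_nat_Suc of_nat_add)
  qed
qed

section \<open>Coordinate changes\<close>

locale atlas =
  fixes T :: "'m topology" and A :: "('m, 'd::finite) chart set"
  assumes manifold: "smooth_manifold T A"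
begin

lemma
  assumes "c \<in> A"
  shows openin_chart_dom: "openin T (chart_dom c)"
    and chart_dom_subset: "chart_dom c \<subseteq> topspace T"
    and open_chart_image: "open (chart_image c)"
    and chart_homeo: "homeomorphic_map (subtopology T (chart_dom c)) (top_of_set (chart_image c)) (chart_map c)"
    and inj_on_chart: "inj_on (chart_map c) (chart_dom c)"
proof -
  have *: "is_chart T c" using manifold assms by (simp add: smooth_manifold_def)
  then show "openin T (chart_dom c)" "open (chart_image c)"
    and h: "homeomorphic_map (subtopology T (chart_dom c)) (top_of_set (chart_image c)) (chart_map c)"
    by (simp_all add: is_chart_def)
  then show s: "chart_dom c \<subseteq> topspace T" by (simp add: openin_subset)
  show "inj_on (chart_map c) (chart_dom c)"
    using homeomorphic_imp_injective_map[OF h] s by (simp add: Int_absorb1)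
qed

lemma topspace_covered: "p \<in> topspace T \<Longrightarrow> \<exists>c\<in>A. p \<in> chart_dom c"
  using manifold unfolding smooth_manifold_def by (metis UN_E)

lemma chart_inv_map: "c \<in> A \<Longrightarrow> p \<in> chart_dom c \<Longrightarrow> chart_inv c (chart_map c p) = p"
  by (simp add: inj_on_chart)

lemma chart_inv_in: "x \<in> chart_image c \<Longrightarrow> chart_inv c x \<in> chart_dom c"
  by (rule inv_into_into)

lemma chart_map_inv: "x \<in> chart_image c \<Longrightarrow> chart_map c (chart_inv c x) = x"
  by (rule f_inv_into_f)

lemma continuous_map_chart: "c \<in> A \<Longrightarrow> continuous_map (subtopology T (chart_dom c)) euclidean (chart_map c)"
  using homeomorphic_imp_continuous_map[OF chart_homeo] continuous_map_in_subtopology by blast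

section \<open>Overlaps of charts and their transition maps\<close>

definition overlap :: "('m, 'd) chart \<Rightarrow> ('m, 'd) chart \<Rightarrow> (real^'d) set" where
  "overlap c c' = chart_map c ` (chart_dom c \<inter> chart_dom c')"

lemma overlap_subset: "overlap c c' \<subseteq> chart_image c"
  by (auto simp: overlap_def)

lemma open_chart_map_image:
  assumes "c \<in> A" "openin T U" "U \<subseteq> chart_dom c"
  shows "open (chart_map c ` U)"
proof -
  have "openin (subtopology T (chart_dom c)) U"
    using assms by (metis inf.absorb1 openin_subtopology)
  then have "openin (top_of_set (chart_image c)) (chart_map c ` U)"
    using homeomorphic_imp_open_map[OF chart_homeo[OF assms(1)]] by (simp add: open_map_def)
  then show ?thesis using openin_open_trans open_chart_image[OF assms(1)] by blast
qed

lemma open_overlap: "c \<in> A \<Longrightarrow> c' \<in> A \<Longrightarrow> open (overlap c c')"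
  unfolding overlap_def by (rule open_chart_map_image) (auto intro: openin_chart_dom)

lemma in_overlap: "p \<in> chart_dom c \<Longrightarrow> p \<in> chart_dom c' \<Longrightarrow> chart_map c p \<in> overlap c c'"
  by (auto simp: overlap_def)

lemma overlapD:
  assumes "c \<in> A" "x \<in> overlap c c'"
  shows "x \<in> chart_image c" "chart_inv c x \<in> chart_dom c" "chart_inv c x \<in> chart_dom c'"
    "chart_map c (chart_inv c x) = x" "transition c c' x = chart_map c' (chart_inv c x)"
  using assms by (auto simp: overlap_def chart_inv_map transition_def)

lemma transition_overlap:
  assumes "c \<in> A" "c' \<in> A" "x \<in> overlap c c'"
  shows "transition c c' x \<in> overlap c' c" "transition c c' x \<in> chart_image c'"
    "chart_inv c' (transition c c' x) = chart_inv c x"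
  using overlapD[OF assms(1,3)] chart_inv_map[OF assms(2)] by (auto simp: overlap_def)

lemma smooth_transition: "c \<in> A \<Longrightarrow> c' \<in> A \<Longrightarrow> smooth_on (overlap c c') (transition c c')"
  using manifold by (auto simp: smooth_manifold_def smooth_compatible_def overlap_def)

lemma transition_map: "c \<in> A \<Longrightarrow> p \<in> chart_dom c \<Longrightarrow> transition c c' (chart_map c p) = chart_map c' p"
  by (simp add: transition_def chart_inv_map)

lemma transition_differentiable:
  "c \<in> A \<Longrightarrow> c' \<in> A \<Longrightarrow> x \<in> overlap c c' \<Longrightarrow> transition c c' differentiable (at x)"
  using smooth_on_imp_differentiable[OF smooth_transition] .

lemma jacobian_nth: "jacobian c c' p $ i $ j = pderiv_at j (transition c c') (chart_map c p) $ i"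
  by (simp add: jacobian_def matrix_def pderiv_at_def)

lemma jacobian_cocycle:
  assumes c: "c \<in> A" "c' \<in> A" "c'' \<in> A" and p: "p \<in> chart_dom c" "p \<in> chart_dom c'" "p \<in> chart_dom c''"
  shows "jacobian c c'' p = jacobian c' c'' p ** jacobian c c' p"
proof -
  let ?x = "chart_map c p"
  \<comment> \<open>Transition maps compose only where all three charts are defined; this is that
    region in the coordinates of \<open>c\<close>. Its openness lets the derivative be computed
    there.\<close>
  define U where "U = chart_map c ` (chart_dom c \<inter> (chart_dom c' \<inter> chart_dom c''))"
  have U: "open U" unfolding U_def
    by (rule open_chart_map_image) (auto intro: openin_chart_dom c)
  have 1: "transition c c' differentiable (at ?x)" "transition c' c'' differentiable (at (transition c c' ?x))"
    using transition_differentiable in_overlap c p by (simp_all add: transition_map)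
  have "((\<lambda>x. transition c' c'' (transition c c' x)) has_derivative
      (\<lambda>v. frechet_derivative (transition c' c'') (at (chart_map c' p)) (frechet_derivative (transition c c') (at ?x) v))) (at ?x)"
    using 1 transition_map[OF c(1) p(1), of c'] by (metis frechet_derivative_works has_derivative_compose)
  then have "(transition c c'' has_derivative
      (\<lambda>v. frechet_derivative (transition c' c'') (at (chart_map c' p)) (frechet_derivative (transition c c') (at ?x) v))) (at ?x)"
    by (rule has_derivative_transform_within_open[OF _ U])
      (use c p in \<open>auto simp: U_def transition_map\<close>)
  then have "jacobian c c'' p = matrix (frechet_derivative (transition c' c'') (at (chart_map c' p)) \<circ> frechet_derivative (transition c c') (at ?x))"
    by (simp add: jacobian_def frechet_derivative_eqI o_def)
  also have "\<dots> = jacobian c' c'' p ** jacobian c c' p"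
    unfolding jacobian_def
    using 1 transition_map[OF c(1) p(1), of c'] by (intro matrix_compose) (auto intro: linear_frechet_derivative)
  finally show ?thesis .
qed

lemma pderiv_at_transition:
  fixes g :: "real^'d \<Rightarrow> 'b::real_normed_vector"
  assumes c: "c \<in> A" "c' \<in> A" "x \<in> overlap c c'"
    and g': "g' differentiable (at (transition c c' x))"
    and eq: "\<And>y. y \<in> overlap c c' \<Longrightarrow> g y = g' (transition c c' y)"
  shows "pderiv_at j g x = (\<Sum>k\<in>UNIV. jacobian c c' (chart_inv c x) $ k $ j *\<^sub>R pderiv_at k g' (transition c c' x))"
proof -
  have t: "transition c c' differentiable (at x)" using transition_differentiable c by blast
  have "pderiv_at j g x = pderiv_at j (\<lambda>y. g' (transition c c' y)) x"
    by (rule pderiv_at_cong[OF open_overlap[OF c(1,2)] c(3), symmetric])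
      (use eq g' t in \<open>auto intro: differentiable_chain\<close>)
  then show ?thesis
    by (simp add: pderiv_at_chain[OF t g'] jacobian_nth overlapD(4)[OF c(1,3)])
qed

subsection \<open>Tangent vectors and one-forms\<close>

lemma of_real_matrix: "(\<chi> i j. of_real (J $ i $ j)) = (J :: real^'n^'k)"
  by (simp add: vec_eq_iff)

lemma tangent_of_in:
  assumes "c \<in> A" "p \<in> chart_dom c"
  shows "tangent_of A c p u \<in> tangent_space A p"
  unfolding tangent_space_def of_real_matrix
proof (intro CollectI conjI ballI allI impI)
  fix c' c'' assume c: "c' \<in> A" "c'' \<in> A" "p \<in> chart_dom c'" "p \<in> chart_dom c''"
  have "jacobian c c'' p *v u = jacobian c' c'' p *v (jacobian c c' p *v u)"
    using jacobian_cocycle[of c c' c'' p] assms c by (simp only: matrix_vector_mul_assoc)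
  then show "tangent_of A c p u c'' = jacobian c' c'' p *v tangent_of A c p u c'"
    using c by (simp only: tangent_of_def if_True simp_thms)
qed (auto simp: tangent_of_def)

lemma tangent_of_chart:
  fixes v :: "('m, 'd, real) tangent"
  assumes "c \<in> A" "p \<in> chart_dom c" "v \<in> tangent_space A p"
  shows "v = tangent_of A c p (v c)"
proof
  fix c'
  have v: "v c' = jacobian c c' p *v v c" if "c' \<in> A" "p \<in> chart_dom c'"
    using assms that unfolding tangent_space_def of_real_matrix by blast
  have v0: "v c' = 0" if "\<not> (c' \<in> A \<and> p \<in> chart_dom c')"
    using assms(3) that unfolding tangent_space_def by blast
  show "v c' = tangent_of A c p (v c) c'"
    by (cases "c' \<in> A \<and> p \<in> chart_dom c'") (use v v0 in \<open>auto simp: tangent_of_def\<close>)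
qed

text \<open>\<open>one_form\<close> constrains \<open>\<alpha> p\<close> on the tangent space only.
  Composed with \<open>tangent_of\<close>, it becomes a linear functional on coordinate vectors,
  determined by its values on the standard basis.\<close>

lemma one_form_tangent_of:
  assumes \<alpha>: "one_form T A \<alpha>" and c: "c \<in> A" "p \<in> chart_dom c"
  shows "\<alpha> p (tangent_of A c p u) = oneform_local A \<alpha> c (chart_map c p) \<bullet> u"
proof -
  have p: "p \<in> topspace T" using chart_dom_subset c by blast
  have lin: "\<alpha> p (tangent_of A c p (r *\<^sub>R u + s *\<^sub>R v)) = r * \<alpha> p (tangent_of A c p u) + s * \<alpha> p (tangent_of A c p v)"
    for r s u v
  proof -
    have "tangent_of A c p (r *\<^sub>R u + s *\<^sub>R v) = (\<lambda>c'. r *\<^sub>R tangent_of A c p u c' + s *\<^sub>R tangent_of A c p v c')"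
      by (auto simp: tangent_of_def matrix_vector_right_distrib matrix_vector_mult_scaleR)
    then show ?thesis using \<alpha> p tangent_of_in[OF c] by (simp add: one_form_def)
  qed
  have L: "linear (\<lambda>u. \<alpha> p (tangent_of A c p u))"
    using lin[of 1 _ 1] lin[of _ _ 0] by (intro linearI) auto
  have "u = (\<Sum>k\<in>UNIV. u $ k *\<^sub>R axis k 1)"
    by (simp add: vec_eq_iff axis_def if_distrib cong: if_cong)
  then have "\<alpha> p (tangent_of A c p u) = (\<Sum>k\<in>UNIV. u $ k * \<alpha> p (tangent_of A c p (axis k 1)))"
    using linear_sum[OF L, of "\<lambda>k. u $ k *\<^sub>R axis k 1" UNIV] by (simp add: linear_scale[OF L])
  then show ?thesis
    by (simp add: oneform_local_def inner_vec_def chart_inv_map[OF c] mult.commute)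
qed

lemma one_form_eq:
  assumes "one_form T A \<alpha>" "c \<in> A" "p \<in> chart_dom c" "v \<in> tangent_space A p"
  shows "\<alpha> p v = oneform_local A \<alpha> c (chart_map c p) \<bullet> v c"
  using one_form_tangent_of[OF assms(1-3)] tangent_of_chart[OF assms(2-4)] by metis

lemma oneform_local_transition:
  assumes \<alpha>: "one_form T A \<alpha>" and c: "c \<in> A" "c' \<in> A" "x \<in> overlap c c'"
  shows "oneform_local A \<alpha> c x = mtr (jacobian c c' (chart_inv c x)) *v oneform_local A \<alpha> c' (transition c c' x)"
proof -
  let ?p = "chart_inv c x"
  note p = overlapD[OF c(1,3)]
  have "oneform_local A \<alpha> c x \<bullet> u = (mtr (jacobian c c' ?p) *v oneform_local A \<alpha> c' (transition c c' x)) \<bullet> u" for u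
  proof -
    have "tangent_of A c ?p u c' = jacobian c c' ?p *v u"
      using c p by (simp add: tangent_of_def)
    then show ?thesis
      using one_form_tangent_of[OF \<alpha> c(1) p(2), of u] one_form_eq[OF \<alpha> c(2) p(3) tangent_of_in[OF c(1) p(2)], of u] p(4,5)
      by (simp only: inner_mult_right)
  qed
  then show ?thesis using vector_eq_rdot by blast
qed

lemma smooth_oneform_local: "one_form T A \<alpha> \<Longrightarrow> c \<in> A \<Longrightarrow> smooth_on (chart_image c) (oneform_local A \<alpha> c)"
  by (simp add: one_form_def)

text \<open>The exterior derivative commutes with pullback. Differentiating the transformation law
  of the components produces second derivatives of the transition map; they are symmetric and drop
  out on antisymmetrization.\<close>

lemma curl_transition:
  assumes \<alpha>: "one_form T A \<alpha>" and c: "c \<in> A" "c' \<in> A" "x \<in> overlap c c'"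
  defines "J \<equiv> jacobian c c' (chart_inv c x)"
  shows "curl (oneform_local A \<alpha> c) x = mtr J ** curl (oneform_local A \<alpha> c') (transition c c' x) ** J"
proof -
  let ?a = "oneform_local A \<alpha> c" and ?a' = "oneform_local A \<alpha> c'" and ?\<tau> = "transition c c'" and ?U = "overlap c c'"
  note U = open_overlap[OF c(1,2)] and s\<tau> = smooth_transition[OF c(1,2)]
  have J: "J $ i $ j = pderiv_at j ?\<tau> x $ i" for i j
    by (simp add: J_def jacobian_nth overlapD[OF c(1,3)])
  have a: "?a y $ j = (\<Sum>k\<in>UNIV. pderiv_at j ?\<tau> y $ k * ?a' (?\<tau> y) $ k)" if "y \<in> ?U" for y j
    unfolding oneform_local_transition[OF \<alpha> c(1,2) that]
    by (simp add: matrix_vector_mult_def jacobian_nth overlapD[OF c(1) that] Finite_Cartesian_Product.transpose_def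
        del: transpose_matrix_vector)
  have da': "?a' differentiable (at (?\<tau> x))"
    using smooth_on_imp_differentiable[OF smooth_oneform_local[OF \<alpha> c(2)]] transition_overlap[OF c] by blast
  have d\<tau>: "?\<tau> differentiable (at x)" using transition_differentiable[OF c] .
  have sd: "smooth_on ?U (\<lambda>y. pderiv_at j ?\<tau> y $ k)" for j k
    by (intro smooth_on_nth[OF U] smooth_on_pderiv_at s\<tau>)
  have ddt: "(\<lambda>y. pderiv_at j ?\<tau> y $ k) differentiable (at x)" for j k
    using smooth_on_imp_differentiable[OF sd c(3)] .
  have dac: "(\<lambda>y. ?a' (?\<tau> y) $ k) differentiable (at x)" for k
    by (rule differentiable_nth[OF differentiable_chain[OF d\<tau> da']])
  have chain: "pderiv_at i (\<lambda>y. ?a' (?\<tau> y) $ k) x = (\<Sum>l\<in>UNIV. J $ l $ i * pderiv_at l ?a' (?\<tau> x) $ k)" for i k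
  proof -
    have "pderiv_at i (\<lambda>y. ?a' (?\<tau> y) $ k) x = pderiv_at i (\<lambda>y. ?a' (?\<tau> y)) x $ k"
      by (rule pderiv_at_nth) (rule differentiable_chain[OF d\<tau> da'])
    then show ?thesis by (simp add: pderiv_at_chain[OF d\<tau> da'] J)
  qed
  have da: "?a differentiable (at x)"
    using smooth_on_imp_differentiable[OF smooth_oneform_local[OF \<alpha> c(1)]] overlapD[OF c(1,3)] by blast
  have pa: "pderiv_at i ?a x $ j = (\<Sum>k\<in>UNIV. J $ k $ j * (\<Sum>l\<in>UNIV. J $ l $ i * pderiv_at l ?a' (?\<tau> x) $ k)
        + pderiv_at i (\<lambda>y. pderiv_at j ?\<tau> y $ k) x * ?a' (?\<tau> x) $ k)" for i j
  proof -
    have "pderiv_at i ?a x $ j = pderiv_at i (\<lambda>y. ?a y $ j) x" by (simp add: pderiv_at_nth[OF da])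
    also have "\<dots> = pderiv_at i (\<lambda>y. \<Sum>k\<in>UNIV. pderiv_at j ?\<tau> y $ k * ?a' (?\<tau> y) $ k) x"
      by (rule pderiv_at_cong[OF U c(3) a differentiable_nth[OF da]])
    also have "\<dots> = (\<Sum>k\<in>UNIV. pderiv_at j ?\<tau> x $ k * pderiv_at i (\<lambda>y. ?a' (?\<tau> y) $ k) x
        + pderiv_at i (\<lambda>y. pderiv_at j ?\<tau> y $ k) x * ?a' (?\<tau> x) $ k)"
      by (simp add: pderiv_at_sum pderiv_at_mult ddt dac differentiable_mult)
    finally show ?thesis by (simp add: J chain)
  qed
  note comm = pderiv_at_nth_commute[OF U s\<tau> c(3)]
  show ?thesis
  proof (subst vec_eq_iff, intro allI, subst vec_eq_iff, intro allI)
    fix i j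
    have "curl ?a x $ i $ j = (\<Sum>k\<in>UNIV. \<Sum>l\<in>UNIV. J $ k $ j * J $ l $ i * pderiv_at l ?a' (?\<tau> x) $ k)
        - (\<Sum>k\<in>UNIV. \<Sum>l\<in>UNIV. J $ k $ i * J $ l $ j * pderiv_at l ?a' (?\<tau> x) $ k)"
      by (simp add: curl_def pa comm[of j i] sum.distrib sum_distrib_left mult.assoc)
    also have "(\<Sum>k\<in>UNIV. \<Sum>l\<in>UNIV. J $ k $ i * J $ l $ j * pderiv_at l ?a' (?\<tau> x) $ k)
        = (\<Sum>k\<in>UNIV. \<Sum>l\<in>UNIV. J $ k $ j * J $ l $ i * pderiv_at k ?a' (?\<tau> x) $ l)"
      by (subst sum.swap) (simp add: mult_ac)
    finally show "curl ?a x $ i $ j = (mtr J ** curl ?a' (?\<tau> x) ** J) $ i $ j"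
      by (simp add: matrix_matrix_mult_def Finite_Cartesian_Product.transpose_def curl_def
          sum_distrib_left sum_distrib_right sum_subtractf algebra_simps)
  qed
qed

text \<open>The Jacobians are real, so the real and imaginary parts of a complex tangent vector are
  real tangent vectors, to which the coordinate formula for \<open>\<alpha>\<close> applies.\<close>

lemma oneform_apply_local:
  assumes \<alpha>: "one_form T A \<alpha>" and c: "c \<in> A" "p \<in> chart_dom c" and X: "X p \<in> tangent_space A p"
  shows "oneform_apply \<alpha> X p = (\<Sum>i\<in>UNIV. of_real (oneform_local A \<alpha> c (chart_map c p) $ i) * X p c $ i)"
proof -
  have part: "(\<lambda>c. \<chi> i. h (X p c $ i)) \<in> tangent_space A p"
    if h: "linear h" "\<And>r z. h (of_real r * z) = r * h z" for h :: "complex \<Rightarrow> real"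
    unfolding tangent_space_def of_real_matrix
  proof (intro CollectI conjI ballI allI impI)
    fix c' c'' assume c: "c' \<in> A" "c'' \<in> A" "p \<in> chart_dom c'" "p \<in> chart_dom c''"
    then have "X p c'' = (\<chi> i j. of_real (jacobian c' c'' p $ i $ j)) *v X p c'"
      using X unfolding tangent_space_def by blast
    then show "(\<chi> i. h (X p c'' $ i)) = jacobian c' c'' p *v (\<chi> i. h (X p c' $ i))"
      by (simp add: vec_eq_iff matrix_vector_mult_def linear_sum[OF h(1)] h(2))
  next
    fix c' assume "c' \<notin> A \<or> p \<notin> chart_dom c'"
    then have "X p c' = 0" using X unfolding tangent_space_def by blast
    then show "(\<chi> i. h (X p c' $ i)) = 0" by (simp add: vec_eq_iff linear_0[OF h(1)])
  qed
  have "linear Re" "linear Im" by (intro linearI; simp)+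
  then have "(\<lambda>c. \<chi> i. Re (X p c $ i)) \<in> tangent_space A p" "(\<lambda>c. \<chi> i. Im (X p c $ i)) \<in> tangent_space A p"
    by (intro part; simp)+
  from one_form_eq[OF \<alpha> c this(1)] one_form_eq[OF \<alpha> c this(2)] show ?thesis
    unfolding oneform_apply_def by (simp add: inner_vec_def complex_eq_iff)
qed

subsection \<open>The Lie bracket\<close>

lemma vfield_local_transition:
  assumes X: "vector_field T A X" and c: "c \<in> A" "c' \<in> A" "x \<in> overlap c c'"
  shows "vfield_local X c' (transition c c' x) $ i = (\<Sum>j\<in>UNIV. of_real (pderiv_at j (transition c c') x $ i) * vfield_local X c x $ j)"
proof -
  note p = overlapD[OF c(1,3)]
  have "X (chart_inv c x) \<in> tangent_space A (chart_inv c x)"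
    using X p(2) chart_dom_subset[OF c(1)] by (auto simp: vector_field_def)
  then have "X (chart_inv c x) c' = (\<chi> i j. of_real (jacobian c c' (chart_inv c x) $ i $ j)) *v X (chart_inv c x) c"
    using c p unfolding tangent_space_def by blast
  then show ?thesis
    by (simp add: vfield_local_def transition_overlap(3)[OF c] matrix_vector_mult_def jacobian_nth p(4))
qed

text \<open>The transformation law of the components of \<open>X\<close>, differentiated. The terms
  with second derivatives of the transition map are the reason why first derivatives of a field do
  not transform as a tensor.\<close>

lemma vfield_local_transition_deriv:
  assumes X: "vector_field T A X" and c: "c \<in> A" "c' \<in> A" "x \<in> overlap c c'"
  shows "(\<Sum>l\<in>UNIV. of_real (pderiv_at j (transition c c') x $ l) * pderiv_at l (vfield_local X c') (transition c c' x) $ i)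
    = (\<Sum>k\<in>UNIV. of_real (pderiv_at k (transition c c') x $ i) * pderiv_at j (vfield_local X c) x $ k
        + of_real (pderiv_at j (\<lambda>y. pderiv_at k (transition c c') y $ i) x) * vfield_local X c x $ k)"
proof -
  let ?\<tau> = "transition c c'" and ?U = "overlap c c'" and ?X = "vfield_local X c" and ?X' = "vfield_local X c'"
  note U = open_overlap[OF c(1,2)] and s\<tau> = smooth_transition[OF c(1,2)]
  have dX: "?X differentiable (at x)" and dX': "?X' differentiable (at (?\<tau> x))"
    using X c overlapD(1)[OF c(1,3)] transition_overlap(2)[OF c]
    unfolding vector_field_def by (blast intro: smooth_on_imp_differentiable)+
  have d\<tau>: "?\<tau> differentiable (at x)" using transition_differentiable[OF c] .
  have ddt: "(\<lambda>y. pderiv_at j ?\<tau> y $ k) differentiable (at x)" for j k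
    by (rule smooth_on_imp_differentiable[OF smooth_on_nth[OF U smooth_on_pderiv_at[OF s\<tau>]] c(3)])
  have ddc: "(\<lambda>y. of_real (pderiv_at j ?\<tau> y $ k) :: complex) differentiable (at x)" for j k
    by (rule smooth_on_imp_differentiable[OF smooth_on_of_real[OF U smooth_on_nth[OF U smooth_on_pderiv_at[OF s\<tau>]]] c(3)])
  have chain: "(\<lambda>y. ?X' (?\<tau> y)) differentiable (at x)" by (rule differentiable_chain[OF d\<tau> dX'])
  have "(\<Sum>l\<in>UNIV. of_real (pderiv_at j ?\<tau> x $ l) * pderiv_at l ?X' (?\<tau> x) $ i) = pderiv_at j (\<lambda>y. ?X' (?\<tau> y)) x $ i"
    by (simp add: pderiv_at_chain[OF d\<tau> dX'] scaleR_conv_of_real[where 'a = complex])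
  also have "\<dots> = pderiv_at j (\<lambda>y. ?X' (?\<tau> y) $ i) x" by (simp add: pderiv_at_nth[OF chain])
  also have "\<dots> = pderiv_at j (\<lambda>y. \<Sum>k\<in>UNIV. of_real (pderiv_at k ?\<tau> y $ i) * ?X y $ k) x"
    by (rule pderiv_at_cong[OF U c(3) vfield_local_transition[OF X c(1,2)] differentiable_nth[OF chain]])
  also have "\<dots> = (\<Sum>k\<in>UNIV. of_real (pderiv_at k ?\<tau> x $ i) * pderiv_at j (\<lambda>y. ?X y $ k) x
        + pderiv_at j (\<lambda>y. of_real (pderiv_at k ?\<tau> y $ i)) x * ?X x $ k)"
    by (simp add: pderiv_at_sum pderiv_at_mult ddc differentiable_nth[OF dX] differentiable_mult)
  finally show ?thesis
    by (simp add: pderiv_at_nth[OF dX] pderiv_at_linear[OF bounded_linear_of_real ddt])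
qed

text \<open>Each half of the bracket transforms like a vector up to a term with second derivatives
  of the transition map. That term is symmetric in the two fields and cancels in the
  difference.\<close>

lemma lie_bracket_in_tangent_space:
  assumes V: "vector_field T A V" and X: "vector_field T A X"
  shows "lie_bracket A V X p \<in> tangent_space A p"
  unfolding tangent_space_def
proof (intro CollectI conjI ballI allI impI)
  fix c c' assume c: "c \<in> A" "c' \<in> A" and p: "p \<in> chart_dom c" "p \<in> chart_dom c'"
  let ?\<tau> = "transition c c'" and ?x = "chart_map c p"
  let ?V = "vfield_local V c ?x" and ?V' = "vfield_local V c' (?\<tau> ?x)"
  let ?X = "vfield_local X c ?x" and ?X' = "vfield_local X c' (?\<tau> ?x)"
  note U = open_overlap[OF c] and s\<tau> = smooth_transition[OF c]
  have x: "?x \<in> overlap c c'" using in_overlap p by blast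
  have loc: "Y p c = vfield_local Y c ?x" "Y p c' = vfield_local Y c' (?\<tau> ?x)" "chart_map c' p = ?\<tau> ?x" for Y
    by (simp_all add: vfield_local_def chart_inv_map c p transition_map)
  note comm = pderiv_at_nth_commute[OF U s\<tau> x]
  have half: "(\<Sum>l\<in>UNIV. W' $ l * pderiv_at l (vfield_local Y c') (?\<tau> ?x) $ i)
     = (\<Sum>k\<in>UNIV. of_real (pderiv_at k ?\<tau> ?x $ i) * (\<Sum>j\<in>UNIV. W $ j * pderiv_at j (vfield_local Y c) ?x $ k))
       + (\<Sum>j\<in>UNIV. \<Sum>k\<in>UNIV. of_real (pderiv_at j (\<lambda>y. pderiv_at k ?\<tau> y $ i) ?x) * W $ j * vfield_local Y c ?x $ k)"
    if W: "vector_field T A Z" and Y: "vector_field T A Y"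
      and W': "W' = vfield_local Z c' (?\<tau> ?x)" "W = vfield_local Z c ?x" for Z Y i W W'
  proof -
    have "(\<Sum>l\<in>UNIV. W' $ l * pderiv_at l (vfield_local Y c') (?\<tau> ?x) $ i)
       = (\<Sum>l\<in>UNIV. \<Sum>j\<in>UNIV. W $ j * (of_real (pderiv_at j ?\<tau> ?x $ l) * pderiv_at l (vfield_local Y c') (?\<tau> ?x) $ i))"
      by (simp add: W' vfield_local_transition[OF W c x] sum_distrib_right sum_distrib_left mult_ac)
    also have "\<dots> = (\<Sum>j\<in>UNIV. W $ j * (\<Sum>l\<in>UNIV. of_real (pderiv_at j ?\<tau> ?x $ l) * pderiv_at l (vfield_local Y c') (?\<tau> ?x) $ i))"
      by (subst sum.swap) (simp add: sum_distrib_left)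
    also have "\<dots> = (\<Sum>j\<in>UNIV. \<Sum>k\<in>UNIV. of_real (pderiv_at k ?\<tau> ?x $ i) * (W $ j * pderiv_at j (vfield_local Y c) ?x $ k))
       + (\<Sum>j\<in>UNIV. \<Sum>k\<in>UNIV. of_real (pderiv_at j (\<lambda>y. pderiv_at k ?\<tau> y $ i) ?x) * W $ j * vfield_local Y c ?x $ k)"
      unfolding vfield_local_transition_deriv[OF Y c x]
      by (simp add: sum_distrib_left sum.distrib algebra_simps)
    also have "(\<Sum>j\<in>UNIV. \<Sum>k\<in>UNIV. of_real (pderiv_at k ?\<tau> ?x $ i) * (W $ j * pderiv_at j (vfield_local Y c) ?x $ k))
       = (\<Sum>k\<in>UNIV. of_real (pderiv_at k ?\<tau> ?x $ i) * (\<Sum>j\<in>UNIV. W $ j * pderiv_at j (vfield_local Y c) ?x $ k))"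
      by (subst sum.swap) (simp add: sum_distrib_left)
    finally show ?thesis .
  qed
  \<comment> \<open>The correction terms of the two halves agree, by equality of mixed partial
    derivatives.\<close>
  have sym: "(\<Sum>j\<in>UNIV. \<Sum>k\<in>UNIV. of_real (pderiv_at j (\<lambda>y. pderiv_at k ?\<tau> y $ i) ?x) * ?V $ j * ?X $ k)
     = (\<Sum>j\<in>UNIV. \<Sum>k\<in>UNIV. of_real (pderiv_at j (\<lambda>y. pderiv_at k ?\<tau> y $ i) ?x) * ?X $ j * ?V $ k)" for i
    by (subst sum.swap) (simp add: comm[of _ _ i] mult_ac)
  show "lie_bracket A V X p c' = (\<chi> i j. of_real (jacobian c c' p $ i $ j)) *v lie_bracket A V X p c"
    unfolding vec_eq_iff
  proof
    fix i
    have "lie_bracket A V X p c' $ i = (\<Sum>l\<in>UNIV. ?V' $ l * pderiv_at l (vfield_local X c') (?\<tau> ?x) $ i)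
        - (\<Sum>l\<in>UNIV. ?X' $ l * pderiv_at l (vfield_local V c') (?\<tau> ?x) $ i)"
      using c p by (simp add: lie_bracket_def loc sum_subtractf)
    also have "\<dots> = (\<Sum>k\<in>UNIV. of_real (pderiv_at k ?\<tau> ?x $ i) *
        ((\<Sum>j\<in>UNIV. ?V $ j * pderiv_at j (vfield_local X c) ?x $ k) - (\<Sum>j\<in>UNIV. ?X $ j * pderiv_at j (vfield_local V c) ?x $ k)))"
      unfolding half[OF V X refl refl] half[OF X V refl refl] sym
      by (simp add: sum_subtractf right_diff_distrib)
    also have "\<dots> = ((\<chi> i j. of_real (jacobian c c' p $ i $ j)) *v lie_bracket A V X p c) $ i"
      using c p by (simp add: lie_bracket_def loc(1) matrix_vector_mult_def jacobian_nth sum_subtractf)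
    finally show "lie_bracket A V X p c' $ i = ((\<chi> i j. of_real (jacobian c c' p $ i $ j)) *v lie_bracket A V X p c) $ i" .
  qed
qed (auto simp: lie_bracket_def)

lemma vfield_add_scaled_in_tangent_space:
  assumes "X p \<in> tangent_space A p" "Y p \<in> tangent_space A p"
  shows "vfield_add_scaled X t Y p \<in> tangent_space A p"
  unfolding tangent_space_def
proof (intro CollectI conjI ballI allI impI)
  fix c c' assume c: "c \<in> A" "c' \<in> A" "p \<in> chart_dom c" "p \<in> chart_dom c'"
  let ?J = "\<chi> i j. of_real (jacobian c c' p $ i $ j) :: complex^'d^'d"
  have "X p c' = ?J *v X p c" "Y p c' = ?J *v Y p c"
    using assms c unfolding tangent_space_def by blast+
  then show "vfield_add_scaled X t Y p c' = ?J *v vfield_add_scaled X t Y p c"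
    by (simp add: vfield_add_scaled_def vec_eq_iff matrix_vector_mult_def sum.distrib scaleR_sum_right
        algebra_simps)
next
  fix c assume "c \<notin> A \<or> p \<notin> chart_dom c"
  then have "X p c = 0" "Y p c = 0" using assms unfolding tangent_space_def by blast+
  then show "vfield_add_scaled X t Y p c = 0" by (simp add: vfield_add_scaled_def)
qed

end

section \<open>Integration\<close>

lemma set_integrable_compact_support:
  fixes f :: "'a::euclidean_space \<Rightarrow> 'b::{banach, second_countable_topology}"
  assumes "continuous_on U f" "compact K" "K \<subseteq> U" "\<And>x. x \<in> U - K \<Longrightarrow> f x = 0"
  shows "set_integrable lborel U f"
proof -
  have eq: "(\<lambda>x. indicator U x *\<^sub>R f x) = (\<lambda>x. indicator K x *\<^sub>R f x)"
    using assms(3,4) by (auto simp: indicator_def fun_eq_iff)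
  show ?thesis
    unfolding set_integrable_def eq
    by (rule borel_integrable_compact[OF assms(2) continuous_on_subset[OF assms(1,3)]])
qed

lemma set_lebesgue_integral_sum:
  fixes f :: "'i \<Rightarrow> 'a \<Rightarrow> 'b::{banach, second_countable_topology}"
  assumes "\<And>i. i \<in> I \<Longrightarrow> set_integrable M U (f i)"
  shows "(LINT x:U|M. (\<Sum>i\<in>I. f i x)) = (\<Sum>i\<in>I. LINT x:U|M. f i x)"
  using assms unfolding set_lebesgue_integral_def set_integrable_def scaleR_sum_right
  by (rule Bochner_Integration.integral_sum)

lemma set_lebesgue_integral_restrict:
  assumes "S \<subseteq> U" "\<And>x. x \<in> U - S \<Longrightarrow> f x = 0"
  shows "(LINT x:U|M. f x) = (LINT x:S|M. f x)"
proof -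
  have eq: "(\<lambda>x. indicator U x *\<^sub>R f x) = (\<lambda>x. indicator S x *\<^sub>R f x)"
    using assms by (auto simp: indicator_def fun_eq_iff)
  show ?thesis unfolding set_lebesgue_integral_def eq ..
qed

text \<open>Translation invariance of the integral, differentiated under the integral sign.\<close>

lemma integral_pderiv_at_zero:
  fixes f :: "real^'d::finite \<Rightarrow> complex"
  assumes U: "open U" and f: "smooth_on U f" and K: "compact K" "K \<subseteq> U" and z: "\<And>x. x \<in> U - K \<Longrightarrow> f x = 0"
  shows "(LINT x:U|lborel. pderiv_at k f x) = 0"
proof -
  define e :: "real^'d" where "e = axis k 1"
  have e: "norm e = 1" by (simp add: e_def)
  \<comment> \<open>Extension by zero to the whole space, where translations act.\<close>
  define F where "F x = (if x \<in> U then f x else 0)" for x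
  define F' where "F' x = (if x \<in> U then pderiv_at k f x else 0)" for x
  have U': "open (- K)" using K(1) by (simp add: compact_imp_closed open_Compl)
  have F0: "F x = 0" if "x \<notin> K" for x using that z by (auto simp: F_def)
  have F'0: "F' x = 0" if "x \<notin> K" for x
  proof (cases "x \<in> U")
    case True
    have "pderiv_at k f x = pderiv_at k (\<lambda>_. 0 :: complex) x"
      by (rule pderiv_at_cong[of "U - K"])
        (use U K True that z smooth_on_imp_differentiable[OF f] in \<open>auto simp: open_Diff compact_imp_closed\<close>)
    then show ?thesis by (simp add: F'_def pderiv_at_const)
  qed (simp add: F'_def)
  have line: "((\<lambda>t. F (x + t *\<^sub>R e)) has_vector_derivative F' (x + s *\<^sub>R e)) (at s)" for x s
  proof (cases "x + s *\<^sub>R e \<in> U")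
    case True
    have "(f has_derivative frechet_derivative f (at (x + s *\<^sub>R e))) (at (x + s *\<^sub>R e))"
      using smooth_on_imp_has_derivative[OF f True] .
    then have D: "(F has_derivative frechet_derivative f (at (x + s *\<^sub>R e))) (at (x + s *\<^sub>R e))"
      by (rule has_derivative_transform_within_open[OF _ U True]) (simp add: F_def)
    have "((\<lambda>t. F (x + t *\<^sub>R e)) has_derivative (\<lambda>h. frechet_derivative f (at (x + s *\<^sub>R e)) (h *\<^sub>R e))) (at s)"
      by (rule has_derivative_compose[of "\<lambda>t. x + t *\<^sub>R e" _ _ _ F, OF _ D]) (auto intro!: derivative_eq_intros)
    then show ?thesis
      using linear_scale[OF linear_frechet_derivative[OF smooth_on_imp_differentiable[OF f True]]] True
      by (simp add: has_vector_derivative_def F'_def pderiv_at_def e_def)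
  next
    case False
    \<comment> \<open>A point outside \<open>U\<close> lies in the open complement of
      \<open>K\<close>, on which \<open>F\<close> is identically zero.\<close>
    then have out: "x + s *\<^sub>R e \<in> - K" using K by auto
    have "((\<lambda>t. 0) has_vector_derivative 0) (at s)" by simp
    moreover have "open {t. x + t *\<^sub>R e \<in> - K}"
      using continuous_open_vimage[OF U', of "\<lambda>t. x + t *\<^sub>R e"] by (simp add: vimage_def continuous_intros)
    ultimately have "((\<lambda>t. F (x + t *\<^sub>R e)) has_vector_derivative 0) (at s)"
      by (rule has_vector_derivative_transform_within_open) (use out F0 in auto)
    then show ?thesis using False by (simp add: F'_def)
  qed
  have "continuous_on K (pderiv_at k f)"
    using smooth_on_imp_continuous_on[OF smooth_on_pderiv_at[OF f]] K(2) continuous_on_subset by blast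
  then have "bounded (pderiv_at k f ` K)" using K(1) compact_continuous_image compact_imp_bounded by blast
  then obtain B where B: "B > 0" "\<And>x. x \<in> K \<Longrightarrow> norm (pderiv_at k f x) \<le> B"
    unfolding bounded_pos by auto
  have B': "norm (F' x) \<le> B" for x using B F'0[of x] by (cases "x \<in> K") (auto simp: F'_def)
  have lip: "norm (F (x + t *\<^sub>R e) - F x) \<le> B * \<bar>t\<bar>" for x t
  proof -
    have "norm (F (x + t *\<^sub>R e) - F (x + 0 *\<^sub>R e)) \<le> B * norm (t - 0)"
    proof (rule differentiable_bound[of UNIV "\<lambda>t. F (x + t *\<^sub>R e)" "\<lambda>s h. h *\<^sub>R F' (x + s *\<^sub>R e)"])
      show "onorm (\<lambda>h. h *\<^sub>R F' (x + s *\<^sub>R e)) \<le> B" for s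
        by (rule onorm_le) (use mult_left_mono[OF B'[of "x + s *\<^sub>R e"]] in \<open>simp add: mult.commute[of B]\<close>)
    qed (use line in \<open>auto simp: has_vector_derivative_def\<close>)
    then show ?thesis by simp
  qed
  obtain R where R: "\<And>x. x \<in> K \<Longrightarrow> norm x \<le> R" using K(1) compact_imp_bounded bounded_iff by metis
  have intF: "integrable lborel F"
  proof -
    have "set_integrable lborel U f"
      by (rule set_integrable_compact_support[OF smooth_on_imp_continuous_on[OF f] K z])
    moreover have "(\<lambda>x. indicator U x *\<^sub>R f x) = F" by (auto simp: F_def)
    ultimately show ?thesis by (simp add: set_integrable_def)
  qed
  \<comment> \<open>Difference quotients with steps \<open>1 / (n + 1)\<close>. Translation
    invariance makes their integrals zero, and they converge to \<open>F'\<close>.\<close>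
  define s where "s n x = real (Suc n) *\<^sub>R (F (x + inverse (real (Suc n)) *\<^sub>R e) - F x)" for n x
  have shift: "integrable lborel (\<lambda>x. F (x + v))" "(LINT x|lborel. F (x + v)) = (LINT x|lborel. F x)" for v
  proof -
    have 1: "(\<lambda>x. F (x + v)) = (\<lambda>x. F (v + x))" by (simp add: add.commute)
    have m: "(+) v \<in> lborel \<rightarrow>\<^sub>M borel" by simp
    have "integrable (distr lborel borel ((+) v)) F" using intF by (simp add: lborel_distr_plus)
    then show "integrable lborel (\<lambda>x. F (x + v))" unfolding 1
      using integrable_distr[OF m] by blast
    have "(LINT x|lborel. F (v + x)) = (LINT x|distr lborel borel ((+) v). F x)"
      using intF by (subst integral_distr) auto
    then show "(LINT x|lborel. F (x + v)) = (LINT x|lborel. F x)"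
      by (simp add: 1 lborel_distr_plus)
  qed
  have s0: "(LINT x|lborel. s n x) = 0" for n
    unfolding s_def using shift intF by simp
  have ms: "s n \<in> borel_measurable lborel" for n
    unfolding s_def by (intro borel_measurable_scaleR borel_measurable_const borel_measurable_diff
        borel_measurable_integrable shift intF)
  \<comment> \<open>The integrable majorant: the steps are at most 1, so every quotient is supported
    in the ball of radius \<open>R + 1\<close>, and the Lipschitz constant \<open>B\<close> bounds
    it there.\<close>
  have sbound: "norm (s n x) \<le> indicator (cball 0 (R + 1)) x *\<^sub>R B" for n x
  proof (cases "x \<in> cball 0 (R + 1)")
    case True
    have "norm (s n x) \<le> real (Suc n) * (B * \<bar>inverse (real (Suc n))\<bar>)"
      unfolding s_def norm_scaleR by (rule mult_mono[OF _ lip]) auto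
    also have "\<dots> = B" by simp
    finally show ?thesis using True by simp
  next
    case False
    have "x \<notin> K" using False R by force
    moreover have "x + inverse (real (Suc n)) *\<^sub>R e \<notin> K"
    proof
      assume "x + inverse (real (Suc n)) *\<^sub>R e \<in> K"
      then have "norm (x + inverse (real (Suc n)) *\<^sub>R e) \<le> R" by (rule R)
      moreover have "norm x \<le> norm (x + inverse (real (Suc n)) *\<^sub>R e) + norm (inverse (real (Suc n)) *\<^sub>R e)"
        using norm_triangle_ineq4[of "x + inverse (real (Suc n)) *\<^sub>R e" "inverse (real (Suc n)) *\<^sub>R e"] by simp
      moreover have "norm (inverse (real (Suc n)) *\<^sub>R e) \<le> 1"
        using e by (simp add: field_simps)
      ultimately show False using False by simp
    qed
    ultimately show ?thesis using F0 False by (simp add: s_def)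
  qed
  have lim: "(\<lambda>n. s n x) \<longlonglongrightarrow> F' x" for x
  proof -
    have "((\<lambda>t. F (x + t *\<^sub>R e)) has_vector_derivative F' (x + 0 *\<^sub>R e)) (at 0)" by (rule line)
    then have "((\<lambda>h. norm (F (x + (0 + h) *\<^sub>R e) - F (x + 0 *\<^sub>R e) - h *\<^sub>R F' (x + 0 *\<^sub>R e)) / norm h) \<longlongrightarrow> 0) (at 0)"
      unfolding has_vector_derivative_def has_derivative_at by blast
    moreover have "filterlim (\<lambda>n. inverse (real (Suc n))) (at 0) sequentially"
      using LIMSEQ_inverse_real_of_nat by (auto simp: filterlim_at)
    ultimately have lim0: "(\<lambda>n. norm (F (x + (0 + inverse (real (Suc n))) *\<^sub>R e) - F (x + 0 *\<^sub>R e)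
        - inverse (real (Suc n)) *\<^sub>R F' (x + 0 *\<^sub>R e)) / norm (inverse (real (Suc n)))) \<longlonglongrightarrow> 0"
      by (rule filterlim_compose)
    have "norm (v - r *\<^sub>R w) / norm r = norm (inverse r *\<^sub>R v - w)" if "r > 0" for r and v w :: complex
    proof -
      have "inverse r *\<^sub>R v - w = inverse r *\<^sub>R (v - r *\<^sub>R w)" using that by (simp add: scaleR_diff_right)
      then show ?thesis by (simp add: divide_inverse mult.commute)
    qed
    from this[of "inverse (real (Suc n))" for n] have "(\<lambda>n. norm (s n x - F' x)) \<longlonglongrightarrow> 0"
      using lim0 by (simp add: s_def)
    then show ?thesis using LIM_zero_cancel tendsto_norm_zero_iff by blast
  qed
  have w: "integrable lborel (\<lambda>x. indicator (cball 0 (R + 1)) x *\<^sub>R B)"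
    by (rule borel_integrable_compact) auto
  have mF': "F' \<in> borel_measurable lborel" by (rule borel_measurable_LIMSEQ_metric[OF ms lim])
  have "(\<lambda>n. LINT x|lborel. s n x) \<longlonglongrightarrow> (LINT x|lborel. F' x)"
    by (rule integral_dominated_convergence[OF mF' ms w]) (simp_all only: lim sbound AE_I2)
  then have "(LINT x|lborel. F' x) = 0" unfolding s0 by (simp add: LIMSEQ_const_iff)
  moreover have "(\<lambda>x. indicator U x *\<^sub>R pderiv_at k f x) = F'" by (auto simp: F'_def)
  ultimately show ?thesis by (simp add: set_lebesgue_integral_def)
qed

text \<open>The change of variables theorem of the library is stated for values in \<open>real^'n\<close>.\<close>

lemma change_of_variables_complex:
  fixes f :: "real^'d::{finite,wellorder} \<Rightarrow> complex" and \<tau> :: "real^'d::_ \<Rightarrow> real^'d::_"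
  assumes S: "open S" and d: "\<And>x. x \<in> S \<Longrightarrow> (\<tau> has_derivative \<tau>' x) (at x)" and inj: "inj_on \<tau> S"
    and f: "set_integrable lborel (\<tau> ` S) f"
    and g: "set_integrable lborel S (\<lambda>x. \<bar>det (matrix (\<tau>' x))\<bar> *\<^sub>R f (\<tau> x))"
  shows "(LINT x:S|lborel. \<bar>det (matrix (\<tau>' x))\<bar> *\<^sub>R f (\<tau> x)) = (LINT y:\<tau> ` S|lborel. f y)"
proof -
  \<comment> \<open>\<open>C\<close> and \<open>D\<close> are the mutually inverse real-linear
    identifications of the complex plane with \<open>real^2\<close>.\<close>
  define C :: "complex \<Rightarrow> real^2" where "C z = vector [Re z, Im z]" for z
  define D :: "real^2 \<Rightarrow> complex" where "D v = Complex (v $ 1) (v $ 2)" for v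
  have C: "bounded_linear C" unfolding C_def linear_conv_bounded_linear[symmetric]
    by (intro linearI) (auto simp: vec_eq_iff forall_2)
  have D: "bounded_linear D" unfolding D_def linear_conv_bounded_linear[symmetric]
    by (intro linearI) (auto simp: complex_eq_iff)
  have DC: "D (C z) = z" "D (r *\<^sub>R C z) = r *\<^sub>R z" for r z by (auto simp: C_def D_def complex_eq_iff)
  \<comment> \<open>Passage from the Borel measure to its completion and on to the gauge integral,
    in which the change of variables theorem is phrased.\<close>
  have leb: "h absolutely_integrable_on W \<and> (LINT x:W|lborel. h x) = integral W h" if "set_integrable lborel W h"
    for h :: "real^'d::_ \<Rightarrow> complex" and W
  proof -
    have m: "(\<lambda>x. indicator W x *\<^sub>R h x) \<in> borel_measurable lborel"
      using that unfolding set_integrable_def by (rule borel_measurable_integrable)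
    have "h absolutely_integrable_on W"
      using that integrable_completion[OF m] by (simp add: set_integrable_def)
    then show ?thesis
      using set_lebesgue_integral_eq_integral(2)[of W h] integral_completion[OF m] by (simp add: set_lebesgue_integral_def)
  qed
  have "(C \<circ> f) absolutely_integrable_on \<tau> ` S"
    using leb[OF f] absolutely_integrable_linear[OF _ C] by blast
  moreover have "S \<in> sets lebesgue" using S by simp
  ultimately have *: "(\<lambda>x. \<bar>det (matrix (\<tau>' x))\<bar> *\<^sub>R (C \<circ> f) (\<tau> x)) absolutely_integrable_on S"
     "integral S (\<lambda>x. \<bar>det (matrix (\<tau>' x))\<bar> *\<^sub>R (C \<circ> f) (\<tau> x)) = integral (\<tau> ` S) (C \<circ> f)"
    using has_absolute_integral_change_of_variables[of S \<tau> \<tau>' "C \<circ> f" "integral (\<tau> ` S) (C \<circ> f)"]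
      d inj has_derivative_at_withinI by blast+
  have "integral S (D \<circ> (\<lambda>x. \<bar>det (matrix (\<tau>' x))\<bar> *\<^sub>R (C \<circ> f) (\<tau> x))) = D (integral (\<tau> ` S) (C \<circ> f))"
    using integral_linear[OF set_lebesgue_integral_eq_integral(1)[OF *(1)] D] *(2) by simp
  also have "\<dots> = integral (\<tau> ` S) f"
    using integral_linear[OF set_lebesgue_integral_eq_integral(1) C] leb[OF f] by (metis DC(1))
  also have "D \<circ> (\<lambda>x. \<bar>det (matrix (\<tau>' x))\<bar> *\<^sub>R (C \<circ> f) (\<tau> x)) = (\<lambda>x. \<bar>det (matrix (\<tau>' x))\<bar> *\<^sub>R f (\<tau> x))"
    by (simp add: DC o_def)
  finally show ?thesis using leb[OF f] leb[OF g] by simp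
qed

locale oriented_atlas = atlas T A
  for T :: "'m topology" and A :: "('m, 'd::{finite,wellorder}) chart set" +
  fixes P :: "('m, 'd) chart set"
  assumes compact: "compact_space T" and oriented: "orientation T A P"
begin

section \<open>Continuous densities on positively oriented charts\<close>

lemma positive_chart: "c \<in> P \<Longrightarrow> c \<in> A"
  using oriented by (auto simp: orientation_def)

text \<open>The coefficients of a continuous complex top-degree form. Only positively oriented
  charts are compared, so the determinant here equals its absolute value in the change of variables
  formula.\<close>

definition density :: "(('m, 'd) chart \<Rightarrow> real^'d::_ \<Rightarrow> complex) \<Rightarrow> bool" where
  "density w \<longleftrightarrow> (\<forall>c\<in>P. continuous_on (chart_image c) (w c)) \<and>
     (\<forall>c\<in>P. \<forall>c'\<in>P. \<forall>x\<in>overlap c c'. w c x = det (jacobian c c' (chart_inv c x)) *\<^sub>R w c' (transition c c' x))"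

lemma density_mult_function:
  fixes f :: "'m \<Rightarrow> real"
  assumes "density w" "\<And>c. c \<in> P \<Longrightarrow> continuous_on (chart_image c) (f \<circ> chart_inv c)"
  shows "density (\<lambda>c x. f (chart_inv c x) *\<^sub>R w c x)"
proof -
  have "continuous_on (chart_image c) (\<lambda>x. f (chart_inv c x) *\<^sub>R w c x)" if "c \<in> P" for c
    using assms that unfolding density_def by (intro continuous_on_scaleR) (auto simp: o_def)
  moreover have "f (chart_inv c x) *\<^sub>R w c x = det (jacobian c c' (chart_inv c x)) *\<^sub>R
      (f (chart_inv c' (transition c c' x)) *\<^sub>R w c' (transition c c' x))"
    if "c \<in> P" "c' \<in> P" "x \<in> overlap c c'" for c c' x
    using assms(1) that transition_overlap(3)[OF positive_chart positive_chart that(3)]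
    by (simp add: density_def)
  ultimately show ?thesis unfolding density_def by blast
qed

lemma compact_chart_image:
  assumes "c \<in> A" "closedin T K" "K \<subseteq> chart_dom c"
  shows "compact (chart_map c ` K)"
proof -
  have "compactin T K" using closedin_compact_space compact assms(2) by blast
  then have "compactin (subtopology T (chart_dom c)) K" using assms(3) by (simp add: compactin_subtopology)
  then have "compactin euclidean (chart_map c ` K)" using image_compactin continuous_map_chart[OF assms(1)] by blast
  then show ?thesis by simp
qed

lemma chart_inv_notin: "x \<in> chart_image c - chart_map c ` K \<Longrightarrow> chart_inv c x \<notin> K"
  by (metis DiffD1 DiffD2 chart_map_inv image_eqI)

lemma density_integrable:
  assumes w: "density w" and K: "closedin T K" "K \<subseteq> chart_dom c" and c: "c \<in> P"
    and z: "\<And>x. x \<in> chart_image c \<Longrightarrow> chart_inv c x \<notin> K \<Longrightarrow> w c x = 0"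
  shows "set_integrable lborel (chart_image c) (w c)"
proof (rule set_integrable_compact_support[of _ _ "chart_map c ` K"])
  show "continuous_on (chart_image c) (w c)" using w c by (simp add: density_def)
  show "compact (chart_map c ` K)" by (rule compact_chart_image[OF positive_chart[OF c] K])
  show "chart_map c ` K \<subseteq> chart_image c" using K by auto
  show "w c x = 0" if "x \<in> chart_image c - chart_map c ` K" for x
    using that chart_inv_notin[OF that] by (intro z) blast+
qed

text \<open>The support \<open>K\<close> lies in both charts, so each integral reduces to the
  overlap, where the change of variables formula matches the transformation law of
  \<open>w\<close>.\<close>

lemma density_integral_overlap:
  assumes w: "density w" and K: "closedin T K" "K \<subseteq> chart_dom c" "K \<subseteq> chart_dom c'" and c: "c \<in> P" "c' \<in> P"
    and z: "\<And>c x. c \<in> P \<Longrightarrow> x \<in> chart_image c \<Longrightarrow> chart_inv c x \<notin> K \<Longrightarrow> w c x = 0"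
  shows "(LINT x:chart_image c|lborel. w c x) = (LINT x:chart_image c'|lborel. w c' x)"
proof -
  note cA = positive_chart[OF c(1)] positive_chart[OF c(2)]
  let ?U = "overlap c c'" and ?\<tau> = "transition c c'"
  let ?D = "\<lambda>x. frechet_derivative ?\<tau> (at x)"
  \<comment> \<open>Stated for an arbitrary pair of charts, since it is needed with \<open>c\<close>
    and \<open>c'\<close> in both orders.\<close>
  have supp: "(LINT x:chart_image c|lborel. w c x) = (LINT x:overlap c c'|lborel. w c x)
      \<and> set_integrable lborel (overlap c c') (w c)"
    if c: "c \<in> P" and K': "K \<subseteq> chart_dom c" "K \<subseteq> chart_dom c'" for c c'
  proof
    note cA = positive_chart[OF c]
    have z': "w c x = 0" if "x \<in> chart_image c - chart_map c ` K" for x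
      using that chart_inv_notin[OF that] by (intro z c) blast+
    have sub: "chart_map c ` K \<subseteq> overlap c c'" using K' by (auto simp: overlap_def)
    show "(LINT x:chart_image c|lborel. w c x) = (LINT x:overlap c c'|lborel. w c x)"
      by (rule set_lebesgue_integral_restrict[OF overlap_subset]) (use z' sub in blast)
    show "set_integrable lborel (overlap c c') (w c)"
    proof (rule set_integrable_compact_support[of _ _ "chart_map c ` K"])
      show "continuous_on (overlap c c') (w c)"
        by (rule continuous_on_subset[OF _ overlap_subset]) (use w c in \<open>simp add: density_def\<close>)
      show "compact (chart_map c ` K)" by (rule compact_chart_image[OF cA K(1) K'(1)])
    qed (use sub z' overlap_subset[of c c'] in auto)
  qed
  have im: "?\<tau> ` ?U = overlap c' c"
  proof (intro set_eqI iffI)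
    fix y assume "y \<in> overlap c' c"
    from transition_overlap[OF cA(2,1) this] overlapD[OF cA(2) this]
    have "transition c' c y \<in> ?U" "?\<tau> (transition c' c y) = y"
      by (simp_all add: transition_def)
    then show "y \<in> ?\<tau> ` ?U" by (metis image_eqI)
  qed (use transition_overlap[OF cA] in auto)
  have inj: "inj_on ?\<tau> ?U"
    by (rule inj_onI) (metis transition_overlap(3)[OF cA] overlapD(4)[OF cA(1)])
  have wU: "w c x = \<bar>det (matrix (?D x))\<bar> *\<^sub>R w c' (?\<tau> x)" if x: "x \<in> ?U" for x
  proof -
    have "det (jacobian c c' (chart_inv c x)) > 0"
      using oriented c overlapD(2,3)[OF cA(1) x] by (auto simp: orientation_def)
    then show ?thesis
      using w c x by (simp add: density_def jacobian_def overlapD(4)[OF cA(1) x])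
  qed
  have Ub: "?U \<in> sets lborel" using open_overlap[OF cA] by simp
  have "(LINT x:chart_image c|lborel. w c x) = (LINT x:?U|lborel. w c x)"
    using supp[OF c(1) K(2,3)] by blast
  also have "\<dots> = (LINT x:?U|lborel. \<bar>det (matrix (?D x))\<bar> *\<^sub>R w c' (?\<tau> x))"
    using wU by (intro set_lebesgue_integral_cong[OF Ub]) blast
  also have "\<dots> = (LINT y:?\<tau> ` ?U|lborel. w c' y)"
  proof (rule change_of_variables_complex[OF open_overlap[OF cA] _ inj])
    show "(?\<tau> has_derivative ?D x) (at x)" if "x \<in> ?U" for x
      using smooth_on_imp_has_derivative[OF smooth_transition[OF cA] that] .
    show "set_integrable lborel (?\<tau> ` ?U) (w c')" unfolding im using supp[OF c(2) K(3,2)] by blast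
    have "set_integrable lborel ?U (w c)" using supp[OF c(1) K(2,3)] by blast
    moreover have "(\<lambda>x. indicator ?U x *\<^sub>R w c x) = (\<lambda>x. indicator ?U x *\<^sub>R (\<bar>det (matrix (?D x))\<bar> *\<^sub>R w c' (?\<tau> x)))"
      using wU by (auto simp: indicator_def fun_eq_iff)
    ultimately show "set_integrable lborel ?U (\<lambda>x. \<bar>det (matrix (?D x))\<bar> *\<^sub>R w c' (?\<tau> x))"
      unfolding set_integrable_def by simp
  qed
  also have "\<dots> = (LINT y:chart_image c'|lborel. w c' y)" unfolding im using supp[OF c(2) K(3,2)] by simp
  finally show ?thesis .
qed

subsection \<open>Partitions of unity\<close>

definition pou_support :: "(nat \<Rightarrow> 'm \<Rightarrow> real) \<Rightarrow> nat \<Rightarrow> 'm set" where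
  "pou_support \<rho> i = T closure_of {p \<in> topspace T. \<rho> i p \<noteq> 0}"

lemma pou_facts:
  assumes "partition_of_unity T A P N \<kappa> \<rho>" "i < N"
  shows pou_chart: "\<kappa> i \<in> P" and pou_closed: "closedin T (pou_support \<rho> i)"
    and pou_support: "pou_support \<rho> i \<subseteq> chart_dom (\<kappa> i)"
    and pou_outside: "p \<in> topspace T \<Longrightarrow> p \<notin> pou_support \<rho> i \<Longrightarrow> \<rho> i p = 0"
    and pou_smooth: "c \<in> A \<Longrightarrow> smooth_on (chart_image c) (\<rho> i \<circ> chart_inv c)"
proof -
  show "\<kappa> i \<in> P" "closedin T (pou_support \<rho> i)" "pou_support \<rho> i \<subseteq> chart_dom (\<kappa> i)"
    "c \<in> A \<Longrightarrow> smooth_on (chart_image c) (\<rho> i \<circ> chart_inv c)"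
    using assms by (auto simp: partition_of_unity_def smooth_function_def pou_support_def)
  show "\<rho> i p = 0" if "p \<in> topspace T" "p \<notin> pou_support \<rho> i"
  proof (rule ccontr)
    assume "\<rho> i p \<noteq> 0"
    then have "p \<in> {p \<in> topspace T. \<rho> i p \<noteq> 0}" using that by simp
    then show False using that closure_of_subset[of "{p \<in> topspace T. \<rho> i p \<noteq> 0}" T] by (auto simp: pou_support_def)
  qed
qed

lemma pou_continuous:
  "partition_of_unity T A P N \<kappa> \<rho> \<Longrightarrow> i < N \<Longrightarrow> c \<in> P \<Longrightarrow> continuous_on (chart_image c) (\<rho> i \<circ> chart_inv c)"
  using smooth_on_imp_continuous_on[OF pou_smooth] positive_chart by blast

lemma chart_inv_topspace: "c \<in> A \<Longrightarrow> x \<in> chart_image c \<Longrightarrow> chart_inv c x \<in> topspace T"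
  by (rule subsetD[OF chart_dom_subset chart_inv_in])

lemma pou_sum:
  "partition_of_unity T A P N \<kappa> \<rho> \<Longrightarrow> p \<in> topspace T \<Longrightarrow> (\<Sum>i<N. \<rho> i p) = 1"
  by (simp add: partition_of_unity_def)

text \<open>Moves densities supported in different charts \<open>\<mu> i\<close> to the common
  charts \<open>\<kappa> j\<close>, where they can be added. It serves twice: with the pieces of a
  second partition of unity, for the independence of the integral, and with the densities
  \<open>d\<rho>\<^sub>i(W)\<close> in the divergence theorem.\<close>

lemma pou_integral_sum:
  assumes pou: "partition_of_unity T A P N \<kappa> \<rho>"
    and \<omega>: "\<And>i. i < M \<Longrightarrow> density (\<omega> i)" "\<And>i. i < M \<Longrightarrow> closedin T (S i)" "\<And>i. i < M \<Longrightarrow> S i \<subseteq> chart_dom (\<mu> i)"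
      "\<And>i. i < M \<Longrightarrow> \<mu> i \<in> P"
      "\<And>i c x. i < M \<Longrightarrow> c \<in> P \<Longrightarrow> x \<in> chart_image c \<Longrightarrow> chart_inv c x \<notin> S i \<Longrightarrow> \<omega> i c x = 0"
  shows "(\<Sum>i<M. LINT x:chart_image (\<mu> i)|lborel. \<omega> i (\<mu> i) x) =
    (\<Sum>j<N. LINT x:chart_image (\<kappa> j)|lborel. \<rho> j (chart_inv (\<kappa> j) x) *\<^sub>R (\<Sum>i<M. \<omega> i (\<kappa> j) x))"
proof -
  define w where "w i j c x = \<rho> j (chart_inv c x) *\<^sub>R \<omega> i c x" for i j c x
  have dw: "density (w i j)" if "i < M" "j < N" for i j
    unfolding w_def using \<omega>(1)[OF that(1)] pou_continuous[OF pou that(2)] by (rule density_mult_function)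
  have zero: "w i j c x = 0"
    if "i < M" "j < N" "c \<in> P" "x \<in> chart_image c" "chart_inv c x \<notin> S i \<inter> pou_support \<rho> j" for i j c x
    using that \<omega>(5)[OF that(1,3,4)] pou_outside[OF pou that(2)] chart_inv_topspace[OF positive_chart]
    by (auto simp: w_def)
  have K: "closedin T (S i \<inter> pou_support \<rho> j)" if "i < M" "j < N" for i j
    using \<omega>(2) pou_closed[OF pou] that by (intro closedin_Int)
  have "(\<Sum>i<M. LINT x:chart_image (\<mu> i)|lborel. \<omega> i (\<mu> i) x)
      = (\<Sum>i<M. \<Sum>j<N. LINT x:chart_image (\<mu> i)|lborel. w i j (\<mu> i) x)"
  proof (rule sum.cong[OF refl])
    fix i assume "i \<in> {..<M}" then have i: "i < M" by simp
    note cA = positive_chart[OF \<omega>(4)[OF i]]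
    have "\<omega> i (\<mu> i) x = (\<Sum>j<N. w i j (\<mu> i) x)" if "x \<in> chart_image (\<mu> i)" for x
      using pou_sum[OF pou chart_inv_topspace[OF cA that]] by (simp add: w_def flip: scaleR_sum_left)
    then have "(LINT x:chart_image (\<mu> i)|lborel. \<omega> i (\<mu> i) x) = (LINT x:chart_image (\<mu> i)|lborel. (\<Sum>j<N. w i j (\<mu> i) x))"
      using open_chart_image[OF cA] by (intro set_lebesgue_integral_cong) auto
    also have "\<dots> = (\<Sum>j<N. LINT x:chart_image (\<mu> i)|lborel. w i j (\<mu> i) x)"
    proof (rule set_lebesgue_integral_sum)
      fix j assume "j \<in> {..<N}" then have j: "j < N" by simp
      show "set_integrable lborel (chart_image (\<mu> i)) (w i j (\<mu> i))"
        by (rule density_integrable[OF dw[OF i j] K[OF i j] _ \<omega>(4)[OF i] zero[OF i j \<omega>(4)[OF i]]]) 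
          (use \<omega>(3)[OF i] in blast)
    qed
    finally show "(LINT x:chart_image (\<mu> i)|lborel. \<omega> i (\<mu> i) x) = (\<Sum>j<N. LINT x:chart_image (\<mu> i)|lborel. w i j (\<mu> i) x)" .
  qed
  \<comment> \<open>Multiplication by \<open>\<rho> j\<close> has shrunk the support to
    \<open>S i \<inter> pou_support \<rho> j\<close>, which lies in both charts.\<close>
  also have "\<dots> = (\<Sum>i<M. \<Sum>j<N. LINT x:chart_image (\<kappa> j)|lborel. w i j (\<kappa> j) x)"
  proof (intro sum.cong refl)
    fix i j assume "i \<in> {..<M}" "j \<in> {..<N}" then have i: "i < M" and j: "j < N" by auto
    show "(LINT x:chart_image (\<mu> i)|lborel. w i j (\<mu> i) x) = (LINT x:chart_image (\<kappa> j)|lborel. w i j (\<kappa> j) x)"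
      by (rule density_integral_overlap[OF dw[OF i j] K[OF i j] _ _ \<omega>(4)[OF i] pou_chart[OF pou j] zero[OF i j]])
        (use \<omega>(3)[OF i] pou_support[OF pou j] in auto)
  qed
  also have "\<dots> = (\<Sum>j<N. \<Sum>i<M. LINT x:chart_image (\<kappa> j)|lborel. w i j (\<kappa> j) x)"
    by (rule sum.swap)
  also have "\<dots> = (\<Sum>j<N. LINT x:chart_image (\<kappa> j)|lborel. (\<Sum>i<M. w i j (\<kappa> j) x))"
  proof (intro sum.cong refl set_lebesgue_integral_sum[symmetric])
    fix i j assume "i \<in> {..<M}" "j \<in> {..<N}" then have i: "i < M" and j: "j < N" by auto
    show "set_integrable lborel (chart_image (\<kappa> j)) (w i j (\<kappa> j))"
      by (rule density_integrable[OF dw[OF i j] K[OF i j] _ pou_chart[OF pou j] zero[OF i j pou_chart[OF pou j]]])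
        (use pou_support[OF pou j] in blast)
  qed
  finally show ?thesis by (simp add: w_def scaleR_sum_right)
qed

text \<open>The uniqueness that justifies the description in \<open>form_integral\<close>: the
  pieces \<open>\<sigma> i\<close> times \<open>w\<close> of another partition add up to
  \<open>w\<close> in each chart \<open>\<kappa> j\<close>.\<close>

lemma form_integral_eq:
  assumes pou: "partition_of_unity T A P N \<kappa> \<rho>" and w: "density w"
  shows "form_integral T A P w = (\<Sum>i<N. LINT x:chart_image (\<kappa> i)|lborel. \<rho> i (chart_inv (\<kappa> i) x) *\<^sub>R w (\<kappa> i) x)"
  unfolding form_integral_def
proof (rule the_equality)
  fix I assume "\<exists>N \<kappa> \<rho>. partition_of_unity T A P N \<kappa> \<rho> \<and>
     I = (\<Sum>i<N. LINT x:chart_image (\<kappa> i)|lborel. \<rho> i (chart_inv (\<kappa> i) x) *\<^sub>R w (\<kappa> i) x)"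
  then obtain M \<mu> \<sigma> where pou': "partition_of_unity T A P M \<mu> \<sigma>"
    and I: "I = (\<Sum>i<M. LINT x:chart_image (\<mu> i)|lborel. \<sigma> i (chart_inv (\<mu> i) x) *\<^sub>R w (\<mu> i) x)" by blast
  have "I = (\<Sum>j<N. LINT x:chart_image (\<kappa> j)|lborel. \<rho> j (chart_inv (\<kappa> j) x) *\<^sub>R
      (\<Sum>i<M. \<sigma> i (chart_inv (\<kappa> j) x) *\<^sub>R w (\<kappa> j) x))"
    unfolding I
  proof (rule pou_integral_sum[OF pou, of M "\<lambda>i c x. \<sigma> i (chart_inv c x) *\<^sub>R w c x" "pou_support \<sigma>" \<mu>])
    show "density (\<lambda>c x. \<sigma> i (chart_inv c x) *\<^sub>R w c x)" if "i < M" for i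
      using w pou_continuous[OF pou' that] by (rule density_mult_function)
    show "\<sigma> i (chart_inv c x) *\<^sub>R w c x = 0"
      if "i < M" "c \<in> P" "x \<in> chart_image c" "chart_inv c x \<notin> pou_support \<sigma> i" for i c x
      using pou_outside[OF pou' that(1) chart_inv_topspace[OF positive_chart[OF that(2)] that(3)] that(4)] by simp
  qed (use pou_facts[OF pou'] in auto)
  also have "\<dots> = (\<Sum>j<N. LINT x:chart_image (\<kappa> j)|lborel. \<rho> j (chart_inv (\<kappa> j) x) *\<^sub>R w (\<kappa> j) x)"
  proof (intro sum.cong refl set_lebesgue_integral_cong allI impI)
    fix j assume "j \<in> {..<N}"
    then have cA: "\<kappa> j \<in> A" using positive_chart pou_chart[OF pou] by auto
    show "chart_image (\<kappa> j) \<in> sets lborel" using open_chart_image[OF cA] by simp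
    fix x assume x: "x \<in> chart_image (\<kappa> j)"
    show "\<rho> j (chart_inv (\<kappa> j) x) *\<^sub>R (\<Sum>i<M. \<sigma> i (chart_inv (\<kappa> j) x) *\<^sub>R w (\<kappa> j) x)
        = \<rho> j (chart_inv (\<kappa> j) x) *\<^sub>R w (\<kappa> j) x"
      using pou_sum[OF pou' chart_inv_topspace[OF cA x]] by (simp flip: scaleR_sum_left)
  qed
  finally show "I = (\<Sum>i<N. LINT x:chart_image (\<kappa> i)|lborel. \<rho> i (chart_inv (\<kappa> i) x) *\<^sub>R w (\<kappa> i) x)" .
qed (use pou in blast)

text \<open>Equal integrands define the same predicate on values, so the two descriptions agree
  whatever they denote.\<close>

lemma form_integral_cong:
  assumes "\<And>c x. c \<in> P \<Longrightarrow> x \<in> chart_image c \<Longrightarrow> w c x = w' c x"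
  shows "form_integral T A P w = form_integral T A P w'"
proof -
  have "(\<Sum>i<N. LINT x:chart_image (\<kappa> i)|lborel. \<rho> i (chart_inv (\<kappa> i) x) *\<^sub>R w (\<kappa> i) x)
     = (\<Sum>i<N. LINT x:chart_image (\<kappa> i)|lborel. \<rho> i (chart_inv (\<kappa> i) x) *\<^sub>R w' (\<kappa> i) x)"
    if "partition_of_unity T A P N \<kappa> \<rho>" for N \<kappa> \<rho>
  proof (intro sum.cong refl set_lebesgue_integral_cong allI impI)
    fix j assume "j \<in> {..<N}"
    then have c: "\<kappa> j \<in> P" using pou_chart[OF that] by auto
    show "chart_image (\<kappa> j) \<in> sets lborel" using open_chart_image[OF positive_chart[OF c]] by simp
    show "\<rho> j (chart_inv (\<kappa> j) x) *\<^sub>R w (\<kappa> j) x = \<rho> j (chart_inv (\<kappa> j) x) *\<^sub>R w' (\<kappa> j) x"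
      if "x \<in> chart_image (\<kappa> j)" for x using assms[OF c that] by simp
  qed
  then show ?thesis unfolding form_integral_def by (metis (no_types, lifting))
qed

text \<open>A continuous function is bounded on each compact set
  \<open>pou_support \<rho> i\<close>, and these finitely many sets cover the manifold because the
  \<open>\<rho> i\<close> sum to 1.\<close>

lemma bounded_on_manifold:
  fixes f :: "'m \<Rightarrow> complex"
  assumes pou: "partition_of_unity T A P N \<kappa> \<rho>"
    and f: "\<And>c. c \<in> A \<Longrightarrow> continuous_on (chart_image c) (\<lambda>x. f (chart_inv c x))"
  obtains B where "B > 0" "\<And>p. p \<in> topspace T \<Longrightarrow> norm (f p) \<le> B"
proof -
  have "\<exists>B>0. \<forall>p\<in>pou_support \<rho> i. norm (f p) \<le> B" if i: "i < N" for i
  proof -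
    note cA = positive_chart[OF pou_chart[OF pou i]] and s = pou_support[OF pou i]
    have "continuous_on (chart_map (\<kappa> i) ` pou_support \<rho> i) (\<lambda>x. f (chart_inv (\<kappa> i) x))"
      by (rule continuous_on_subset[OF f[OF cA]]) (use s in auto)
    then have "compact ((\<lambda>x. f (chart_inv (\<kappa> i) x)) ` chart_map (\<kappa> i) ` pou_support \<rho> i)"
      using compact_continuous_image compact_chart_image[OF cA pou_closed[OF pou i] s] by blast
    then have "bounded ((\<lambda>x. f (chart_inv (\<kappa> i) x)) ` chart_map (\<kappa> i) ` pou_support \<rho> i)"
      by (rule compact_imp_bounded)
    then obtain B where B: "B > 0"
      "\<forall>y \<in> (\<lambda>x. f (chart_inv (\<kappa> i) x)) ` chart_map (\<kappa> i) ` pou_support \<rho> i. norm y \<le> B"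
      unfolding bounded_pos by blast
    have "norm (f p) \<le> B" if "p \<in> pou_support \<rho> i" for p
    proof -
      have "norm (f (chart_inv (\<kappa> i) (chart_map (\<kappa> i) p))) \<le> B" using B(2) that by blast
      then show ?thesis by (simp only: chart_inv_map[OF cA subsetD[OF s that]])
    qed
    then show ?thesis using B(1) by blast
  qed
  then obtain B where B: "\<And>i. i < N \<Longrightarrow> B i > 0" "\<And>i p. i < N \<Longrightarrow> p \<in> pou_support \<rho> i \<Longrightarrow> norm (f p) \<le> B i"
    by metis
  show thesis
  proof
    \<comment> \<open>The summand 1 keeps the bound positive for \<open>N = 0\<close>.\<close>
    show "1 + (\<Sum>i<N. B i) > 0" using B(1) by (intro add_pos_nonneg sum_nonneg) (auto intro: less_imp_le)
    fix p assume p: "p \<in> topspace T"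
    have "\<exists>i<N. \<rho> i p \<noteq> 0"
    proof (rule ccontr)
      assume "\<not> (\<exists>i<N. \<rho> i p \<noteq> 0)"
      then have "(\<Sum>i<N. \<rho> i p) = 0" by (intro sum.neutral) auto
      then show False using pou_sum[OF pou p] by simp
    qed
    then obtain i where i: "i < N" "\<rho> i p \<noteq> 0" by blast
    then have "norm (f p) \<le> B i" using B(2) pou_outside[OF pou i(1) p] by blast
    also have "B i \<le> (\<Sum>i<N. B i)" using i B(1) by (intro member_le_sum) (auto intro: less_imp_le)
    finally show "norm (f p) \<le> 1 + (\<Sum>i<N. B i)" by simp
  qed
qed

text \<open>Stokes' theorem. Splitting \<open>\<rho>\<^sub>i div W = div (\<rho>\<^sub>i W) - d\<rho>\<^sub>i(W)\<close>, the first terms integrate to \<open>0\<close>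
  chartwise and the second ones add up to \<open>d1(W) = 0\<close>.\<close>

lemma divergence_theorem:
  fixes u :: "'m \<Rightarrow> complex" and g :: "('m, 'd) chart \<Rightarrow> real^'d::_ \<Rightarrow> real"
  assumes pou: "partition_of_unity T A P N \<kappa> \<rho>"
    and u: "\<And>c. c \<in> A \<Longrightarrow> smooth_on (chart_image c) (\<lambda>x. u (chart_inv c x))"
    and g: "\<And>c. c \<in> A \<Longrightarrow> smooth_on (chart_image c) (g c)"
      "\<And>c c' x. c \<in> A \<Longrightarrow> c' \<in> A \<Longrightarrow> x \<in> overlap c c' \<Longrightarrow> g c x = det (jacobian c c' (chart_inv c x)) * g c' (transition c c' x)"
    and V: "vector_field T A V"
  defines "W \<equiv> \<lambda>c k x. u (chart_inv c x) * of_real (g c x) * vfield_local V c x $ k"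
  shows "(\<Sum>i<N. LINT x:chart_image (\<kappa> i)|lborel. \<rho> i (chart_inv (\<kappa> i) x) *\<^sub>R (\<Sum>k\<in>UNIV. pderiv_at k (W (\<kappa> i) k) x)) = 0"
proof -
  let ?r = "\<lambda>i c x. \<rho> i (chart_inv c x)"
  \<comment> \<open>The density \<open>d\<rho>\<^sub>i(W)\<close>.\<close>
  define \<omega> where "\<omega> i c x = (\<Sum>k\<in>UNIV. pderiv_at k (?r i c) x *\<^sub>R W c k x)" for i c x
  have sW: "smooth_on (chart_image c) (W c k)" if "c \<in> A" for c k
    unfolding W_def using V that open_chart_image[OF that]
    by (intro smooth_on_mult smooth_on_of_real smooth_on_nth u g) (auto simp: vector_field_def)
  have sr: "smooth_on (chart_image c) (?r i c)" if "c \<in> A" "i < N" for c i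
    using pou_smooth[OF pou that(2,1)] by (simp add: o_def)
  have split: "?r i c x *\<^sub>R (\<Sum>k\<in>UNIV. pderiv_at k (W c k) x)
      = (\<Sum>k\<in>UNIV. pderiv_at k (\<lambda>x. ?r i c x *\<^sub>R W c k x) x) - \<omega> i c x"
    if "c \<in> A" "i < N" "x \<in> chart_image c" for c i x
    using smooth_on_imp_differentiable[OF sW[OF that(1)] that(3)] smooth_on_imp_differentiable[OF sr[OF that(1,2)] that(3)]
    by (simp add: pderiv_at_bilinear[OF bounded_bilinear_scaleR] \<omega>_def sum.distrib scaleR_sum_right)
  have out: "open (chart_map c ` (chart_dom c - pou_support \<rho> i))" if "c \<in> A" "i < N" for c i
    by (intro open_chart_map_image[OF that(1)] openin_diff openin_chart_dom[OF that(1)] pou_closed[OF pou that(2)]) auto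
  have dr0: "pderiv_at k (?r i c) x = 0"
    if c: "c \<in> A" and i: "i < N" and x: "x \<in> chart_image c" "chart_inv c x \<notin> pou_support \<rho> i" for i c x k
  proof -
    have "pderiv_at k (?r i c) x = pderiv_at k (\<lambda>_. 0 :: real) x"
    proof (rule pderiv_at_cong[OF out[OF c i]])
      show "x \<in> chart_map c ` (chart_dom c - pou_support \<rho> i)"
        using x chart_inv_in[OF x(1)] chart_map_inv[OF x(1)] by (metis DiffI image_eqI)
      show "?r i c y = 0" if "y \<in> chart_map c ` (chart_dom c - pou_support \<rho> i)" for y
        using that chart_inv_map[OF c] chart_dom_subset[OF c] by (auto intro!: pou_outside[OF pou i])
      show "?r i c differentiable at x" by (rule smooth_on_imp_differentiable[OF sr[OF c i] x(1)])
    qed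
    then show ?thesis by (simp add: pderiv_at_const)
  qed
  \<comment> \<open>The Jacobian of the covector \<open>d\<rho>\<^sub>i\<close> is absorbed by the
    vector \<open>V\<close>; the determinant contributed by \<open>g\<close> remains.\<close>
  have d\<omega>: "density (\<omega> i)" if i: "i < N" for i
    unfolding density_def
  proof (intro conjI ballI)
    fix c assume "c \<in> P"
    then have cA: "c \<in> A" by (rule positive_chart)
    show "continuous_on (chart_image c) (\<omega> i c)"
      unfolding \<omega>_def
      by (intro continuous_on_sum continuous_on_scaleR smooth_on_imp_continuous_on[OF sW[OF cA]]
          smooth_on_imp_continuous_on[OF smooth_on_pderiv_at[OF sr[OF cA i]]])
  next
    fix c c' x assume "c \<in> P" "c' \<in> P" and x: "x \<in> overlap c c'"
    then have cA: "c \<in> A" "c' \<in> A" by (auto intro: positive_chart)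
    let ?J = "jacobian c c' (chart_inv c x)" and ?y = "transition c c' x"
    have y: "?y \<in> chart_image c'" "chart_inv c' ?y = chart_inv c x" using transition_overlap[OF cA x] by auto
    have dr: "pderiv_at k (?r i c) x = (\<Sum>l\<in>UNIV. ?J $ l $ k *\<^sub>R pderiv_at l (?r i c') ?y)" for k
      by (rule pderiv_at_transition[OF cA x smooth_on_imp_differentiable[OF sr[OF cA(2) i] y(1)]])
        (simp add: transition_overlap[OF cA])
    let ?u = "u (chart_inv c x)"
    have "\<omega> i c x = (\<Sum>k\<in>UNIV. \<Sum>l\<in>UNIV. of_real (?J $ l $ k) * of_real (pderiv_at l (?r i c') ?y) *
        (?u * of_real (g c x) * vfield_local V c x $ k))"
      by (simp add: \<omega>_def dr W_def scaleR_conv_of_real sum_distrib_right)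
    also have "\<dots> = (\<Sum>l\<in>UNIV. of_real (pderiv_at l (?r i c') ?y) * ?u * of_real (g c x) *
         (\<Sum>k\<in>UNIV. of_real (?J $ l $ k) * vfield_local V c x $ k))"
      by (subst sum.swap) (simp add: sum_distrib_left mult_ac)
    also have "\<dots> = (\<Sum>l\<in>UNIV. of_real (pderiv_at l (?r i c') ?y) * ?u * of_real (g c x) * vfield_local V c' ?y $ l)"
      by (simp add: vfield_local_transition[OF V cA x] jacobian_nth overlapD(4)[OF cA(1) x])
    also have "\<dots> = det ?J *\<^sub>R \<omega> i c' ?y"
      by (simp add: \<omega>_def W_def g(2)[OF cA x] y scaleR_conv_of_real sum_distrib_left mult_ac)
    finally show "\<omega> i c x = det ?J *\<^sub>R \<omega> i c' ?y" .
  qed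
  have \<omega>0: "\<omega> i c x = 0" if "i < N" "c \<in> P" "x \<in> chart_image c" "chart_inv c x \<notin> pou_support \<rho> i" for i c x
    using dr0[OF positive_chart[OF that(2)] that(1,3,4)] by (simp add: \<omega>_def)
  have int\<omega>: "set_integrable lborel (chart_image (\<kappa> i)) (\<omega> i (\<kappa> i))" if "i < N" for i
    using density_integrable[OF d\<omega>[OF that] pou_closed[OF pou that] pou_support[OF pou that] pou_chart[OF pou that]
        \<omega>0[OF that pou_chart[OF pou that]]] by blast
  have "(\<Sum>i<N. \<omega> i c x) = 0" if c: "c \<in> P" and x: "x \<in> chart_image c" for c x
  proof -
    note cA = positive_chart[OF c]
    have dsum: "(\<Sum>i<N. pderiv_at k (?r i c) x) = 0" for k
    proof -
      have d: "?r i c differentiable (at x)" if "i < N" for i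
        by (rule smooth_on_imp_differentiable[OF sr[OF cA that] x])
      have "(\<Sum>i<N. pderiv_at k (?r i c) x) = pderiv_at k (\<lambda>x. \<Sum>i<N. ?r i c x) x"
        using d by (intro pderiv_at_sum[symmetric]) auto
      also have "\<dots> = pderiv_at k (\<lambda>_. 1 :: real) x"
        by (rule pderiv_at_cong[OF open_chart_image[OF cA] x])
          (use pou_sum[OF pou chart_inv_topspace[OF cA]] d in \<open>auto intro: differentiable_sum\<close>)
      finally show ?thesis by (simp add: pderiv_at_const)
    qed
    have "(\<Sum>i<N. \<omega> i c x) = (\<Sum>k\<in>UNIV. (\<Sum>i<N. pderiv_at k (?r i c) x) *\<^sub>R W c k x)"
      unfolding \<omega>_def by (subst sum.swap) (simp add: scaleR_sum_left)
    then show ?thesis by (simp add: dsum)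
  qed
  note sum0 = this
  \<comment> \<open>The \<open>\<omega> i\<close> are integrated in different charts; only after
    moving them to common charts does their pointwise sum, which is zero, become available.\<close>
  have "(\<Sum>i<N. LINT x:chart_image (\<kappa> i)|lborel. \<omega> i (\<kappa> i) x)
      = (\<Sum>j<N. LINT x:chart_image (\<kappa> j)|lborel. \<rho> j (chart_inv (\<kappa> j) x) *\<^sub>R (\<Sum>i<N. \<omega> i (\<kappa> j) x))"
    by (rule pou_integral_sum[OF pou d\<omega> pou_closed[OF pou] pou_support[OF pou] pou_chart[OF pou] \<omega>0])
  also have "\<dots> = (\<Sum>j<N. LINT x:chart_image (\<kappa> j)|lborel. (0 :: complex))"
  proof (intro sum.cong refl set_lebesgue_integral_cong allI impI)
    fix j assume "j \<in> {..<N}"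
    then have c: "\<kappa> j \<in> P" using pou_chart[OF pou] by auto
    show "chart_image (\<kappa> j) \<in> sets lborel" using open_chart_image[OF positive_chart[OF c]] by simp
    show "\<rho> j (chart_inv (\<kappa> j) x) *\<^sub>R (\<Sum>i<N. \<omega> i (\<kappa> j) x) = 0" if "x \<in> chart_image (\<kappa> j)" for x
      using sum0[OF c that] by simp
  qed
  finally have \<omega>sum: "(\<Sum>i<N. LINT x:chart_image (\<kappa> i)|lborel. \<omega> i (\<kappa> i) x) = 0" by simp
  have "(LINT x:chart_image (\<kappa> i)|lborel. ?r i (\<kappa> i) x *\<^sub>R (\<Sum>k\<in>UNIV. pderiv_at k (W (\<kappa> i) k) x))
      = - (LINT x:chart_image (\<kappa> i)|lborel. \<omega> i (\<kappa> i) x)" if i: "i < N" for i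
  proof -
    let ?c = "\<kappa> i"
    let ?K = "chart_map ?c ` pou_support \<rho> i"
    note cA = positive_chart[OF pou_chart[OF pou i]]
    note U = open_chart_image[OF cA]
    have K: "compact ?K" "?K \<subseteq> chart_image ?c"
      using compact_chart_image[OF cA pou_closed[OF pou i] pou_support[OF pou i]] pou_support[OF pou i] by auto
    have srW: "smooth_on (chart_image ?c) (\<lambda>x. ?r i ?c x *\<^sub>R W ?c k x)" for k
      by (rule smooth_on_bilinear[OF U bounded_bilinear_scaleR sr[OF cA i] sW[OF cA]])
    have z: "?r i ?c x *\<^sub>R W ?c k x = 0" if "x \<in> chart_image ?c - ?K" for x k
    proof -
      have "chart_inv ?c x \<notin> pou_support \<rho> i" using chart_inv_notin[OF that] .
      then show ?thesis using pou_outside[OF pou i chart_inv_topspace[OF cA]] that by simp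
    qed
    have z': "pderiv_at k (\<lambda>x. ?r i ?c x *\<^sub>R W ?c k x) x = 0" if x: "x \<in> chart_image ?c - ?K" for x k
    proof -
      have "pderiv_at k (\<lambda>x. ?r i ?c x *\<^sub>R W ?c k x) x = pderiv_at k (\<lambda>_. 0 :: complex) x"
        by (rule pderiv_at_cong[of "chart_image ?c - ?K"])
          (use U K x z smooth_on_imp_differentiable[OF srW] in \<open>auto simp: open_Diff compact_imp_closed\<close>)
      then show ?thesis by (simp add: pderiv_at_const)
    qed
    have int: "set_integrable lborel (chart_image ?c) (pderiv_at k (\<lambda>x. ?r i ?c x *\<^sub>R W ?c k x))" for k
      by (rule set_integrable_compact_support[OF smooth_on_imp_continuous_on[OF smooth_on_pderiv_at[OF srW]] K z'])
    have ints: "set_integrable lborel (chart_image ?c) (\<lambda>x. \<Sum>k\<in>UNIV. pderiv_at k (\<lambda>x. ?r i ?c x *\<^sub>R W ?c k x) x)"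
      using int unfolding set_integrable_def scaleR_sum_right by (intro Bochner_Integration.integrable_sum)
    have "(LINT x:chart_image ?c|lborel. ?r i ?c x *\<^sub>R (\<Sum>k\<in>UNIV. pderiv_at k (W ?c k) x))
        = (LINT x:chart_image ?c|lborel. (\<Sum>k\<in>UNIV. pderiv_at k (\<lambda>x. ?r i ?c x *\<^sub>R W ?c k x) x) - \<omega> i ?c x)"
      using split[OF cA i] U by (intro set_lebesgue_integral_cong) auto
    also have "\<dots> = (LINT x:chart_image ?c|lborel. (\<Sum>k\<in>UNIV. pderiv_at k (\<lambda>x. ?r i ?c x *\<^sub>R W ?c k x) x))
        - (LINT x:chart_image ?c|lborel. \<omega> i ?c x)"
      by (rule set_integral_diff(2)[OF ints int\<omega>[OF i]])
    also have "(LINT x:chart_image ?c|lborel. (\<Sum>k\<in>UNIV. pderiv_at k (\<lambda>x. ?r i ?c x *\<^sub>R W ?c k x) x)) = 0"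
      using integral_pderiv_at_zero[OF U srW K z] by (simp add: set_lebesgue_integral_sum int)
    finally show ?thesis by simp
  qed
  then show ?thesis using \<omega>sum by (simp add: sum_negf)
qed

end

section \<open>Contact vector fields\<close>

text \<open>If \<open>e\<close> is the error for \<open>m\<close>, the error for
  \<open>Suc m\<close> is \<open>(e + (m + 1) z^2) / (1 + z)\<close>, and \<open>1 + z\<close> has
  norm at least 1/2. The constant does not depend on \<open>z\<close>, which later makes the
  expansion uniform over the manifold.\<close>

lemma inverse_power_second_order:
  "\<exists>C\<ge>0. \<forall>z::complex. norm z \<le> 1 / 2 \<longrightarrow> norm (inverse ((1 + z) ^ m) - 1 + of_nat m * z) \<le> C * (norm z)\<^sup>2"
proof (induction m)
  case 0
  show ?case by (intro exI[of _ 0]) simp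
next
  case (Suc m)
  then obtain C where C: "C \<ge> 0" "\<And>z::complex. norm z \<le> 1 / 2 \<Longrightarrow>
      norm (inverse ((1 + z) ^ m) - 1 + of_nat m * z) \<le> C * (norm z)\<^sup>2" by blast
  have "norm (inverse ((1 + z) ^ Suc m) - 1 + of_nat (Suc m) * z) \<le> (2 * (C + real (Suc m))) * (norm z)\<^sup>2"
    if z: "norm z \<le> 1 / 2" for z :: complex
  proof -
    define e where "e = inverse ((1 + z) ^ m) - 1 + of_nat m * z"
    have n: "norm (1 + z) \<ge> 1 / 2" using norm_triangle_ineq2[of 1 "- z"] z by simp
    then have nz: "1 + z \<noteq> 0" by auto
    have inv: "inverse ((1 + z) ^ m) = e + 1 - of_nat m * z" by (simp add: e_def)
    have "inverse ((1 + z) ^ Suc m) = inverse (1 + z) * (e + 1 - of_nat m * z)"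
      by (simp flip: inv)
    then have "inverse ((1 + z) ^ Suc m) - 1 + of_nat (Suc m) * z = inverse (1 + z) * (e + of_nat (Suc m) * z\<^sup>2)"
      using nz by (simp add: field_simps power2_eq_square)
    also have "norm \<dots> \<le> 2 * (C * (norm z)\<^sup>2 + real (Suc m) * (norm z)\<^sup>2)"
      unfolding norm_mult
    proof (rule mult_mono)
      show "norm (inverse (1 + z)) \<le> 2" using le_imp_inverse_le[OF n] by (simp add: norm_inverse)
      have "norm (e + of_nat (Suc m) * z\<^sup>2) \<le> norm e + norm (of_nat (Suc m) * z\<^sup>2)" by (rule norm_triangle_ineq)
      also have "\<dots> \<le> C * (norm z)\<^sup>2 + real (Suc m) * (norm z)\<^sup>2"
        using C(2)[OF z] by (simp add: e_def norm_mult norm_power del: of_nat_Suc)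
      finally show "norm (e + of_nat (Suc m) * z\<^sup>2) \<le> C * (norm z)\<^sup>2 + real (Suc m) * (norm z)\<^sup>2" .
    qed auto
    finally show ?thesis by (simp add: algebra_simps)
  qed
  then show ?case using C(1) by (intro exI[of _ "2 * (C + real (Suc m))"]) auto
qed

text \<open>The form in which the invariance will be concluded: a quadratic remainder takes the
  place of differentiation under the integral sign.\<close>

lemma has_vector_derivative_zero:
  fixes \<Phi> :: "real \<Rightarrow> 'b::real_normed_vector"
  assumes "d > 0" "\<And>t. \<bar>t\<bar> < d \<Longrightarrow> norm (\<Phi> t - \<Phi> 0) \<le> C * t\<^sup>2"
  shows "(\<Phi> has_vector_derivative 0) (at 0)"
proof -
  have "((\<lambda>h. norm (\<Phi> (0 + h) - \<Phi> 0 - 0) / norm h) \<longlongrightarrow> 0) (at (0::real))"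
  proof (rule tendsto_sandwich)
    show "\<forall>\<^sub>F h in at 0. 0 \<le> norm (\<Phi> (0 + h) - \<Phi> 0 - 0) / norm h" by simp
    show "\<forall>\<^sub>F h in at 0. norm (\<Phi> (0 + h) - \<Phi> 0 - 0) / norm h \<le> C * \<bar>h\<bar>"
      unfolding eventually_at
    proof (intro exI[of _ d] conjI ballI impI assms(1))
      fix h :: real assume h: "h \<noteq> 0 \<and> dist h 0 < d"
      then have "norm (\<Phi> h - \<Phi> 0) / \<bar>h\<bar> \<le> C * h\<^sup>2 / \<bar>h\<bar>"
        using assms(2)[of h] by (intro divide_right_mono) auto
      also have "\<dots> = C * \<bar>h\<bar>" using h by (simp add: power2_eq_square field_simps flip: abs_mult)
      finally show "norm (\<Phi> (0 + h) - \<Phi> 0 - 0) / norm h \<le> C * \<bar>h\<bar>" by simp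
    qed
    show "((\<lambda>h. C * \<bar>h\<bar>) \<longlongrightarrow> 0) (at 0)" by (auto intro!: tendsto_eq_intros)
  qed simp
  then show ?thesis unfolding has_vector_derivative_def has_derivative_at by simp
qed

lemma pderiv_at_inverse_power:
  fixes H :: "real^'d::finite \<Rightarrow> complex"
  assumes "H differentiable (at x)" "H x \<noteq> 0"
  shows "pderiv_at k (\<lambda>x. inverse (H x ^ m)) x = - (of_nat m * inverse (H x ^ m) * inverse (H x)) * pderiv_at k H x"
proof -
  have "((\<lambda>z. inverse (z ^ m)) has_field_derivative
      - (inverse (H x ^ m) * (of_nat m * (1 * H x ^ (m - Suc 0))) * inverse (H x ^ m))) (at (H x))"
    by (rule DERIV_inverse'[OF DERIV_power[OF DERIV_ident]]) (use assms(2) in simp)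
  \<comment> \<open>For \<open>m = 0\<close> the truncated exponent \<open>m - Suc 0\<close> is
    harmless, since the factor \<open>of_nat m\<close> vanishes.\<close>
  also have "inverse (H x ^ m) * (of_nat m * (1 * H x ^ (m - Suc 0))) * inverse (H x ^ m) =
      of_nat m * inverse (H x ^ m) * inverse (H x)"
    using assms(2) by (cases m) (simp_all add: field_simps)
  finally have "((\<lambda>z. inverse (z ^ m)) has_field_derivative - (of_nat m * inverse (H x ^ m) * inverse (H x))) (at (H x))" .
  then have D: "((\<lambda>z. inverse (z ^ m)) has_derivative (*) (- (of_nat m * inverse (H x ^ m) * inverse (H x)))) (at (H x))"
    by (simp only: has_field_derivative_def)
  have "((\<lambda>x. inverse (H x ^ m)) has_derivative
      (\<lambda>v. - (of_nat m * inverse (H x ^ m) * inverse (H x)) * frechet_derivative H (at x) v)) (at x)"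
    by (rule has_derivative_compose[where f = H and g = "\<lambda>z. inverse (z ^ m)", OF _ D])
      (use assms(1) in \<open>simp only: frechet_derivative_works\<close>)
  then show ?thesis by (simp add: pderiv_at_def frechet_derivative_eqI)
qed

locale contact_manifold = oriented_atlas T A P
  for T :: "'m topology" and A P :: "('m, 'd::{finite,wellorder}) chart set" +
  fixes n :: nat
  assumes card: "CARD('d) = 2 * n + 1"
begin

text \<open>Both \<open>a\<close> and \<open>da\<close> are pulled back by the transition map, so
  \<open>contact_top_det\<close> applies with \<open>L\<close> its Jacobian.\<close>

lemma contact_density_transition:
  assumes \<alpha>: "one_form T A \<alpha>" and c: "c \<in> A" "c' \<in> A" "x \<in> overlap c c'"
  shows "contact_density n (oneform_local A \<alpha> c) x =
    det (jacobian c c' (chart_inv c x)) * contact_density n (oneform_local A \<alpha> c') (transition c c' x)"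
proof -
  have d: "oneform_local A \<alpha> c differentiable (at x)" "oneform_local A \<alpha> c' differentiable (at (transition c c' x))"
    using smooth_on_imp_differentiable[OF smooth_oneform_local[OF \<alpha> c(1)] overlapD(1)[OF c(1,3)]]
      smooth_on_imp_differentiable[OF smooth_oneform_local[OF \<alpha> c(2)] transition_overlap(2)[OF c]] .
  show ?thesis
    unfolding contact_density_eq[OF d(1)] contact_density_eq[OF d(2)] curl_transition[OF \<alpha> c]
    by (subst oneform_local_transition[OF \<alpha> c]) (rule contact_top_det[OF card])
qed

lemma density_contact:
  assumes \<alpha>: "one_form T A \<alpha>" and u: "\<And>c. c \<in> A \<Longrightarrow> smooth_on (chart_image c) (\<lambda>x. u (chart_inv c x))"
  shows "density (\<lambda>c x. u (chart_inv c x) * of_real (contact_density n (oneform_local A \<alpha> c) x))"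
  unfolding density_def
proof (intro conjI ballI)
  fix c assume "c \<in> P"
  then have cA: "c \<in> A" by (rule positive_chart)
  show "continuous_on (chart_image c) (\<lambda>x. u (chart_inv c x) * of_real (contact_density n (oneform_local A \<alpha> c) x))"
    by (intro smooth_on_imp_continuous_on smooth_on_mult smooth_on_of_real smooth_on_contact_density u
        open_chart_image smooth_oneform_local \<alpha> cA)
next
  fix c c' x assume c: "c \<in> P" "c' \<in> P" and x: "x \<in> overlap c c'"
  then have cA: "c \<in> A" "c' \<in> A" by (auto intro: positive_chart)
  show "u (chart_inv c x) * of_real (contact_density n (oneform_local A \<alpha> c) x) =
    det (jacobian c c' (chart_inv c x)) *\<^sub>R
      (u (chart_inv c' (transition c c' x)) * of_real (contact_density n (oneform_local A \<alpha> c') (transition c c' x)))"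
    by (simp add: contact_density_transition[OF \<alpha> cA x] transition_overlap(3)[OF cA x] scaleR_conv_of_real)
qed

lemma oneform_apply_chart:
  assumes \<alpha>: "one_form T A \<alpha>" and X: "vector_field T A X" and c: "c \<in> A" "x \<in> chart_image c"
  shows "oneform_apply \<alpha> X (chart_inv c x) = (\<Sum>i\<in>UNIV. of_real (oneform_local A \<alpha> c x $ i) * vfield_local X c x $ i)"
proof -
  have "X (chart_inv c x) \<in> tangent_space A (chart_inv c x)"
    using X chart_inv_topspace[OF c] by (simp add: vector_field_def)
  from oneform_apply_local[where X = X, OF \<alpha> c(1) chart_inv_in[OF c(2)] this]
  show ?thesis by (simp add: chart_map_inv[OF c(2)] vfield_local_def)
qed

lemma smooth_vfield_local: "vector_field T A X \<Longrightarrow> c \<in> A \<Longrightarrow> smooth_on (chart_image c) (vfield_local X c)"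
  by (simp add: vector_field_def)

lemma smooth_hamiltonian:
  assumes \<alpha>: "one_form T A \<alpha>" and X: "vector_field T A X" and c: "c \<in> A"
  shows "smooth_on (chart_image c) (\<lambda>x. oneform_apply \<alpha> X (chart_inv c x))"
proof (rule smooth_on_cong[OF open_chart_image[OF c]])
  show "smooth_on (chart_image c) (\<lambda>x. \<Sum>i\<in>UNIV. of_real (oneform_local A \<alpha> c x $ i) * vfield_local X c x $ i)"
    by (intro smooth_on_sum smooth_on_mult smooth_on_of_real smooth_on_nth open_chart_image[OF c]
        smooth_oneform_local[OF \<alpha> c] smooth_vfield_local[OF X c])
qed (simp add: oneform_apply_chart[OF \<alpha> X c])

text \<open>\<open>\<alpha>([V, X]) = V(\<alpha>(X)) - (L\<^sub>V\<alpha>)(X)\<close>\<close>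

lemma hamiltonian_lie_bracket:
  assumes \<alpha>: "one_form T A \<alpha>" and V: "vector_field T A V" and X: "vector_field T A X" and c: "c \<in> A"
    and f: "\<And>x. x \<in> chart_image c \<Longrightarrow> lie_deriv_local (vfield_local V c) (oneform_local A \<alpha> c) x =
           (\<chi> j. F x * of_real (oneform_local A \<alpha> c x $ j))"
    and x: "x \<in> chart_image c"
  shows "oneform_apply \<alpha> (lie_bracket A V X) (chart_inv c x) =
    (\<Sum>k\<in>UNIV. vfield_local V c x $ k * pderiv_at k (\<lambda>x. oneform_apply \<alpha> X (chart_inv c x)) x)
      - F x * oneform_apply \<alpha> X (chart_inv c x)"
proof -
  let ?a = "oneform_local A \<alpha> c" and ?V = "vfield_local V c" and ?X = "vfield_local X c"
  note U = open_chart_image[OF c] and sa = smooth_oneform_local[OF \<alpha> c] and sX = smooth_vfield_local[OF X c]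
  have da: "?a differentiable (at x)" and dX: "?X differentiable (at x)"
    using smooth_on_imp_differentiable[OF sa x] smooth_on_imp_differentiable[OF sX x] .
  have dan: "(\<lambda>x. ?a x $ i) differentiable (at x)" and dac: "(\<lambda>x. complex_of_real (?a x $ i)) differentiable (at x)"
    and dXn: "(\<lambda>x. ?X x $ i) differentiable (at x)" for i
    by (rule smooth_on_imp_differentiable[OF _ x], intro smooth_on_nth smooth_on_of_real U sa sX)+
  have pH: "pderiv_at k (\<lambda>x. oneform_apply \<alpha> X (chart_inv c x)) x =
      (\<Sum>i\<in>UNIV. of_real (?a x $ i) * pderiv_at k ?X x $ i + of_real (pderiv_at k ?a x $ i) * ?X x $ i)" for k
  proof -
    have "pderiv_at k (\<lambda>x. oneform_apply \<alpha> X (chart_inv c x)) x = pderiv_at k (\<lambda>x. \<Sum>i\<in>UNIV. of_real (?a x $ i) * ?X x $ i) x"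
      by (rule pderiv_at_cong[OF U x oneform_apply_chart[OF \<alpha> X c]])
        (auto intro: smooth_on_imp_differentiable[OF smooth_hamiltonian[OF \<alpha> X c] x])
    then show ?thesis
      by (simp add: pderiv_at_sum pderiv_at_mult dac dXn differentiable_mult pderiv_at_nth[OF dX]
          pderiv_at_linear[OF bounded_linear_of_real dan] pderiv_at_nth[OF da])
  qed
  have FX: "(\<Sum>j\<in>UNIV. ?X x $ j * (\<Sum>i\<in>UNIV. ?V x $ i * of_real (pderiv_at i ?a x $ j) + of_real (?a x $ i) * pderiv_at j ?V x $ i))
      = F x * oneform_apply \<alpha> X (chart_inv c x)"
  proof -
    have "(\<Sum>i\<in>UNIV. ?V x $ i * of_real (pderiv_at i ?a x $ j) + of_real (?a x $ i) * pderiv_at j ?V x $ i)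
        = F x * of_real (?a x $ j)" for j
      using arg_cong[OF f[OF x], of "\<lambda>v. v $ j"] by (simp add: lie_deriv_local_def)
    then show ?thesis by (simp add: oneform_apply_chart[OF \<alpha> X c x] sum_distrib_left mult_ac)
  qed
  have "oneform_apply \<alpha> (lie_bracket A V X) (chart_inv c x)
      = (\<Sum>i\<in>UNIV. of_real (?a x $ i) * lie_bracket A V X (chart_inv c x) c $ i)"
    using oneform_apply_local[where X = "lie_bracket A V X", OF \<alpha> c chart_inv_in[OF x] lie_bracket_in_tangent_space[OF V X]]
    by (simp add: chart_map_inv[OF x])
  also have "\<dots> = (\<Sum>i\<in>UNIV. of_real (?a x $ i) * (\<Sum>j\<in>UNIV. ?V x $ j * pderiv_at j ?X x $ i - ?X x $ j * pderiv_at j ?V x $ i))"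
    using c chart_inv_in[OF x] by (simp add: lie_bracket_def chart_map_inv[OF x] vfield_local_def)
  also have "\<dots> = (\<Sum>i\<in>UNIV. \<Sum>j\<in>UNIV. of_real (?a x $ i) * ?V x $ j * pderiv_at j ?X x $ i)
      - (\<Sum>i\<in>UNIV. \<Sum>j\<in>UNIV. of_real (?a x $ i) * ?X x $ j * pderiv_at j ?V x $ i)"
    by (simp add: sum_distrib_left sum_subtractf right_diff_distrib mult_ac)
  \<comment> \<open>Both double sums are completed by the same sum of
    \<open>V k * pderiv_at k a i * X i\<close>: once to give \<open>V(\<alpha>(X))\<close>, once to
    give \<open>(L\<^sub>V\<alpha>)(X)\<close>. It cancels in the difference.\<close>
  also have "(\<Sum>i\<in>UNIV. \<Sum>j\<in>UNIV. of_real (?a x $ i) * ?V x $ j * pderiv_at j ?X x $ i)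
     = (\<Sum>k\<in>UNIV. ?V x $ k * pderiv_at k (\<lambda>x. oneform_apply \<alpha> X (chart_inv c x)) x)
       - (\<Sum>k\<in>UNIV. \<Sum>i\<in>UNIV. ?V x $ k * of_real (pderiv_at k ?a x $ i) * ?X x $ i)"
    unfolding pH by (subst sum.swap) (simp add: sum_distrib_left sum.distrib algebra_simps)
  also have "(\<Sum>i\<in>UNIV. \<Sum>j\<in>UNIV. of_real (?a x $ i) * ?X x $ j * pderiv_at j ?V x $ i)
     = F x * oneform_apply \<alpha> X (chart_inv c x)
       - (\<Sum>k\<in>UNIV. \<Sum>i\<in>UNIV. ?V x $ k * of_real (pderiv_at k ?a x $ i) * ?X x $ i)"
    unfolding FX[symmetric]
    by (subst (1 2) sum.swap) (simp add: sum_distrib_left sum.distrib algebra_simps)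
  finally show ?thesis by simp
qed

lemma hamiltonian_add_scaled:
  assumes \<alpha>: "one_form T A \<alpha>" and p: "p \<in> topspace T" "X p \<in> tangent_space A p" "Y p \<in> tangent_space A p"
  shows "oneform_apply \<alpha> (vfield_add_scaled X t Y) p = oneform_apply \<alpha> X p + of_real t * oneform_apply \<alpha> Y p"
proof -
  obtain c where c: "c \<in> A" "p \<in> chart_dom c" using topspace_covered[OF p(1)] by blast
  have "vfield_add_scaled X t Y p \<in> tangent_space A p"
    by (rule vfield_add_scaled_in_tangent_space) (fact p)+
  from oneform_apply_local[where X = "vfield_add_scaled X t Y", OF \<alpha> c this] show ?thesis
    unfolding oneform_apply_local[where X = X, OF \<alpha> c p(2)] oneform_apply_local[where X = Y, OF \<alpha> c p(3)]
    by (simp add: vfield_add_scaled_def scaleR_conv_of_real[where 'a = complex] sum_distrib_left sum.distrib algebra_simps)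
qed

lemma power_int_eq_inverse_power: "z powi (- int k) = inverse (z ^ k)" for z :: complex
  by (simp add: power_int_minus)

text \<open>Here the exponent \<open>n + 1\<close> is decisive. The volume form contributes
  \<open>(n + 1) f\<close>, and differentiating the power of \<open>H\<close> contributes
  \<open>-(n + 1) V(H) / H\<close>; after \<open>V(H) = \<alpha>([V, X]) + f H\<close> is inserted,
  the terms with \<open>f\<close> cancel.\<close>

lemma divergence_contact:
  assumes \<alpha>: "one_form T A \<alpha>" and V: "vector_field T A V" and X: "vector_field T A X" and c: "c \<in> A"
    and F: "smooth_on (chart_image c) F"
    and f: "\<And>x. x \<in> chart_image c \<Longrightarrow> lie_deriv_local (vfield_local V c) (oneform_local A \<alpha> c) x =
           (\<chi> j. F x * of_real (oneform_local A \<alpha> c x $ j))"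
    and x: "x \<in> chart_image c" and nz: "\<And>x. x \<in> chart_image c \<Longrightarrow> oneform_apply \<alpha> X (chart_inv c x) \<noteq> 0"
  shows "(\<Sum>k\<in>UNIV. pderiv_at k (\<lambda>x. inverse (oneform_apply \<alpha> X (chart_inv c x) ^ (n + 1)) *
        of_real (contact_density n (oneform_local A \<alpha> c) x) * vfield_local V c x $ k) x) =
    - (of_nat (n + 1) * (oneform_apply \<alpha> (lie_bracket A V X) (chart_inv c x) / oneform_apply \<alpha> X (chart_inv c x)) *
       (inverse (oneform_apply \<alpha> X (chart_inv c x) ^ (n + 1)) * of_real (contact_density n (oneform_local A \<alpha> c) x)))"
proof -
  let ?a = "oneform_local A \<alpha> c" and ?V = "vfield_local V c"
  let ?H = "\<lambda>x. oneform_apply \<alpha> X (chart_inv c x)"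
  let ?g = "\<lambda>x. complex_of_real (contact_density n ?a x)"
  let ?u = "\<lambda>x. inverse (?H x ^ (n + 1))"
  note U = open_chart_image[OF c]
  have sH: "smooth_on (chart_image c) ?H" by (rule smooth_hamiltonian[OF \<alpha> X c])
  have sV: "smooth_on (chart_image c) ?V" by (rule smooth_vfield_local[OF V c])
  have sg: "smooth_on (chart_image c) (contact_density n ?a)"
    by (rule smooth_on_contact_density[OF U smooth_oneform_local[OF \<alpha> c]])
  have su: "smooth_on (chart_image c) ?u"
    using nz by (intro smooth_on_inverse smooth_on_power U sH) auto
  have d: "?u differentiable (at x)" "?g differentiable (at x)" "contact_density n ?a differentiable (at x)"
    "?V differentiable (at x)" "(\<lambda>x. ?V x $ k) differentiable (at x)" "?H differentiable (at x)"
    "(\<lambda>x. ?u x * ?g x) differentiable (at x)" for k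
    by (rule smooth_on_imp_differentiable[OF _ x], (intro su sg sV sH smooth_on_of_real smooth_on_nth smooth_on_mult U))+
  have 1: "pderiv_at k (\<lambda>x. ?u x * ?g x * ?V x $ k) x = ?u x * ?g x * pderiv_at k ?V x $ k +
      (?u x * of_real (pderiv_at k (contact_density n ?a) x)
       - of_nat (n + 1) * ?u x * inverse (?H x) * pderiv_at k ?H x * ?g x) * ?V x $ k" for k
    unfolding pderiv_at_mult[OF d(7,5)] pderiv_at_mult[OF d(1,2)] pderiv_at_nth[OF d(4)]
      pderiv_at_linear[OF bounded_linear_of_real d(3)] pderiv_at_inverse_power[OF d(6) nz[OF x]]
    by (simp add: algebra_simps)
  have "(\<Sum>k\<in>UNIV. pderiv_at k (\<lambda>x. ?u x * ?g x * ?V x $ k) x) =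
      ?u x * ((\<Sum>k\<in>UNIV. ?V x $ k * of_real (pderiv_at k (contact_density n ?a) x)) + (\<Sum>k\<in>UNIV. pderiv_at k ?V x $ k) * ?g x)
      - of_nat (n + 1) * ?u x * inverse (?H x) * ?g x * (\<Sum>k\<in>UNIV. ?V x $ k * pderiv_at k ?H x)"
    unfolding 1 by (simp add: sum_distrib_left sum_distrib_right sum.distrib sum_subtractf algebra_simps)
  also have "(\<Sum>k\<in>UNIV. ?V x $ k * of_real (pderiv_at k (contact_density n ?a) x)) + (\<Sum>k\<in>UNIV. pderiv_at k ?V x $ k) * ?g x
      = of_nat (n + 1) * F x * ?g x"
    by (rule complex_div_contact_density[OF card U smooth_oneform_local[OF \<alpha> c] sV F f x])
  also have "(\<Sum>k\<in>UNIV. ?V x $ k * pderiv_at k ?H x) = oneform_apply \<alpha> (lie_bracket A V X) (chart_inv c x) + F x * ?H x"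
    using hamiltonian_lie_bracket[OF \<alpha> V X c f x] by simp
  also have "?u x * (of_nat (n + 1) * F x * ?g x) - of_nat (n + 1) * ?u x * inverse (?H x) * ?g x *
        (oneform_apply \<alpha> (lie_bracket A V X) (chart_inv c x) + F x * ?H x)
      = - (of_nat (n + 1) * (oneform_apply \<alpha> (lie_bracket A V X) (chart_inv c x) / ?H x) * (?u x * ?g x))"
    using nz[OF x] by (simp add: field_simps)
  finally show ?thesis .
qed

section \<open>Invariance of the functional and its independence of the contact form\<close>

lemma contact_functional_eq:
  "contact_functional T A P n \<alpha> X = form_integral T A P
     (\<lambda>c x. inverse (oneform_apply \<alpha> X (chart_inv c x) ^ (n + 1)) * of_real (contact_density n (oneform_local A \<alpha> c) x))"
  unfolding contact_functional_def power_int_eq_inverse_power ..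

text \<open>The Hamiltonian of the perturbed field is \<open>H + t K\<close>, so the integrand is
  that for \<open>t = 0\<close> times \<open>(1 + t K / H)^-(n+1)\<close>. Its linear term is
  \<open>t\<close> times a divergence, and the remainder is bounded by a multiple of
  \<open>t^2\<close> uniformly.\<close>

lemma contact_functional_invariant:
  assumes \<alpha>: "one_form T A \<alpha>" and V: "V \<in> CVect T A \<alpha>" and X: "X \<in> CVect_star T A \<alpha>"
  shows "((\<lambda>t. contact_functional T A P n \<alpha> (vfield_add_scaled X t (lie_bracket A V X))) has_vector_derivative 0) (at 0)"
proof (cases "\<exists>N \<kappa> \<rho>. partition_of_unity T A P N \<kappa> \<rho>")
  case False
  then show ?thesis by (simp add: contact_functional_def form_integral_def)
next
  case True
  then obtain N \<kappa> \<rho> where pou: "partition_of_unity T A P N \<kappa> \<rho>" by blast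
  obtain f where Vf: "vector_field T A V" "smooth_function A f"
    and f: "\<And>c x. c \<in> A \<Longrightarrow> x \<in> chart_image c \<Longrightarrow> lie_deriv_local (vfield_local V c) (oneform_local A \<alpha> c) x =
           (\<chi> j. f (chart_inv c x) * of_real (oneform_local A \<alpha> c x $ j))"
    using V by (auto simp: CVect_def)
  have Xf: "vector_field T A X" and nz: "\<And>p. p \<in> topspace T \<Longrightarrow> oneform_apply \<alpha> X p \<noteq> 0"
    using X by (auto simp: CVect_star_def CVect_def)
  define H where "H p = oneform_apply \<alpha> X p" for p
  define K where "K p = oneform_apply \<alpha> (lie_bracket A V X) p" for p
  define g where "g c = contact_density n (oneform_local A \<alpha> c)" for c
  define m where "m = n + 1"
  have Ht: "oneform_apply \<alpha> (vfield_add_scaled X t (lie_bracket A V X)) p = H p + of_real t * K p" if "p \<in> topspace T" for p t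
    unfolding H_def K_def using Xf that lie_bracket_in_tangent_space[OF Vf(1) Xf]
    by (intro hamiltonian_add_scaled[OF \<alpha>]) (auto simp: vector_field_def)
  have sH: "smooth_on (chart_image c) (\<lambda>x. H (chart_inv c x))" if "c \<in> A" for c
    unfolding H_def by (rule smooth_hamiltonian[OF \<alpha> Xf that])
  have sf: "smooth_on (chart_image c) (\<lambda>x. f (chart_inv c x))" if "c \<in> A" for c
    using Vf(2) that by (auto simp: smooth_function_def o_def)
  \<comment> \<open>Smoothness of \<open>K\<close> is read off the formula for the Hamiltonian of
    the bracket; of the bracket itself only the values in the tangent spaces have been
    established.\<close>
  have sK: "smooth_on (chart_image c) (\<lambda>x. K (chart_inv c x))" if c: "c \<in> A" for c
  proof (rule smooth_on_cong[OF open_chart_image[OF c]])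
    show "smooth_on (chart_image c) (\<lambda>x. (\<Sum>k\<in>UNIV. vfield_local V c x $ k * pderiv_at k (\<lambda>x. H (chart_inv c x)) x)
      - f (chart_inv c x) * H (chart_inv c x))"
      by (intro smooth_on_diff smooth_on_sum smooth_on_mult smooth_on_nth smooth_on_pderiv_at sH sf c
          open_chart_image smooth_vfield_local[OF Vf(1)])
  qed (simp add: H_def K_def hamiltonian_lie_bracket[OF \<alpha> Vf(1) Xf c f[OF c]])
  have nzc: "H (chart_inv c x) \<noteq> 0" if "c \<in> A" "x \<in> chart_image c" for c x
    using nz chart_inv_topspace[OF that] by (simp add: H_def)
  have squot: "smooth_on (chart_image c) (\<lambda>x. K (chart_inv c x) / H (chart_inv c x))" if "c \<in> A" for c
    unfolding divide_inverse
    by (intro smooth_on_mult smooth_on_inverse sK sH nzc open_chart_image that)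
  obtain B where B: "B > 0" "\<And>p. p \<in> topspace T \<Longrightarrow> norm (K p / H p) \<le> B"
    using bounded_on_manifold[where f = "\<lambda>p. K p / H p", OF pou smooth_on_imp_continuous_on[OF squot]] by blast
  obtain C where C: "C \<ge> 0" "\<And>z::complex. norm z \<le> 1 / 2 \<Longrightarrow>
      norm (inverse ((1 + z) ^ m) - 1 + of_nat m * z) \<le> C * (norm z)\<^sup>2"
    using inverse_power_second_order[of m] by blast
  \<comment> \<open>For \<open>\<bar>t\<bar> < d\<close> the quantity \<open>t K / H\<close> has
    norm at most 1/2. This is the range of the second order expansion, and it keeps
    \<open>H + t K\<close> away from zero.\<close>
  define d where "d = 1 / (2 * B)"
  have "d > 0" using B(1) by (simp add: d_def)
  define w where "w t c x = inverse ((H (chart_inv c x) + of_real t * K (chart_inv c x)) ^ m) * complex_of_real (g c x)" for t c x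
  \<comment> \<open>Minus the derivative of \<open>w t\<close> at \<open>t = 0\<close>.\<close>
  define w' where "w' c x = of_nat m * (K (chart_inv c x) / H (chart_inv c x)) * w 0 c x" for c x
  have small: "norm (of_real t * (K p / H p)) \<le> B * \<bar>t\<bar> \<and> norm (of_real t * (K p / H p)) \<le> 1 / 2"
    if "\<bar>t\<bar> < d" "p \<in> topspace T" for t p
  proof -
    have "norm (of_real t * (K p / H p)) \<le> \<bar>t\<bar> * B"
      unfolding norm_mult norm_of_real using B(2)[OF that(2)] by (intro mult_left_mono) auto
    moreover have "\<bar>t\<bar> * B \<le> 1 / 2" using that(1) B(1) by (simp add: d_def field_simps)
    ultimately show ?thesis by (simp add: mult.commute)
  qed
  have nzt: "H p + of_real t * K p \<noteq> 0" if "\<bar>t\<bar> < d" "p \<in> topspace T" for t p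
  proof
    assume 0: "H p + of_real t * K p = 0"
    have "H p \<noteq> 0" using nz[OF that(2)] by (simp add: H_def)
    then have "of_real t * (K p / H p) = - 1" using 0 by (simp add: field_simps add_eq_0_iff2)
    then show False using small[OF that] by simp
  qed
  have dw: "density (w t)" if "\<bar>t\<bar> < d" for t
    unfolding w_def g_def
  proof (rule density_contact[OF \<alpha>, of "\<lambda>p. inverse ((H p + of_real t * K p) ^ m)"])
    fix c assume c: "c \<in> A"
    show "smooth_on (chart_image c) (\<lambda>x. inverse ((H (chart_inv c x) + of_real t * K (chart_inv c x)) ^ m))"
    proof (intro smooth_on_inverse smooth_on_power smooth_on_add smooth_on_mult smooth_on_const sH sK open_chart_image c)
      show "(H (chart_inv c x) + of_real t * K (chart_inv c x)) ^ m \<noteq> 0" if "x \<in> chart_image c" for x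
        using nzt[OF \<open>\<bar>t\<bar> < d\<close> chart_inv_topspace[OF c that]] by simp
    qed
  qed
  have "density (\<lambda>c x. (of_nat m * (K (chart_inv c x) / H (chart_inv c x)) * inverse ((H (chart_inv c x)) ^ m)) * of_real (g c x))"
    unfolding g_def
    by (rule density_contact[OF \<alpha>, of "\<lambda>p. of_nat m * (K p / H p) * inverse (H p ^ m)"])
      (intro smooth_on_mult smooth_on_const squot smooth_on_inverse smooth_on_power sH open_chart_image power_not_zero nzc; assumption)
  then have dw': "density w'" by (simp add: w'_def[abs_def] w_def mult.assoc)
  define \<Phi> where "\<Phi> t = contact_functional T A P n \<alpha> (vfield_add_scaled X t (lie_bracket A V X))" for t
  let ?int = "\<lambda>i w. LINT x:chart_image (\<kappa> i)|lborel. \<rho> i (chart_inv (\<kappa> i) x) *\<^sub>R w (\<kappa> i) x"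
  have \<Phi>: "\<Phi> t = (\<Sum>i<N. ?int i (w t))" if "\<bar>t\<bar> < d" for t
  proof -
    have "\<Phi> t = form_integral T A P (w t)"
      unfolding \<Phi>_def contact_functional_eq
      by (rule form_integral_cong) (simp add: Ht chart_inv_topspace positive_chart w_def g_def m_def)
    then show ?thesis by (simp add: form_integral_eq[OF pou dw[OF that]])
  qed
  have int: "set_integrable lborel (chart_image (\<kappa> i)) (\<lambda>x. \<rho> i (chart_inv (\<kappa> i) x) *\<^sub>R v (\<kappa> i) x)"
    if "density v" "i < N" for v i
  proof (rule density_integrable[OF _ pou_closed[OF pou that(2)] pou_support[OF pou that(2)] pou_chart[OF pou that(2)]])
    show "density (\<lambda>c x. \<rho> i (chart_inv c x) *\<^sub>R v c x)"
      using that(1) pou_continuous[OF pou that(2)] by (rule density_mult_function)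
    show "\<rho> i (chart_inv (\<kappa> i) x) *\<^sub>R v (\<kappa> i) x = 0"
      if "x \<in> chart_image (\<kappa> i)" "chart_inv (\<kappa> i) x \<notin> pou_support \<rho> i" for x
      using pou_outside[OF pou \<open>i < N\<close> chart_inv_topspace[OF positive_chart[OF pou_chart[OF pou \<open>i < N\<close>]] that(1)] that(2)] by simp
  qed
  \<comment> \<open>By \<open>divergence_contact\<close>, \<open>w'\<close> is minus the divergence
    of \<open>V\<close> weighted by \<open>H^-(n+1)\<close> and the contact density.\<close>
  have zero: "(\<Sum>i<N. ?int i w') = 0"
  proof -
    have "(\<Sum>i<N. LINT x:chart_image (\<kappa> i)|lborel. \<rho> i (chart_inv (\<kappa> i) x) *\<^sub>R
        (\<Sum>k\<in>UNIV. pderiv_at k (\<lambda>x. inverse (H (chart_inv (\<kappa> i) x) ^ (n + 1)) * of_real (g (\<kappa> i) x) * vfield_local V (\<kappa> i) x $ k) x)) = 0"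
    proof (rule divergence_theorem[OF pou, of "\<lambda>p. inverse (H p ^ (n + 1))" g V])
      show "smooth_on (chart_image c) (\<lambda>x. inverse (H (chart_inv c x) ^ (n + 1)))" if "c \<in> A" for c
        using that by (intro smooth_on_inverse smooth_on_power sH open_chart_image power_not_zero nzc)
      show "smooth_on (chart_image c) (g c)" if "c \<in> A" for c
        unfolding g_def by (rule smooth_on_contact_density[OF open_chart_image[OF that] smooth_oneform_local[OF \<alpha> that]])
      show "g c x = det (jacobian c c' (chart_inv c x)) * g c' (transition c c' x)"
        if "c \<in> A" "c' \<in> A" "x \<in> overlap c c'" for c c' x
        unfolding g_def by (rule contact_density_transition[OF \<alpha> that])
    qed (rule Vf(1))
    also have "(\<Sum>i<N. LINT x:chart_image (\<kappa> i)|lborel. \<rho> i (chart_inv (\<kappa> i) x) *\<^sub>R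
        (\<Sum>k\<in>UNIV. pderiv_at k (\<lambda>x. inverse (H (chart_inv (\<kappa> i) x) ^ (n + 1)) * of_real (g (\<kappa> i) x) * vfield_local V (\<kappa> i) x $ k) x))
        = (\<Sum>i<N. LINT x:chart_image (\<kappa> i)|lborel. - (\<rho> i (chart_inv (\<kappa> i) x) *\<^sub>R w' (\<kappa> i) x))"
    proof (intro sum.cong refl set_lebesgue_integral_cong allI impI)
      fix i assume "i \<in> {..<N}"
      then have c: "\<kappa> i \<in> A" using positive_chart pou_chart[OF pou] by auto
      show "chart_image (\<kappa> i) \<in> sets lborel" using open_chart_image[OF c] by simp
      fix x assume x: "x \<in> chart_image (\<kappa> i)"
      have "(\<Sum>k\<in>UNIV. pderiv_at k (\<lambda>x. inverse (H (chart_inv (\<kappa> i) x) ^ (n + 1)) * of_real (g (\<kappa> i) x) * vfield_local V (\<kappa> i) x $ k) x)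
          = - w' (\<kappa> i) x"
        unfolding H_def g_def w'_def w_def m_def K_def
        using divergence_contact[OF \<alpha> Vf(1) Xf c sf[OF c] f[OF c] x] nz chart_inv_topspace[OF c] by simp
      then show "\<rho> i (chart_inv (\<kappa> i) x) *\<^sub>R
        (\<Sum>k\<in>UNIV. pderiv_at k (\<lambda>x. inverse (H (chart_inv (\<kappa> i) x) ^ (n + 1)) * of_real (g (\<kappa> i) x) * vfield_local V (\<kappa> i) x $ k) x)
        = - (\<rho> i (chart_inv (\<kappa> i) x) *\<^sub>R w' (\<kappa> i) x)" by simp
    qed
    finally show ?thesis by (simp add: set_lebesgue_integral_def sum_negf)
  qed
  define D where "D = (\<Sum>i<N. LINT x:chart_image (\<kappa> i)|lborel. norm (\<rho> i (chart_inv (\<kappa> i) x) *\<^sub>R w 0 (\<kappa> i) x))"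
  have "norm (\<Phi> t - \<Phi> 0) \<le> (C * B\<^sup>2 * D) * t\<^sup>2" if t: "\<bar>t\<bar> < d" for t
  proof -
    \<comment> \<open>The remainder after the linear term. Its integral is all of
      \<open>\<Phi> t - \<Phi> 0\<close>, because the integral of \<open>w'\<close> is zero.\<close>
    define E where "E c x = w t c x - w 0 c x + of_real t * w' c x" for c x
    have w0: "\<bar>0::real\<bar> < d" using \<open>d > 0\<close> by simp
    have dE: "(\<lambda>x. \<rho> i (chart_inv (\<kappa> i) x) *\<^sub>R E (\<kappa> i) x) = (\<lambda>x. \<rho> i (chart_inv (\<kappa> i) x) *\<^sub>R w t (\<kappa> i) x
         - \<rho> i (chart_inv (\<kappa> i) x) *\<^sub>R w 0 (\<kappa> i) x + of_real t * (\<rho> i (chart_inv (\<kappa> i) x) *\<^sub>R w' (\<kappa> i) x))" for i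
      by (simp add: E_def scaleR_conv_of_real algebra_simps)
    have iE: "set_integrable lborel (chart_image (\<kappa> i)) (\<lambda>x. \<rho> i (chart_inv (\<kappa> i) x) *\<^sub>R E (\<kappa> i) x)"
      and eE: "?int i E = ?int i (w t) - ?int i (w 0) + of_real t * ?int i w'" if "i < N" for i
    proof -
      note i = int[OF dw[OF t] that] int[OF dw[OF w0] that] set_integrable_mult_right[OF int[OF dw' that], of "of_real t"]
      show "set_integrable lborel (chart_image (\<kappa> i)) (\<lambda>x. \<rho> i (chart_inv (\<kappa> i) x) *\<^sub>R E (\<kappa> i) x)"
        unfolding dE by (rule set_integral_add(1)[OF set_integral_diff(1)[OF i(1,2)] i(3)])
      show "?int i E = ?int i (w t) - ?int i (w 0) + of_real t * ?int i w'"
        unfolding dE set_integral_add(2)[OF set_integral_diff(1)[OF i(1,2)] i(3)]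
          set_integral_diff(2)[OF i(1,2)] set_integral_mult_right ..
    qed
    have E: "norm (E c x) \<le> (C * B\<^sup>2 * t\<^sup>2) * norm (w 0 c x)" if c: "c \<in> A" "x \<in> chart_image c" for c x
    proof -
      let ?p = "chart_inv c x"
      let ?z = "of_real t * (K ?p / H ?p)"
      have p: "?p \<in> topspace T" by (rule chart_inv_topspace[OF c])
      note sm = small[OF t p]
      have h: "H ?p \<noteq> 0" using nzc[OF c] .
      have "H ?p + of_real t * K ?p = H ?p * (1 + ?z)" using h by (simp add: field_simps)
      then have "w t c x = inverse ((1 + ?z) ^ m) * w 0 c x"
        by (simp add: w_def power_mult_distrib)
      then have "E c x = (inverse ((1 + ?z) ^ m) - 1 + of_nat m * ?z) * w 0 c x"
        by (simp add: E_def w'_def algebra_simps)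
      then have "norm (E c x) = norm (inverse ((1 + ?z) ^ m) - 1 + of_nat m * ?z) * norm (w 0 c x)"
        by (simp only: norm_mult)
      also have "norm (inverse ((1 + ?z) ^ m) - 1 + of_nat m * ?z) \<le> C * (norm ?z)\<^sup>2"
        using sm by (intro C(2)) blast
      also have "C * (norm ?z)\<^sup>2 \<le> C * (B * \<bar>t\<bar>)\<^sup>2"
        using sm C(1) by (intro mult_left_mono power_mono) auto
      finally show ?thesis by (simp add: power_mult_distrib mult.assoc mult_right_mono)
    qed
    have "\<Phi> t - \<Phi> 0 = (\<Sum>i<N. ?int i E)"
      using zero by (simp add: \<Phi>[OF t] \<Phi>[OF w0] eE sum.distrib sum_subtractf flip: sum_distrib_left)
    also have "norm \<dots> \<le> (\<Sum>i<N. norm (?int i E))" by (rule norm_sum)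
    also have "\<dots> \<le> (\<Sum>i<N. (C * B\<^sup>2 * t\<^sup>2) * (LINT x:chart_image (\<kappa> i)|lborel. norm (\<rho> i (chart_inv (\<kappa> i) x) *\<^sub>R w 0 (\<kappa> i) x)))"
    proof (rule sum_mono)
      fix i assume "i \<in> {..<N}" then have i: "i < N" by simp
      have c: "\<kappa> i \<in> A" using positive_chart pou_chart[OF pou i] by blast
      have "norm (?int i E) \<le> (LINT x:chart_image (\<kappa> i)|lborel. norm (\<rho> i (chart_inv (\<kappa> i) x) *\<^sub>R E (\<kappa> i) x))"
        by (rule set_integral_norm_bound[OF iE[OF i]])
      also have "\<dots> \<le> (LINT x:chart_image (\<kappa> i)|lborel. (C * B\<^sup>2 * t\<^sup>2) * norm (\<rho> i (chart_inv (\<kappa> i) x) *\<^sub>R w 0 (\<kappa> i) x))"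
      proof (rule set_integral_mono)
        show "set_integrable lborel (chart_image (\<kappa> i)) (\<lambda>x. norm (\<rho> i (chart_inv (\<kappa> i) x) *\<^sub>R E (\<kappa> i) x))"
          by (rule set_integrable_norm[OF iE[OF i]])
        show "set_integrable lborel (chart_image (\<kappa> i)) (\<lambda>x. (C * B\<^sup>2 * t\<^sup>2) * norm (\<rho> i (chart_inv (\<kappa> i) x) *\<^sub>R w 0 (\<kappa> i) x))"
          by (rule set_integrable_mult_right[OF set_integrable_norm[OF int[OF dw[OF w0] i]]])
        fix x assume x: "x \<in> chart_image (\<kappa> i)"
        show "norm (\<rho> i (chart_inv (\<kappa> i) x) *\<^sub>R E (\<kappa> i) x) \<le> (C * B\<^sup>2 * t\<^sup>2) * norm (\<rho> i (chart_inv (\<kappa> i) x) *\<^sub>R w 0 (\<kappa> i) x)"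
          using mult_left_mono[OF E[OF c x] abs_ge_zero[of "\<rho> i (chart_inv (\<kappa> i) x)"]] by (simp add: mult_ac)
      qed
      also have "\<dots> = (C * B\<^sup>2 * t\<^sup>2) * (LINT x:chart_image (\<kappa> i)|lborel. norm (\<rho> i (chart_inv (\<kappa> i) x) *\<^sub>R w 0 (\<kappa> i) x))"
        by (rule set_integral_mult_right)
      finally show "norm (?int i E) \<le> (C * B\<^sup>2 * t\<^sup>2) * (LINT x:chart_image (\<kappa> i)|lborel. norm (\<rho> i (chart_inv (\<kappa> i) x) *\<^sub>R w 0 (\<kappa> i) x))" .
    qed
    finally show ?thesis by (simp add: D_def sum_distrib_left mult_ac)
  qed
  then show ?thesis
    using has_vector_derivative_zero[OF \<open>d > 0\<close>, of \<Phi>] unfolding \<Phi>_def by blast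
qed

text \<open>Two contact forms are proportional, \<open>\<beta> = h \<alpha>\<close>, and the integrand itself does not change:
  the factor \<open>h\<^sup>n\<^sup>+\<^sup>1\<close> from the volume form cancels the one from the Hamiltonian.\<close>

lemma contact_form_integrand:
  assumes \<alpha>: "contact_form T A n \<xi> \<alpha>" and \<beta>: "contact_form T A n \<xi> \<beta>" and X: "vector_field T A X"
    and c: "c \<in> A" and x: "x \<in> chart_image c"
  shows "inverse (oneform_apply \<beta> X (chart_inv c x) ^ (n + 1)) * of_real (contact_density n (oneform_local A \<beta> c) x) =
    inverse (oneform_apply \<alpha> X (chart_inv c x) ^ (n + 1)) * of_real (contact_density n (oneform_local A \<alpha> c) x)"
proof -
  let ?a = "oneform_local A \<alpha> c" and ?b = "oneform_local A \<beta> c"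
  note U = open_chart_image[OF c]
  have o\<alpha>: "one_form T A \<alpha>" and o\<beta>: "one_form T A \<beta>" using \<alpha> \<beta> by (auto simp: contact_form_def)
  have nonzero: "a y \<noteq> 0" if "contact_density n a y \<noteq> 0" for a :: "real^'d::_ \<Rightarrow> real^'d::_" and y
    using that by (auto simp: contact_density_def form1_def wedge_def)
  have a0: "?a y \<noteq> 0" and b0: "?b y \<noteq> 0" if "y \<in> chart_image c" for y
  proof -
    have "contact_density n ?a y \<noteq> 0" "contact_density n ?b y \<noteq> 0"
      using \<alpha> \<beta> c that unfolding contact_form_def by blast+
    then show "?a y \<noteq> 0" "?b y \<noteq> 0" using nonzero[of ?a] nonzero[of ?b] by blast+
  qed
  \<comment> \<open>The coefficient of the orthogonal projection of \<open>?b y\<close> onto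
    \<open>?a y\<close>. This formula, unlike the mere existence of a factor, shows that
    \<open>h\<close> is smooth.\<close>
  define h where "h y = (?b y \<bullet> ?a y) * inverse (?a y \<bullet> ?a y)" for y
  have bh: "?b y = h y *\<^sub>R ?a y" if y: "y \<in> chart_image c" for y
  proof -
    let ?p = "chart_inv c y"
    note p = chart_inv_in[OF y] chart_map_inv[OF y] chart_inv_topspace[OF c y]
    \<comment> \<open>The part of \<open>?b y\<close> orthogonal to \<open>?a y\<close>. As a
      tangent vector it lies in the kernel of \<open>\<alpha>\<close>, which is \<open>\<xi>\<close>
      and hence the kernel of \<open>\<beta>\<close>; so it is orthogonal to \<open>?b y\<close>
      too, and therefore to itself.\<close>
    define u where "u = ?b y - h y *\<^sub>R ?a y"
    have "?a y \<bullet> u = 0" using a0[OF y] by (simp add: u_def h_def inner_diff_right inner_commute)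
    then have "\<alpha> ?p (tangent_of A c ?p u) = 0" using one_form_tangent_of[OF o\<alpha> c p(1)] p(2) by simp
    then have "tangent_of A c ?p u \<in> \<xi> ?p" using \<alpha> p tangent_of_in[OF c p(1)] by (simp add: contact_form_def)
    then have "\<beta> ?p (tangent_of A c ?p u) = 0" using \<beta> p by (auto simp: contact_form_def)
    then have "?b y \<bullet> u = 0" using one_form_tangent_of[OF o\<beta> c p(1)] p(2) by simp
    then have "u \<bullet> u = 0" using \<open>?a y \<bullet> u = 0\<close> by (metis u_def inner_diff_left inner_scaleR_left diff_zero mult_zero_right)
    then show ?thesis by (simp add: u_def)
  qed
  have h0: "h y \<noteq> 0" if "y \<in> chart_image c" for y using bh[OF that] b0[OF that] by auto
  have sa: "smooth_on (chart_image c) ?a" and sb: "smooth_on (chart_image c) ?b"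
    using smooth_oneform_local[OF o\<alpha> c] smooth_oneform_local[OF o\<beta> c] .
  have sh: "smooth_on (chart_image c) h"
    unfolding h_def
    by (intro smooth_on_mult smooth_on_inverse smooth_on_bilinear[OF _ bounded_bilinear_inner] U sa sb) (use a0 in auto)
  have d: "?a differentiable (at x)" "?b differentiable (at x)" "h differentiable (at x)"
    using smooth_on_imp_differentiable[OF sa x] smooth_on_imp_differentiable[OF sb x] smooth_on_imp_differentiable[OF sh x] .
  have pb: "pderiv_at i ?b x = h x *\<^sub>R pderiv_at i ?a x + pderiv_at i h x *\<^sub>R ?a x" for i
    using pderiv_at_cong[OF U x bh d(2)] pderiv_at_bilinear[OF bounded_bilinear_scaleR d(3,1)] by simp
  \<comment> \<open>This is \<open>d\<beta> = h d\<alpha> + dh \<and> \<alpha>\<close>. The last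
    term is written as \<open>(dh / h) \<and> (h \<alpha>)\<close>, so that
    \<open>contact_top_add_skew\<close> removes it next to the 1-form
    \<open>h \<alpha>\<close>.\<close>
  have "curl ?b x = h x *\<^sub>R curl ?a x + skew (\<chi> i. pderiv_at i h x / h x) (h x *\<^sub>R ?a x)"
    using h0[OF x] by (simp add: curl_def skew_def pb vec_eq_iff algebra_simps)
  then have "contact_density n ?b x = contact_top n (h x *\<^sub>R ?a x) (h x *\<^sub>R curl ?a x) std_frame"
    unfolding contact_density_eq[OF d(2)] bh[OF x] by (simp add: contact_top_add_skew[OF card])
  then have 1: "contact_density n ?b x = h x ^ (n + 1) * contact_density n ?a x"
    by (simp add: contact_top_scale contact_density_eq[OF d(1)])
  have 2: "oneform_apply \<beta> X (chart_inv c x) = of_real (h x) * oneform_apply \<alpha> X (chart_inv c x)"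
    unfolding oneform_apply_chart[OF o\<alpha> X c x] oneform_apply_chart[OF o\<beta> X c x] bh[OF x]
    by (simp add: sum_distrib_left mult.assoc)
  have cancel: "inverse ((r * z) ^ k) * (r ^ k * y) = inverse (z ^ k) * y" if "r \<noteq> 0" for r z y :: complex and k
  proof -
    have "inverse ((r * z) ^ k) * (r ^ k * y) = (inverse (r ^ k) * r ^ k) * (inverse (z ^ k) * y)"
      by (simp only: power_mult_distrib inverse_mult_distrib mult_ac)
    then show ?thesis using that by simp
  qed
  show ?thesis unfolding 1 2 of_real_mult of_real_power by (rule cancel) (use h0[OF x] in simp)
qed

end

theorem corollary3p5:
  fixes T :: "'m topology"
    and A P :: "('m, 'd::{finite,wellorder}) chart set"
    and n :: nat
    and \<xi> :: "'m \<Rightarrow> ('m, 'd, real) tangent set"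
    and \<alpha> :: "('m, 'd) oneform"
  assumes "n \<ge> 1" and "CARD('d) = 2 * n + 1"
    and "smooth_manifold T A" and "compact_space T" and "orientation T A P"
    and "contact_structure T A n \<xi>" and "contact_form T A n \<xi> \<alpha>"
  shows "CVect_invariant T A \<alpha> (contact_functional T A P n \<alpha>) \<and>
         (\<forall>\<beta>. contact_form T A n \<xi> \<beta> \<longrightarrow>
            (\<forall>X \<in> CVect_star T A \<alpha>.
               contact_functional T A P n \<beta> X = contact_functional T A P n \<alpha> X))"
proof -
  interpret contact_manifold T A P n
    using assms by unfold_locales
  have \<alpha>: "one_form T A \<alpha>" using assms by (simp add: contact_form_def)
  show ?thesis
  proof (intro conjI allI impI ballI)
    show "CVect_invariant T A \<alpha> (contact_functional T A P n \<alpha>)"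
      unfolding CVect_invariant_def using contact_functional_invariant[OF \<alpha>] by blast
    fix \<beta> X assume \<beta>: "contact_form T A n \<xi> \<beta>" and "X \<in> CVect_star T A \<alpha>"
    then have X: "vector_field T A X" by (simp add: CVect_star_def CVect_def)
    show "contact_functional T A P n \<beta> X = contact_functional T A P n \<alpha> X"
      unfolding contact_functional_eq
      by (rule form_integral_cong) (rule contact_form_integrand[OF assms(7) \<beta> X positive_chart])
  qed
qed

end
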